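(* Let $R$ be a $(2^{\aleph_0})^+$-saturated o-minimal expansion of an ordered field, let $\mathbb{R}_{\mathrm{ind}}$ be the structure on $\mathbb{R}$ induced from $R$ by the standard part map (see context), and let $n\ge 1$. The closed subsets of $\mathbb{R}^n$ that are definable (with parameters) in $\mathbb{R}_{\mathrm{ind}}$ are exactly the sets $\operatorname{st}(X)$ with $X\subseteq R^n$ definable in $R$.
   Context: $R$ is a $(2^{\aleph_0})^+$-saturated o-minimal expansion of an ordered field (necessarily real closed). "Definable" means definable with parameters in $R$, unless another structure is specified. $\mathcal{O}=\{a\in R: |a|\le k\text{ for some }k\in\mathbb{N}\}$ is the convex hull of $\mathbb{Q}$ in $R$. The standard part map $\operatorname{st}:\mathcal{O}\to\mathbb{R}$ sends $a$ to the unique real infinitely close to it (it is an ordered ring homomorphism with kernel the infinitesimals $\{a: |a|\le 1/k\text{ for all integers }k>0\}$); it induces coordinatewise $\operatorname{st}:\mathcal{O}^n\to\mathbb{R}^n$. For $X\subseteq R^n$ put $\operatorname{st}(X):=\operatorname{st}(X\cap\mathcal{O}^n)$. $\mathbb{R}_{\mathrm{ind}}$ is the structure with underlying set $\mathbb{R}$ whose basic relations are all sets $\operatorname{st}(X)$ with $X\subseteq R^n$ definable in $R$, $n=0,1,2,\dots$. *)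

theory Defs
  imports "HOL-Analysis.Analysis"
begin

unbundle cardinal_syntax

text \<open>
  First-order structures with domain a type. An \<open>n\<close>-tuple is an extensional function on
  \<open>{..<n}\<close>, so the \<open>n\<close>-th Cartesian power of a set \<open>A\<close> is \<open>{..<n} \<rightarrow>\<^sub>E A\<close>. Interpretations are
  only ever evaluated at tuples whose length is the arity of the symbol.
\<close>

record ('f, 'r, 'a) fo_struct =
  fsyms :: "'f set"
  farity :: "'f \<Rightarrow> nat"
  finterp :: "'f \<Rightarrow> (nat \<Rightarrow> 'a) \<Rightarrow> 'a"
  rsyms :: "'r set"
  rarity :: "'r \<Rightarrow> nat"
  rinterp :: "'r \<Rightarrow> (nat \<Rightarrow> 'a) set"

definition tuple_of :: "'a list \<Rightarrow> nat \<Rightarrow> 'a" where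
  "tuple_of xs = restrict (\<lambda>i. xs ! i) {..<length xs}"

text \<open>\<open>Par a\<close> is the constant symbol naming the element \<open>a\<close> of the domain.\<close>

datatype ('f, 'a) trm = Var nat | Par 'a | App 'f "('f, 'a) trm list"

datatype ('f, 'r, 'a) fm =
    Eq "('f, 'a) trm" "('f, 'a) trm"
  | Rel 'r "('f, 'a) trm list"
  | Neg "('f, 'r, 'a) fm"
  | Conj "('f, 'r, 'a) fm" "('f, 'r, 'a) fm"
  | Ex nat "('f, 'r, 'a) fm"

text \<open>Terms and formulas of the language of \<open>M\<close> expanded by names for the elements of \<open>A\<close>.\<close>

fun is_trm :: "('f, 'r, 'a) fo_struct \<Rightarrow> 'a set \<Rightarrow> ('f, 'a) trm \<Rightarrow> bool" where
  "is_trm M A (Var i) \<longleftrightarrow> True"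
| "is_trm M A (Par a) \<longleftrightarrow> a \<in> A"
| "is_trm M A (App f ts) \<longleftrightarrow>
     f \<in> fsyms M \<and> length ts = farity M f \<and> (\<forall>t\<in>set ts. is_trm M A t)"

fun is_fm :: "('f, 'r, 'a) fo_struct \<Rightarrow> 'a set \<Rightarrow> ('f, 'r, 'a) fm \<Rightarrow> bool" where
  "is_fm M A (Eq s t) \<longleftrightarrow> is_trm M A s \<and> is_trm M A t"
| "is_fm M A (Rel r ts) \<longleftrightarrow>
     r \<in> rsyms M \<and> length ts = rarity M r \<and> (\<forall>t\<in>set ts. is_trm M A t)"
| "is_fm M A (Neg \<phi>) \<longleftrightarrow> is_fm M A \<phi>"
| "is_fm M A (Conj \<phi> \<psi>) \<longleftrightarrow> is_fm M A \<phi> \<and> is_fm M A \<psi>"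
| "is_fm M A (Ex i \<phi>) \<longleftrightarrow> is_fm M A \<phi>"

fun fv_trm :: "('f, 'a) trm \<Rightarrow> nat set" where
  "fv_trm (Var i) = {i}"
| "fv_trm (Par a) = {}"
| "fv_trm (App f ts) = (\<Union>t\<in>set ts. fv_trm t)"

fun fv :: "('f, 'r, 'a) fm \<Rightarrow> nat set" where
  "fv (Eq s t) = fv_trm s \<union> fv_trm t"
| "fv (Rel r ts) = (\<Union>t\<in>set ts. fv_trm t)"
| "fv (Neg \<phi>) = fv \<phi>"
| "fv (Conj \<phi> \<psi>) = fv \<phi> \<union> fv \<psi>"
| "fv (Ex i \<phi>) = fv \<phi> - {i}"

primrec eval_trm :: "('f, 'r, 'a) fo_struct \<Rightarrow> (nat \<Rightarrow> 'a) \<Rightarrow> ('f, 'a) trm \<Rightarrow> 'a" where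
  "eval_trm M e (Var i) = e i"
| "eval_trm M e (Par a) = a"
| "eval_trm M e (App f ts) = finterp M f (tuple_of (map (eval_trm M e) ts))"

primrec sat :: "('f, 'r, 'a) fo_struct \<Rightarrow> (nat \<Rightarrow> 'a) \<Rightarrow> ('f, 'r, 'a) fm \<Rightarrow> bool" where
  "sat M e (Eq s t) \<longleftrightarrow> eval_trm M e s = eval_trm M e t"
| "sat M e (Rel r ts) \<longleftrightarrow> tuple_of (map (eval_trm M e) ts) \<in> rinterp M r"
| "sat M e (Neg \<phi>) \<longleftrightarrow> \<not> sat M e \<phi>"
| "sat M e (Conj \<phi> \<psi>) \<longleftrightarrow> sat M e \<phi> \<and> sat M e \<psi>"
| "sat M e (Ex i \<phi>) \<longleftrightarrow> (\<exists>a. sat M (e(i := a)) \<phi>)"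

text \<open>\<open>X\<close> is a subset of the \<open>n\<close>-th power of the domain definable in \<open>M\<close>, with parameters.\<close>

definition definable :: "('f, 'r, 'a) fo_struct \<Rightarrow> nat \<Rightarrow> (nat \<Rightarrow> 'a) set \<Rightarrow> bool" where
  "definable M n X \<longleftrightarrow>
     (\<exists>\<phi>. is_fm M UNIV \<phi> \<and> fv \<phi> \<subseteq> {..<n} \<and> X = {x \<in> {..<n} \<rightarrow>\<^sub>E UNIV. sat M x \<phi>})"

text \<open>
  \<open>\<kappa>\<close>-saturation: every finitely satisfiable set of formulas in one free variable over fewer than
  \<open>\<kappa>\<close> parameters is realized. The size of the language is not restricted.
\<close>

definition saturated :: "'k rel \<Rightarrow> ('f, 'r, 'a) fo_struct \<Rightarrow> bool" where
  "saturated \<kappa> M \<longleftrightarrow>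
     (\<forall>A \<Phi>. |A| <o \<kappa> \<longrightarrow> (\<forall>\<phi>\<in>\<Phi>. is_fm M A \<phi> \<and> fv \<phi> \<subseteq> {0}) \<longrightarrow>
        (\<forall>\<Psi>. \<Psi> \<subseteq> \<Phi> \<longrightarrow> finite \<Psi> \<longrightarrow> (\<exists>a. \<forall>\<phi>\<in>\<Psi>. sat M (\<lambda>_. a) \<phi>)) \<longrightarrow>
        (\<exists>a. \<forall>\<phi>\<in>\<Phi>. sat M (\<lambda>_. a) \<phi>))"

text \<open>
  The order, addition and multiplication of the field are among the primitives of \<open>M\<close>; zero, one
  and subtraction are then definable without parameters, so they are not required to be primitives.
\<close>

definition expands_ordered_field :: "('f, 'r, 'a::linordered_field) fo_struct \<Rightarrow> bool" where
  "expands_ordered_field M \<longleftrightarrow>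
     (\<exists>r\<in>rsyms M. rarity M r = 2 \<and> (\<forall>x y. tuple_of [x, y] \<in> rinterp M r \<longleftrightarrow> x < y)) \<and>
     (\<exists>f\<in>fsyms M. farity M f = 2 \<and> (\<forall>x y. finterp M f (tuple_of [x, y]) = x + y)) \<and>
     (\<exists>f\<in>fsyms M. farity M f = 2 \<and> (\<forall>x y. finterp M f (tuple_of [x, y]) = x * y))"

definition open_interval :: "'a::linorder set \<Rightarrow> bool" where
  "open_interval I \<longleftrightarrow>
     I = UNIV \<or> (\<exists>a. I = {a<..}) \<or> (\<exists>b. I = {..<b}) \<or> (\<exists>a b. I = {a<..<b})"

text \<open>
  Density and the absence of endpoints, usually part of the definition of o-minimality, hold in
  every ordered field.
\<close>

definition o_minimal :: "('f, 'r, 'a::linordered_field) fo_struct \<Rightarrow> bool" where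
  "o_minimal M \<longleftrightarrow>
     (\<forall>X. definable M 1 X \<longrightarrow>
        (\<exists>F. finite F \<and> (\<forall>I\<in>F. (\<exists>a. I = {a}) \<or> open_interval I) \<and> (\<lambda>x. x 0) ` X = \<Union>F))"

definition finite_elems :: "'a::linordered_field set" where
  "finite_elems = {a. \<exists>k::nat. \<bar>a\<bar> \<le> of_nat k}"

text \<open>
  A field element and a real number live in different fields, so that their difference is
  infinitesimal is expressed through common rational approximations.
\<close>

definition infinitely_close :: "'a::linordered_field \<Rightarrow> real \<Rightarrow> bool" where
  "infinitely_close a r \<longleftrightarrow>
     (\<forall>k::nat. k > 0 \<longrightarrow>
        (\<exists>q::rat. \<bar>a - of_rat q\<bar> \<le> 1 / of_nat k \<and> \<bar>r - of_rat q\<bar> \<le> 1 / of_nat k))"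

lemma infinitely_close_ex1:
  fixes a :: "'a::linordered_field"
  assumes "a \<in> finite_elems"
  shows "\<exists>!r. infinitely_close a r"
proof (rule ex_ex1I)
  obtain N :: nat where N: "\<bar>a\<bar> \<le> of_nat N"
    using assms by (auto simp: finite_elems_def)
  define Q where "Q = {of_rat q :: real | q. of_rat q \<le> a}"
  have approx: "\<exists>q::rat. of_rat q \<le> a \<and> a < of_rat (q + 1 / of_nat k)" if k: "k > 0" for k :: nat
  proof -
    define P where "P j \<longleftrightarrow> of_nat k * a < of_int (int j - int (N * k))" for j
    have k0: "(of_nat k :: 'a) > 0" using k by simp
    have "of_nat k * a \<le> of_nat k * of_nat N"
      using N k0 by (intro mult_left_mono) auto
    also have "\<dots> < of_int (int (2 * N * k + 1) - int (N * k))"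
      by (simp add: algebra_simps)
    finally have "P (2 * N * k + 1)" unfolding P_def .
    then have P: "P (LEAST j. P j)" by (rule LeastI)
    have "of_nat k * (- a) \<le> of_nat k * of_nat N"
      using N k0 by (intro mult_left_mono) auto
    then have "\<not> P 0" by (simp add: P_def algebra_simps)
    then obtain i where i: "(LEAST j. P j) = Suc i"
      using P by (metis not0_implies_Suc)
    then have "\<not> P i" by (metis lessI not_less_Least)
    define m where "m = int i - int (N * k)"
    have lo: "of_int m \<le> of_nat k * a"
      using \<open>\<not> P i\<close> by (simp add: P_def m_def)
    have hi: "of_nat k * a < of_int (m + 1)"
      using P unfolding i by (simp add: P_def m_def algebra_simps)
    have "of_rat (of_int m / of_nat k) \<le> a"
      using lo k0 by (simp add: of_rat_divide field_simps)
    moreover have "a < of_rat (of_int m / of_nat k + 1 / of_nat k)"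
      using hi k0 by (simp add: of_rat_divide of_rat_add field_simps)
    ultimately show ?thesis by blast
  qed
  have "infinitely_close a (Sup Q)"
    unfolding infinitely_close_def
  proof (intro allI impI)
    fix k :: nat assume k: "k > 0"
    obtain q where q: "of_rat q \<le> a" "a < of_rat (q + 1 / of_nat k)"
      using approx[OF k] by blast
    have le: "x \<le> of_rat (q + 1 / of_nat k)" if "x \<in> Q" for x
    proof -
      obtain p where p: "x = of_rat p" "of_rat p \<le> a" using \<open>x \<in> Q\<close> unfolding Q_def by blast
      then have "(of_rat p :: 'a) < of_rat (q + 1 / of_nat k)" using q by (meson le_less_trans)
      then have "p < q + 1 / of_nat k" by (simp only: of_rat_less)
      then show ?thesis unfolding p(1) of_rat_less_eq by simp
    qed
    have inQ: "of_rat q \<in> Q" using q by (auto simp: Q_def)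
    have "of_rat q \<le> Sup Q" by (rule cSup_upper) (use le inQ in \<open>auto simp only: bdd_above_def\<close>)
    moreover have "Sup Q \<le> of_rat (q + 1 / of_nat k)" by (rule cSup_least) (use le inQ in auto)
    ultimately have "\<bar>Sup Q - of_rat q\<bar> \<le> 1 / of_nat k"
      by (simp add: of_rat_add of_rat_divide)
    moreover have "\<bar>a - of_rat q\<bar> \<le> 1 / of_nat k"
      using q by (simp add: of_rat_add of_rat_divide)
    ultimately show "\<exists>q::rat. \<bar>a - of_rat q\<bar> \<le> 1 / of_nat k \<and> \<bar>Sup Q - of_rat q\<bar> \<le> 1 / of_nat k"
      by blast
  qed
  then show "\<exists>r. infinitely_close a r" ..
next
  fix r s assume rs: "infinitely_close a r" "infinitely_close a s"
  have "\<bar>r - s\<bar> \<le> 4 * inverse (real (Suc k))" for k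
  proof -
    obtain p where p: "\<bar>a - of_rat p\<bar> \<le> 1 / of_nat (Suc k)" "\<bar>r - of_rat p\<bar> \<le> 1 / of_nat (Suc k)"
      using rs(1) unfolding infinitely_close_def by blast
    obtain q where q: "\<bar>a - of_rat q\<bar> \<le> 1 / of_nat (Suc k)" "\<bar>s - of_rat q\<bar> \<le> 1 / of_nat (Suc k)"
      using rs(2) unfolding infinitely_close_def by blast
    define d :: rat where "d = 1 / of_nat (Suc k)"
    have d: "(of_rat d :: 'a) = 1 / of_nat (Suc k)" "(of_rat d :: real) = 1 / of_nat (Suc k)"
      by (simp_all only: d_def of_rat_divide of_rat_1 of_rat_of_nat_eq)
    have "(of_rat (p - q) :: 'a) \<le> of_rat (d + d)" "(of_rat (q - p) :: 'a) \<le> of_rat (d + d)"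
      using p(1) q(1) unfolding d(1)[symmetric] of_rat_add of_rat_diff by linarith+
    then have "(of_rat (p - q) :: real) \<le> of_rat (d + d)" "(of_rat (q - p) :: real) \<le> of_rat (d + d)"
      unfolding of_rat_less_eq by auto
    then have "\<bar>r - s\<bar> \<le> 4 * of_rat d"
      using p(2) q(2) unfolding d(2)[symmetric] of_rat_add of_rat_diff by linarith
    then show ?thesis unfolding d(2) by (simp add: divide_inverse)
  qed
  then have "\<bar>r - s\<bar> \<le> 0"
    by (intro LIMSEQ_le_const[OF tendsto_mult_right_zero[OF LIMSEQ_inverse_real_of_nat, of 4]])
       (auto intro!: exI[of _ 0])
  then show "r = s" by simp
qed

definition standard_part :: "'a::linordered_field \<Rightarrow> real" where
  "standard_part a = (THE r. infinitely_close a r)"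

definition st_tuple :: "nat \<Rightarrow> (nat \<Rightarrow> 'a::linordered_field) \<Rightarrow> nat \<Rightarrow> real" where
  "st_tuple n x = restrict (\<lambda>i. standard_part (x i)) {..<n}"

definition st_set :: "nat \<Rightarrow> (nat \<Rightarrow> 'a::linordered_field) set \<Rightarrow> (nat \<Rightarrow> real) set" where
  "st_set n X = st_tuple n ` (X \<inter> ({..<n} \<rightarrow>\<^sub>E finite_elems))"

text \<open>
  The structure on the reals without function symbols whose relation symbols are the pairs of an
  arity \<open>n\<close> and a set \<open>st(X)\<close>, with \<open>X\<close> a definable set of \<open>n\<close>-tuples, each interpreted by that
  very set. (The arity is recorded because the empty set occurs with every arity.)
\<close>

definition R_ind ::
    "('f, 'r, 'a::linordered_field) fo_struct \<Rightarrow> (unit, nat \<times> (nat \<Rightarrow> real) set, real) fo_struct"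
  where
  "R_ind M = \<lparr>fsyms = {}, farity = (\<lambda>_. 0), finterp = (\<lambda>_ _. 0),
     rsyms = {(n, st_set n X) | n X. definable M n X}, rarity = fst, rinterp = snd\<rparr>"

end

theory Submission
  imports Defs
begin

text \<open>
  Call a set \<open>S\<close> of real \<open>n\<close>-tuples \<^emph>\<open>traced\<close> if it is the set of standard parts of those finite \<open>x\<close> such that
  \<open>Z x v\<close> for some appreciable \<open>v\<close>, where \<open>Z\<close> is definable and decreasing in \<open>v\<close>. Saturation
  provides an infinitesimal dominating any continuum of infinitesimals; as there are only continuum
  many real tuples, this shows that the sets \<open>st(X)\<close> and their complements are traced, that traced sets
  are closed under unions, intersections and projections, and that the closure of \<open>S\<close> is
  \<open>st({x. Z x r})\<close> for a large enough infinitesimal \<open>r\<close>.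

  For complements let \<open>f x\<close> be the supremum of the \<open>v\<close> with \<open>Z x v\<close>. By o-minimality the points that the
  closure adds to \<open>S\<close> lie in \<open>st({x. f x = v})\<close> for every large enough infinitesimal \<open>v\<close>. If \<open>v\<close> is moreover
  not in the definable closure of the parameters, then exchange shows that the dimension of
  \<open>{x. f x = v}\<close> is smaller than that of the domain of \<open>f\<close>, and induction on the dimension applies to the
  part of \<open>S\<close> inside this fibre. Hence all sets definable in the induced structure are traced, and the
  closed ones are of the form \<open>st(X)\<close>.
\<close>

section \<open>Definable predicates and definable closure\<close>

text \<open>With \<open>r\<close> fixed, a traced set is the union over k of the closed sets st({x.
  Z x (1/k)}), which increase with k. It is thus an F_sigma set, and the obstacle is that the
  complement of an F_sigma set is in general only G_delta. This is why complements need
  o-minimality. The two quantified elements absorb what R cannot express. The infinitesimal one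
  covers the gap between two points with the same standard part. The appreciable one keeps auxiliary
  witnesses finite and separates a point from a set. Saturation at the successor of the continuum
  matches the choices to be dominated: one infinitesimal for each real tuple. Dimension is not
  attached to definable sets but bounded pointwise, by the number of coordinates of \<open>x\<close>
  that generate the others over the parameters. Hence each new level \<open>v\<close> has to avoid
  the definable closure: as a parameter it then makes one generator redundant. Exchange, obtained
  from definable subsets of the line alone, takes the place of cell decomposition.\<close>

abbreviation tuples :: "nat \<Rightarrow> (nat \<Rightarrow> 'a) set" where
  "tuples n \<equiv> {..<n} \<rightarrow>\<^sub>E UNIV"

section \<open>Evaluation depends on free variables only; formulas have finitely many
  parameters\<close>

lemma eval_trm_cong:
  "(\<And>i. i \<in> fv_trm t \<Longrightarrow> e i = e' i) \<Longrightarrow> eval_trm M e t = eval_trm M e' t"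
proof (induction t)
  case (App f ts)
  then have "map (eval_trm M e) ts = map (eval_trm M e') ts"
    by (intro map_cong refl) auto
  then show ?case by (simp del: map_eq_conv)
qed auto

lemma map_eval_trm_cong:
  "(\<And>i. i \<in> (\<Union>t\<in>set ts. fv_trm t) \<Longrightarrow> e i = e' i) \<Longrightarrow> map (eval_trm M e) ts = map (eval_trm M e') ts"
  by (intro map_cong refl eval_trm_cong) auto

lemma sat_cong:
  "(\<And>i. i \<in> fv \<phi> \<Longrightarrow> e i = e' i) \<Longrightarrow> sat M e \<phi> \<longleftrightarrow> sat M e' \<phi>"
proof (induction \<phi> arbitrary: e e')
  case (Eq s t)
  have "eval_trm M e s = eval_trm M e' s" by (rule eval_trm_cong) (use Eq in auto)
  moreover have "eval_trm M e t = eval_trm M e' t" by (rule eval_trm_cong) (use Eq in auto)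
  ultimately show ?case by simp
next
  case (Rel r ts)
  have "map (eval_trm M e) ts = map (eval_trm M e') ts" by (rule map_eval_trm_cong) (use Rel in auto)
  then show ?case by (simp del: map_eq_conv)
next
  case (Conj \<phi> \<psi>)
  have "sat M e \<phi> \<longleftrightarrow> sat M e' \<phi>" by (rule Conj.IH(1)) (use Conj.prems in auto)
  moreover have "sat M e \<psi> \<longleftrightarrow> sat M e' \<psi>" by (rule Conj.IH(2)) (use Conj.prems in auto)
  ultimately show ?case by simp
next
  case (Ex i \<phi>)
  have "sat M (e(i := a)) \<phi> \<longleftrightarrow> sat M (e'(i := a)) \<phi>" for a
    by (rule Ex.IH) (use Ex.prems in auto)
  then show ?case by simp
next
  case (Neg \<phi>)
  have "sat M e \<phi> \<longleftrightarrow> sat M e' \<phi>" by (rule Neg.IH) (use Neg.prems in auto)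
  then show ?case by simp
qed

lemma finite_fv_trm: "finite (fv_trm t)"
  by (induction t) auto

lemma finite_fv: "finite (fv \<phi>)"
  by (induction \<phi>) (auto simp: finite_fv_trm)

lemma is_trm_mono: "is_trm M A t \<Longrightarrow> A \<subseteq> B \<Longrightarrow> is_trm M B t"
  by (induction t) auto

lemma is_fm_mono: "is_fm M A \<phi> \<Longrightarrow> A \<subseteq> B \<Longrightarrow> is_fm M B \<phi>"
  by (induction \<phi>) (auto intro: is_trm_mono)

lemma is_trm_finite_params: "is_trm M A t \<Longrightarrow> \<exists>B. finite B \<and> is_trm M B t"
proof (induction t)
  case (App f ts)
  then have "\<forall>t\<in>set ts. \<exists>B. finite B \<and> is_trm M B t" by auto
  then obtain B where B: "\<forall>t\<in>set ts. finite (B t) \<and> is_trm M (B t) t" by metis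
  then have "finite (\<Union>t\<in>set ts. B t)" "\<forall>t\<in>set ts. is_trm M (\<Union>t\<in>set ts. B t) t"
    by (auto elim!: is_trm_mono)
  with App.prems show ?case by (intro exI[of _ "\<Union>t\<in>set ts. B t"]) simp
qed (auto intro: exI[of _ "{}"] exI[of _ "{_}"])

lemma is_fm_finite_params: "is_fm M A \<phi> \<Longrightarrow> \<exists>B. finite B \<and> is_fm M B \<phi>"
proof (induction \<phi>)
  case (Eq s t)
  then obtain B C where "finite B" "is_trm M B s" "finite C" "is_trm M C t"
    using is_trm_finite_params by (metis is_fm.simps(1))
  then show ?case by (intro exI[of _ "B \<union> C"]) (auto elim: is_trm_mono)
next
  case (Rel r ts)
  then have "\<forall>t\<in>set ts. \<exists>B. finite B \<and> is_trm M B t" using is_trm_finite_params by fastforce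
  then obtain B where B: "\<forall>t\<in>set ts. finite (B t) \<and> is_trm M (B t) t" by metis
  then have "finite (\<Union>t\<in>set ts. B t)" "\<forall>t\<in>set ts. is_trm M (\<Union>t\<in>set ts. B t) t"
    by (auto elim!: is_trm_mono)
  with Rel.prems show ?case by (intro exI[of _ "\<Union>t\<in>set ts. B t"]) simp
next
  case (Conj \<phi> \<psi>)
  then obtain B C where "finite B" "is_fm M B \<phi>" "finite C" "is_fm M C \<psi>" by auto
  then show ?case by (intro exI[of _ "B \<union> C"]) (auto elim: is_fm_mono)
qed auto

section \<open>Simultaneous substitution of terms for free variables\<close>

primrec subst_trm :: "(nat \<Rightarrow> ('f, 'a) trm) \<Rightarrow> ('f, 'a) trm \<Rightarrow> ('f, 'a) trm" where
  "subst_trm s (Var i) = s i"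
| "subst_trm s (Par a) = Par a"
| "subst_trm s (App f ts) = App f (map (subst_trm s) ts)"

lemma eval_subst_trm: "eval_trm M e (subst_trm s t) = eval_trm M (\<lambda>i. eval_trm M e (s i)) t"
proof (induction t)
  case (App f ts)
  then have "map (eval_trm M e \<circ> subst_trm s) ts = map (eval_trm M (\<lambda>i. eval_trm M e (s i))) ts"
    by (intro map_cong) auto
  then show ?case by (simp del: map_eq_conv)
qed auto

lemma fv_subst_trm: "fv_trm (subst_trm s t) = (\<Union>i\<in>fv_trm t. fv_trm (s i))"
  by (induction t) auto

lemma is_trm_subst_trm:
  "is_trm M A t \<Longrightarrow> (\<And>i. i \<in> fv_trm t \<Longrightarrow> is_trm M A (s i)) \<Longrightarrow> is_trm M A (subst_trm s t)"
  by (induction t) auto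

text \<open>Stating the result up to satisfaction leaves bound variables free to be renamed. The
  terms \<open>s i\<close> are constrained at free variables only, so in the \<open>Ex\<close> case
  the bound variable can be sent to a fresh one.\<close>

lemma ex_subst_fm:
  assumes "is_fm M A \<phi>" "\<And>i. i \<in> fv \<phi> \<Longrightarrow> is_trm M A (s i)"
  shows "\<exists>\<psi>. is_fm M A \<psi> \<and> fv \<psi> \<subseteq> (\<Union>i\<in>fv \<phi>. fv_trm (s i)) \<and>
    (\<forall>e. sat M e \<psi> \<longleftrightarrow> sat M (\<lambda>i. eval_trm M e (s i)) \<phi>)"
  using assms
proof (induction \<phi> arbitrary: s)
  case (Eq t u)
  then show ?case
    by (intro exI[of _ "Eq (subst_trm s t) (subst_trm s u)"])
       (auto simp: eval_subst_trm fv_subst_trm is_trm_subst_trm)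
next
  case (Rel r ts)
  have "map (eval_trm M e \<circ> subst_trm s) ts = map (eval_trm M (\<lambda>i. eval_trm M e (s i))) ts" for e
    by (intro map_cong) (auto simp: eval_subst_trm)
  with Rel show ?case
    by (intro exI[of _ "Rel r (map (subst_trm s) ts)"])
       (auto simp: fv_subst_trm simp del: map_eq_conv intro!: is_trm_subst_trm)
next
  case (Neg \<phi>)
  obtain \<psi> where "is_fm M A \<psi>" "fv \<psi> \<subseteq> (\<Union>i\<in>fv \<phi>. fv_trm (s i))"
    "\<forall>e. sat M e \<psi> \<longleftrightarrow> sat M (\<lambda>i. eval_trm M e (s i)) \<phi>"
    using Neg.IH[of s] Neg.prems by auto
  then show ?case by (intro exI[of _ "Neg \<psi>"]) auto
next
  case (Conj \<phi>1 \<phi>2)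
  obtain \<psi>1 where "is_fm M A \<psi>1" "fv \<psi>1 \<subseteq> (\<Union>i\<in>fv \<phi>1. fv_trm (s i))"
    "\<forall>e. sat M e \<psi>1 \<longleftrightarrow> sat M (\<lambda>i. eval_trm M e (s i)) \<phi>1"
    using Conj.IH(1)[of s] Conj.prems by auto
  moreover obtain \<psi>2 where "is_fm M A \<psi>2" "fv \<psi>2 \<subseteq> (\<Union>i\<in>fv \<phi>2. fv_trm (s i))"
    "\<forall>e. sat M e \<psi>2 \<longleftrightarrow> sat M (\<lambda>i. eval_trm M e (s i)) \<phi>2"
    using Conj.IH(2)[of s] Conj.prems by auto
  ultimately show ?case by (intro exI[of _ "Conj \<psi>1 \<psi>2"]) auto
next
  case (Ex k \<phi>)
  \<comment> \<open>\<open>j\<close> occurs in no term substituted for a free variable other than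
    \<open>k\<close>, so renaming the bound \<open>k\<close> to \<open>j\<close> captures
    nothing.\<close>
  obtain j where j: "j \<notin> (\<Union>i\<in>fv \<phi> - {k}. fv_trm (s i))"
    using ex_new_if_finite[OF infinite_UNIV_nat, of "\<Union>i\<in>fv \<phi> - {k}. fv_trm (s i)"]
    by (auto simp: finite_fv finite_fv_trm)
  have "is_trm M A ((s(k := Var j)) i)" if "i \<in> fv \<phi>" for i
    using Ex.prems that by auto
  with Ex.IH[of "s(k := Var j)"] Ex.prems
  obtain \<psi> where \<psi>: "is_fm M A \<psi>" "fv \<psi> \<subseteq> (\<Union>i\<in>fv \<phi>. fv_trm ((s(k := Var j)) i))"
    "\<And>e. sat M e \<psi> \<longleftrightarrow> sat M (\<lambda>i. eval_trm M e ((s(k := Var j)) i)) \<phi>"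
    by auto
  have "sat M (\<lambda>i. eval_trm M (e(j := a)) ((s(k := Var j)) i)) \<phi> \<longleftrightarrow>
        sat M ((\<lambda>i. eval_trm M e (s i))(k := a)) \<phi>" for e a
    by (rule sat_cong) (use j in \<open>auto intro!: eval_trm_cong\<close>)
  moreover have "fv \<psi> - {j} \<subseteq> (\<Union>i\<in>fv \<phi> - {k}. fv_trm (s i))"
    using \<psi>(2) by (auto split: if_splits)
  ultimately show ?case using \<psi>(1,3) by (intro exI[of _ "Ex j \<psi>"]) auto
qed

section \<open>Calculus of definable predicates on environments\<close>

definition term_fun :: "('f, 'r, 'a) fo_struct \<Rightarrow> 'a set \<Rightarrow> ((nat \<Rightarrow> 'a) \<Rightarrow> 'a) \<Rightarrow> bool" where
  "term_fun M A F \<longleftrightarrow> (\<exists>t. is_trm M A t \<and> (\<forall>e. eval_trm M e t = F e))"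

text \<open>Formulas enter later arguments only through their meaning: definability is then derived
  by rules that follow the shape of a HOL predicate on environments, without writing any formula
  down.\<close>

definition definable_pred :: "('f, 'r, 'a) fo_struct \<Rightarrow> 'a set \<Rightarrow> ((nat \<Rightarrow> 'a) \<Rightarrow> bool) \<Rightarrow> bool" where
  "definable_pred M A P \<longleftrightarrow> (\<exists>\<phi>. is_fm M A \<phi> \<and> (\<forall>e. sat M e \<phi> \<longleftrightarrow> P e))"

lemma definable_pred_mono: "definable_pred M A P \<Longrightarrow> A \<subseteq> B \<Longrightarrow> definable_pred M B P"
  unfolding definable_pred_def by (meson is_fm_mono)

lemma term_fun_var: "term_fun M A (\<lambda>e. e i)"
  unfolding term_fun_def by (intro exI[of _ "Var i"]) auto

lemma term_fun_const: "a \<in> A \<Longrightarrow> term_fun M A (\<lambda>_. a)"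
  unfolding term_fun_def by (intro exI[of _ "Par a"]) auto

lemma definable_pred_subst:
  assumes "definable_pred M A P" "\<And>i. term_fun M A (F i)"
  shows "definable_pred M A (\<lambda>e. P (\<lambda>i. F i e))"
proof -
  obtain \<phi> where \<phi>: "is_fm M A \<phi>" "\<And>e. sat M e \<phi> \<longleftrightarrow> P e"
    using assms(1) unfolding definable_pred_def by auto
  obtain s where s: "\<And>i. is_trm M A (s i)" "\<And>i e. eval_trm M e (s i) = F i e"
    using assms(2) unfolding term_fun_def by metis
  obtain \<psi> where \<psi>: "is_fm M A \<psi>" "\<And>e. sat M e \<psi> \<longleftrightarrow> sat M (\<lambda>i. eval_trm M e (s i)) \<phi>"
    using ex_subst_fm[OF \<phi>(1), of s] s(1) by blast
  have "sat M e \<psi> \<longleftrightarrow> P (\<lambda>i. F i e)" for e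
    unfolding \<psi>(2) \<phi>(2) s(2) ..
  with \<psi>(1) show ?thesis unfolding definable_pred_def by blast
qed

lemma definable_pred_not: "definable_pred M A P \<Longrightarrow> definable_pred M A (\<lambda>e. \<not> P e)"
proof -
  assume "definable_pred M A P"
  then obtain \<phi> where "is_fm M A \<phi>" "\<forall>e. sat M e \<phi> \<longleftrightarrow> P e" unfolding definable_pred_def by auto
  then show ?thesis unfolding definable_pred_def by (intro exI[of _ "Neg \<phi>"]) auto
qed

lemma definable_pred_conj:
  assumes "definable_pred M A P" "definable_pred M A Q"
  shows "definable_pred M A (\<lambda>e. P e \<and> Q e)"
proof -
  obtain \<phi> \<psi> where "is_fm M A \<phi>" "\<forall>e. sat M e \<phi> \<longleftrightarrow> P e" "is_fm M A \<psi>" "\<forall>e. sat M e \<psi> \<longleftrightarrow> Q e"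
    using assms unfolding definable_pred_def by auto
  then show ?thesis unfolding definable_pred_def by (intro exI[of _ "Conj \<phi> \<psi>"]) auto
qed

lemma definable_pred_disj:
  assumes "definable_pred M A P" "definable_pred M A Q"
  shows "definable_pred M A (\<lambda>e. P e \<or> Q e)"
  using definable_pred_not[OF definable_pred_conj[OF assms[THEN definable_pred_not]]] by simp

lemma definable_pred_imp:
  assumes "definable_pred M A P" "definable_pred M A Q"
  shows "definable_pred M A (\<lambda>e. P e \<longrightarrow> Q e)"
  using definable_pred_disj[OF definable_pred_not[OF assms(1)] assms(2)] by simp

lemma definable_pred_eq:
  assumes "term_fun M A F" "term_fun M A G"
  shows "definable_pred M A (\<lambda>e. F e = G e)"
proof -
  obtain t u where "is_trm M A t" "\<forall>e. eval_trm M e t = F e" "is_trm M A u" "\<forall>e. eval_trm M e u = G e"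
    using assms unfolding term_fun_def by auto
  then show ?thesis unfolding definable_pred_def by (intro exI[of _ "Eq t u"]) auto
qed

lemma definable_pred_const: "definable_pred M A (\<lambda>_. b)"
proof -
  have "definable_pred M A (\<lambda>e. e 0 = e 0)" by (intro definable_pred_eq term_fun_var)
  then have "definable_pred M A (\<lambda>_. True)" by simp
  then show ?thesis using definable_pred_not[of M A "\<lambda>_. True"] by (cases b) simp_all
qed

text \<open>De Bruijn convention: in the premise the witness is variable 0 and the old environment
  is shifted up by one.\<close>

lemma definable_pred_ex:
  assumes "definable_pred M A (\<lambda>e. Q (e 0) (\<lambda>i. e (Suc i)))"
  shows "definable_pred M A (\<lambda>e. \<exists>a. Q a e)"
proof -
  obtain \<phi> where \<phi>: "is_fm M A \<phi>" "\<And>e. sat M e \<phi> \<longleftrightarrow> Q (e 0) (\<lambda>i. e (Suc i))"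
    using assms unfolding definable_pred_def by auto
  \<comment> \<open>\<open>Ex 0\<close> overwrites variable 0 and thus speaks about the tail of the
    environment; substituting variable \<open>i - 1\<close> for \<open>i\<close> undoes the
    shift.\<close>
  have "definable_pred M A (\<lambda>e. \<exists>a. Q a (\<lambda>i. e (Suc i)))"
    unfolding definable_pred_def using \<phi> by (intro exI[of _ "Ex 0 \<phi>"]) auto
  from definable_pred_subst[OF this, of "\<lambda>i e. e (i - 1)"] show ?thesis by (simp add: term_fun_var)
qed

lemma definable_pred_all:
  assumes "definable_pred M A (\<lambda>e. Q (e 0) (\<lambda>i. e (Suc i)))"
  shows "definable_pred M A (\<lambda>e. \<forall>a. Q a e)"
  using definable_pred_not[OF definable_pred_ex[OF definable_pred_not[OF assms]]] by simp

lemma definable_pred_ball_less: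
  fixes n :: nat
  shows "(\<And>i. i < n \<Longrightarrow> definable_pred M A (P i)) \<Longrightarrow> definable_pred M A (\<lambda>e. \<forall>i<n. P i e)"
proof (induction n)
  case 0
  then show ?case by (simp add: definable_pred_const)
next
  case (Suc n)
  then have "definable_pred M A (\<lambda>e. (\<forall>i<n. P i e) \<and> P n e)"
    by (intro definable_pred_conj) auto
  then show ?case by (simp add: All_less_Suc conj_commute)
qed

text \<open>Block form of the same convention: the tuple occupies the variables below
  \<open>n\<close> and the old environment is shifted by \<open>n\<close>. The last coordinate is
  bound outside the shorter tuple, so it is variable 0 once that tuple is quantified away.\<close>

lemma definable_pred_ex_tuple:
  fixes M :: "('f, 'r, 'a) fo_struct"
  shows "definable_pred M A (\<lambda>e. Q (\<lambda>i\<in>{..<n}. e i) (\<lambda>i. e (i + n))) \<Longrightarrow>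
   definable_pred M A (\<lambda>e. \<exists>x\<in>tuples n. Q x e)"
proof (induction n arbitrary: Q)
  case 0
  have "tuples 0 = {\<lambda>i. undefined}" by (simp add: PiE_empty_domain)
  with 0 show ?case by (simp add: restrict_def)
next
  case (Suc n)
  have *: "(\<lambda>i\<in>{..<Suc n}. e i) = (\<lambda>i\<in>{..<n}. e i)(n := e n)" for e :: "nat \<Rightarrow> 'a"
    by (auto simp: fun_eq_iff)
  have "definable_pred M A (\<lambda>e. \<exists>x\<in>tuples n. Q (x(n := e 0)) (\<lambda>i. e (Suc i)))"
    by (rule Suc.IH) (use Suc.prems[unfolded *] in \<open>simp only: add_Suc_right add_Suc add_0\<close>)
  then have "definable_pred M A (\<lambda>e. \<exists>a. \<exists>x\<in>tuples n. Q (x(n := a)) e)"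
    by (rule definable_pred_ex)
  moreover have "(\<exists>x\<in>tuples (Suc n). Q x e) \<longleftrightarrow> (\<exists>a. \<exists>x\<in>tuples n. Q (x(n := a)) e)" for e
  proof -
    have "tuples (Suc n) = (\<lambda>(a, x). x(n := a)) ` (UNIV \<times> (tuples n :: (nat \<Rightarrow> 'a) set))"
      by (simp add: lessThan_Suc PiE_insert_eq)
    then show ?thesis by (simp del: fun_upd_apply)
  qed
  ultimately show ?case by simp
qed

definition tuple_fun :: "('f, 'r, 'a) fo_struct \<Rightarrow> 'a set \<Rightarrow> nat \<Rightarrow> ((nat \<Rightarrow> 'a) \<Rightarrow> nat \<Rightarrow> 'a) \<Rightarrow> bool" where
  "tuple_fun M A n X \<longleftrightarrow> (\<forall>e. X e \<in> tuples n) \<and> (\<forall>i<n. term_fun M A (\<lambda>e. X e i))"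

lemma tuple_fun_vars: "tuple_fun M A n (\<lambda>e. \<lambda>i\<in>{..<n}. e (f i))"
  by (auto simp: tuple_fun_def term_fun_var)

lemma tuple_fun_const: "x \<in> tuples n \<Longrightarrow> x ` {..<n} \<subseteq> A \<Longrightarrow> tuple_fun M A n (\<lambda>_. x)"
  by (auto simp: tuple_fun_def term_fun_const)

text \<open>Abstracting the parameter \<open>b\<close> into the variable \<open>0\<close> shifts all variables, so nothing can be captured.\<close>

lemma ex_abstract_trm:
  "is_trm M (insert b A) t \<Longrightarrow> \<exists>u. is_trm M A u \<and> (\<forall>e. eval_trm M (case_nat b e) u = eval_trm M e t)"
proof (induction t)
  case (Var i)
  show ?case by (intro exI[of _ "Var (Suc i)"]) auto
next
  case (Par a)
  then show ?case
    by (cases "a = b") (auto intro: exI[of _ "Var 0"] exI[of _ "Par a"])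
next
  case (App f ts)
  then have "\<forall>t\<in>set ts. \<exists>u. is_trm M A u \<and> (\<forall>e. eval_trm M (case_nat b e) u = eval_trm M e t)"
    by auto
  then obtain g where g: "\<forall>t\<in>set ts. is_trm M A (g t) \<and> (\<forall>e. eval_trm M (case_nat b e) (g t) = eval_trm M e t)"
    by metis
  then have "map (eval_trm M (case_nat b e) \<circ> g) ts = map (eval_trm M e) ts" for e
    by auto
  with g App.prems show ?case
    by (intro exI[of _ "App f (map g ts)"]) (auto simp del: map_eq_conv)
qed

lemma ex_abstract_fm:
  fixes M :: "('f, 'r, 'a) fo_struct"
  shows "is_fm M (insert b A) \<phi> \<Longrightarrow> \<exists>\<psi>. is_fm M A \<psi> \<and> (\<forall>e. sat M (case_nat b e) \<psi> \<longleftrightarrow> sat M e \<phi>)"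
proof (induction \<phi>)
  case (Eq s t)
  then obtain s' t' where "is_trm M A s'" "\<forall>e. eval_trm M (case_nat b e) s' = eval_trm M e s"
      "is_trm M A t'" "\<forall>e. eval_trm M (case_nat b e) t' = eval_trm M e t"
    using ex_abstract_trm by (metis is_fm.simps(1))
  then show ?case by (intro exI[of _ "Eq s' t'"]) auto
next
  case (Rel r ts)
  then have "\<forall>t\<in>set ts. \<exists>u. is_trm M A u \<and> (\<forall>e. eval_trm M (case_nat b e) u = eval_trm M e t)"
    by (auto intro: ex_abstract_trm)
  then obtain g where g: "\<forall>t\<in>set ts. is_trm M A (g t) \<and> (\<forall>e. eval_trm M (case_nat b e) (g t) = eval_trm M e t)"
    by metis
  then have "map (eval_trm M (case_nat b e) \<circ> g) ts = map (eval_trm M e) ts" for e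
    by auto
  with g Rel.prems show ?case
    by (intro exI[of _ "Rel r (map g ts)"]) (auto simp del: map_eq_conv)
next
  case (Neg \<phi>)
  then obtain \<psi> where "is_fm M A \<psi>" "\<forall>e. sat M (case_nat b e) \<psi> \<longleftrightarrow> sat M e \<phi>" by auto
  then show ?case by (intro exI[of _ "Neg \<psi>"]) auto
next
  case (Conj \<phi>1 \<phi>2)
  then obtain \<psi>1 \<psi>2 where "is_fm M A \<psi>1" "\<forall>e. sat M (case_nat b e) \<psi>1 \<longleftrightarrow> sat M e \<phi>1"
    "is_fm M A \<psi>2" "\<forall>e. sat M (case_nat b e) \<psi>2 \<longleftrightarrow> sat M e \<phi>2" by auto
  then show ?case by (intro exI[of _ "Conj \<psi>1 \<psi>2"]) auto
next
  case (Ex i \<phi>)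
  then obtain \<psi> where \<psi>: "is_fm M A \<psi>" "\<forall>e. sat M (case_nat b e) \<psi> \<longleftrightarrow> sat M e \<phi>" by auto
  have "(case_nat b e)(Suc i := a) = case_nat b (e(i := a))" for e :: "nat \<Rightarrow> 'a" and a
    by (auto simp: fun_eq_iff split: nat.splits)
  with \<psi> show ?case by (intro exI[of _ "Ex (Suc i) \<psi>"]) auto
qed

lemma definable_pred_abstract:
  "definable_pred M (insert b A) P \<Longrightarrow> \<exists>Q. definable_pred M A Q \<and> (\<forall>e. Q (case_nat b e) \<longleftrightarrow> P e)"
proof -
  assume "definable_pred M (insert b A) P"
  then obtain \<phi> where \<phi>: "is_fm M (insert b A) \<phi>" "\<And>e. sat M e \<phi> \<longleftrightarrow> P e"
    unfolding definable_pred_def by auto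
  obtain \<psi> where \<psi>: "is_fm M A \<psi>" "\<And>e. sat M (case_nat b e) \<psi> \<longleftrightarrow> sat M e \<phi>"
    using ex_abstract_fm[OF \<phi>(1)] by blast
  show ?thesis
    by (rule exI[of _ "\<lambda>e. sat M e \<psi>"]) (use \<phi> \<psi> in \<open>auto simp: definable_pred_def\<close>)
qed

section \<open>Definable closure\<close>

definition dcl :: "('f, 'r, 'a) fo_struct \<Rightarrow> 'a set \<Rightarrow> 'a set" where
  "dcl M A = {a. definable_pred M A (\<lambda>e. e 0 = a)}"

lemma dcl_mono: "A \<subseteq> B \<Longrightarrow> dcl M A \<subseteq> dcl M B"
  by (auto simp: dcl_def intro: definable_pred_mono)

lemma subset_dcl: "A \<subseteq> dcl M A"
  by (auto simp: dcl_def intro: definable_pred_eq term_fun_var term_fun_const)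

text \<open>The parameter \<open>b\<close> is abstracted to a variable, which is then quantified out
  again, pinned to the one value that the definition of \<open>b\<close> over \<open>A\<close>
  allows.\<close>

lemma definable_pred_dcl_insert:
  fixes M :: "('f, 'r, 'a) fo_struct"
  assumes "definable_pred M (insert b A) P" "b \<in> dcl M A"
  shows "definable_pred M A P"
proof -
  obtain Q where Q: "definable_pred M A Q" "\<And>e. Q (case_nat b e) \<longleftrightarrow> P e"
    using definable_pred_abstract[OF assms(1)] by auto
  have "definable_pred M A (\<lambda>e. e 0 = b)" using assms(2) by (simp add: dcl_def)
  moreover have "case_nat (e 0) (\<lambda>i. e (Suc i)) = e" for e :: "nat \<Rightarrow> 'a"
    by (auto simp: fun_eq_iff split: nat.splits)
  ultimately have "definable_pred M A (\<lambda>e. e 0 = b \<and> Q (case_nat (e 0) (\<lambda>i. e (Suc i))))"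
    using Q(1) by (simp add: definable_pred_conj)
  then have "definable_pred M A (\<lambda>e. \<exists>a. a = b \<and> Q (case_nat a e))"
    by (rule definable_pred_ex)
  then show ?thesis by (simp add: Q(2))
qed

text \<open>Parameters are removed one at a time, hence the finiteness of \<open>B\<close>; in the
  applications \<open>B\<close> consists of coordinates of a tuple.\<close>

lemma definable_pred_dcl_Un:
  "finite B \<Longrightarrow> definable_pred M (A \<union> B) P \<Longrightarrow> B \<subseteq> dcl M A \<Longrightarrow> definable_pred M A P"
proof (induction B rule: finite_induct)
  case (insert b B)
  then have "b \<in> dcl M (A \<union> B)" using dcl_mono[of A "A \<union> B" M] by blast
  then have "definable_pred M (A \<union> B) P" using insert.prems by (auto intro: definable_pred_dcl_insert)
  then show ?case using insert by auto
qed auto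

lemma dcl_trans: "finite B \<Longrightarrow> a \<in> dcl M (A \<union> B) \<Longrightarrow> B \<subseteq> dcl M A \<Longrightarrow> a \<in> dcl M A"
  using definable_pred_dcl_Un[of B M A "\<lambda>e. e 0 = a"] by (simp add: dcl_def[of M A] dcl_def[of M "A \<union> B"])

section \<open>Standard parts\<close>

abbreviation continuum_sized :: "'b set \<Rightarrow> bool" where
  "continuum_sized A \<equiv> |A| \<le>o ctwo ^c natLeq"

lemma Cinfinite_continuum: "Cinfinite (ctwo ^c natLeq)"
  by (intro Cinfinite_cexp natLeq_Cinfinite ordLeq_refl Card_order_ctwo)

lemma continuum_sized_subset: "A \<subseteq> B \<Longrightarrow> continuum_sized B \<Longrightarrow> continuum_sized A"
  by (meson card_of_mono1 ordLeq_transitive)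

lemma continuum_sized_image: "continuum_sized A \<Longrightarrow> continuum_sized (f ` A)"
  by (meson card_of_image ordLeq_transitive)

lemma continuum_sized_Un: "continuum_sized A \<Longrightarrow> continuum_sized B \<Longrightarrow> continuum_sized (A \<union> B)"
  by (rule Un_Cinfinite_bound[OF _ _ Cinfinite_continuum])

text \<open>The cardinal power unfolds to the cardinality of the type of functions from
  \<open>nat\<close> to \<open>bool\<close>.\<close>

lemma continuum_sized_inj:
  assumes "inj_on (f :: 'b \<Rightarrow> nat \<Rightarrow> bool) A"
  shows "continuum_sized A"
proof -
  have "ctwo ^c natLeq = |UNIV :: (nat \<Rightarrow> bool) set|"
    by (simp add: cexp_def ctwo_def Func_def Field_natLeq Field_card_of)
  moreover have "|A| \<le>o |UNIV :: (nat \<Rightarrow> bool) set|"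
    using assms card_of_ordLeq[of A "UNIV :: (nat \<Rightarrow> bool) set"] by auto
  ultimately show ?thesis by simp
qed

lemma continuum_sized_countable:
  assumes "countable A"
  shows "continuum_sized A"
proof -
  obtain f :: "'a \<Rightarrow> nat" where "inj_on f A" using assms by (auto simp: countable_def)
  then have "inj_on (\<lambda>a i. i = f a) A" by (auto simp: inj_on_def fun_eq_iff)
  then show ?thesis by (rule continuum_sized_inj)
qed

text \<open>A real tuple is coded by the set of pairs (i, q) with q rational and below the i-th
  coordinate; density of the rationals makes the code injective.\<close>

lemma continuum_sized_real_tuples: "continuum_sized (tuples n :: (nat \<Rightarrow> real) set)"
proof -
  have "inj (\<lambda>(x :: nat \<Rightarrow> real) m. real_of_rat (snd (from_nat m :: nat \<times> rat)) < x (fst (from_nat m :: nat \<times> rat)))"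
  proof (rule injI, rule ext)
    fix x y :: "nat \<Rightarrow> real" and i
    assume "(\<lambda>m. real_of_rat (snd (from_nat m :: nat \<times> rat)) < x (fst (from_nat m :: nat \<times> rat))) =
      (\<lambda>m. real_of_rat (snd (from_nat m :: nat \<times> rat)) < y (fst (from_nat m :: nat \<times> rat)))"
    then have *: "real_of_rat q < x i \<longleftrightarrow> real_of_rat q < y i" for q
      by (drule_tac x = "to_nat (i, q)" in fun_cong) simp
    show "x i = y i"
    proof (rule ccontr)
      assume "x i \<noteq> y i"
      then consider "x i < y i" | "y i < x i" by linarith
      then show False
      proof cases
        case 1
        then obtain q where "x i < of_rat q" "of_rat q < y i" using of_rat_dense by blast
        then show False using *[of q] by simp
      next
        case 2
        then obtain q where "y i < of_rat q" "of_rat q < x i" using of_rat_dense by blast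
        then show False using *[of q] by simp
      qed
    qed
  qed
  then have "continuum_sized (UNIV :: (nat \<Rightarrow> real) set)" by (rule continuum_sized_inj)
  then show ?thesis by (rule continuum_sized_subset[rotated]) simp
qed

section \<open>Order and standard parts\<close>

lemma infinitely_close_standard_part:
  "a \<in> finite_elems \<Longrightarrow> infinitely_close a (standard_part a)"
  unfolding standard_part_def using theI'[OF infinitely_close_ex1] by blast

lemma standard_part_eq:
  "a \<in> finite_elems \<Longrightarrow> infinitely_close a r \<Longrightarrow> standard_part a = r"
  unfolding standard_part_def by (rule the1_equality[OF infinitely_close_ex1])

lemma ex_inverse_of_nat_less_rat: "(0 :: rat) < d \<Longrightarrow> \<exists>k::nat>0. 1 / of_nat k < d"
  using ex_inverse_of_nat_less[of d] by (auto simp: inverse_eq_divide)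

lemma of_rat_1_div: "of_rat (1 / of_nat k) = (1 / of_nat k :: 'a :: field_char_0)"
  by (simp add: of_rat_divide)

text \<open>Only rationals can be compared with elements of both fields, so the argument runs
  through a rational \<open>q'\<close> strictly between \<open>q\<close> and the standard part. The
  next lemma is the mirror image.\<close>

lemma standard_part_le_of_rat:
  fixes a :: "'a::linordered_field"
  assumes "a \<in> finite_elems" "a \<le> of_rat q"
  shows "standard_part a \<le> of_rat q"
proof (rule ccontr)
  assume "\<not> standard_part a \<le> of_rat q"
  then obtain q' where q': "real_of_rat q < of_rat q'" "of_rat q' < standard_part a"
    using of_rat_dense[of "of_rat q" "standard_part a"] by auto
  \<comment> \<open>The approximation \<open>p\<close> is off by up to 1/k on the real side and
    again on the side of \<open>a\<close>, so 1/k has to be less than half of the gap.\<close>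
  then have "0 < (q' - q) / 2" by (simp add: of_rat_less)
  then obtain k :: nat where k: "k > 0" "1 / of_nat k < (q' - q) / 2"
    using ex_inverse_of_nat_less_rat by blast
  obtain p where p: "\<bar>a - of_rat p\<bar> \<le> of_rat (1 / of_nat k)" "\<bar>standard_part a - of_rat p\<bar> \<le> of_rat (1 / of_nat k)"
    using infinitely_close_standard_part[OF assms(1)] k(1)
    unfolding infinitely_close_def of_rat_1_div by blast
  have "real_of_rat q' < of_rat (p + 1 / of_nat k)"
    using p(2) q'(2) unfolding of_rat_add by linarith
  then have "q' < p + 1 / of_nat k" by (simp only: of_rat_less)
  then have "q < p - 1 / of_nat k" using k(2) by (simp add: field_simps)
  then have "(of_rat q :: 'a) < of_rat (p - 1 / of_nat k)" by (simp only: of_rat_less)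
  also have "\<dots> \<le> a" using p(1) unfolding of_rat_diff by linarith
  finally show False using assms(2) by simp
qed

lemma of_rat_le_standard_part:
  fixes a :: "'a::linordered_field"
  assumes "a \<in> finite_elems" "of_rat q \<le> a"
  shows "of_rat q \<le> standard_part a"
proof (rule ccontr)
  assume "\<not> of_rat q \<le> standard_part a"
  then obtain q' where q': "standard_part a < of_rat q'" "real_of_rat q' < of_rat q"
    using of_rat_dense[of "standard_part a" "of_rat q"] by auto
  then have "0 < (q - q') / 2" by (simp add: of_rat_less)
  then obtain k :: nat where k: "k > 0" "1 / of_nat k < (q - q') / 2"
    using ex_inverse_of_nat_less_rat by blast
  obtain p where p: "\<bar>a - of_rat p\<bar> \<le> of_rat (1 / of_nat k)" "\<bar>standard_part a - of_rat p\<bar> \<le> of_rat (1 / of_nat k)"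
    using infinitely_close_standard_part[OF assms(1)] k(1)
    unfolding infinitely_close_def of_rat_1_div by blast
  have "real_of_rat (p - 1 / of_nat k) < of_rat q'"
    using p(2) q'(1) unfolding of_rat_diff by linarith
  then have "p - 1 / of_nat k < q'" by (simp only: of_rat_less)
  then have "p + 1 / of_nat k < q" using k(2) by (simp add: field_simps)
  then have "(of_rat (p + 1 / of_nat k) :: 'a) < of_rat q" by (simp only: of_rat_less)
  moreover have "a \<le> of_rat (p + 1 / of_nat k)" using p(1) unfolding of_rat_add by linarith
  ultimately show False using assms(2) by simp
qed

lemma standard_part_mono:
  assumes "a \<in> finite_elems" "b \<in> finite_elems" "a \<le> b"
  shows "standard_part a \<le> standard_part b"
proof (rule ccontr)
  assume "\<not> standard_part a \<le> standard_part b"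
  then obtain q where q: "standard_part b < of_rat q" "of_rat q < standard_part a"
    using of_rat_dense[of "standard_part b" "standard_part a"] by auto
  then have "\<not> of_rat q \<le> b" using of_rat_le_standard_part[OF assms(2), of q] by auto
  moreover have "\<not> a \<le> of_rat q" using standard_part_le_of_rat[OF assms(1), of q] q by auto
  ultimately show False using assms(3) by simp
qed

lemma finite_elems_diff_le:
  assumes "a \<in> finite_elems" "b \<le> a + of_nat k" "a \<le> b + of_nat k"
  shows "b \<in> finite_elems"
proof -
  obtain m where "\<bar>a\<bar> \<le> of_nat m" using assms(1) by (auto simp: finite_elems_def)
  then have "\<bar>b\<bar> \<le> of_nat (m + k)" using assms(2,3) unfolding of_nat_add by linarith
  then show ?thesis unfolding finite_elems_def by blast
qed

lemma inverse_of_nat_le_1: "1 / of_nat k \<le> (1 :: 'a :: linordered_field)"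
  by (cases "k = 0") (auto simp: field_simps)

lemma finite_elems_close:
  assumes "a \<in> finite_elems" "b \<le> a + 1 / of_nat k" "a \<le> b + 1 / of_nat k"
  shows "b \<in> finite_elems"
  by (rule finite_elems_diff_le[OF assms(1), of _ 1]) (use assms inverse_of_nat_le_1[of k, where 'a='a] in auto)

text \<open>All later error terms have the form 1/k, so compatibility with these shifts is the part
  of additivity that transfers inequalities with slack.\<close>

lemma standard_part_add_inverse:
  fixes a :: "'a::linordered_field"
  assumes "a \<in> finite_elems"
  shows "standard_part (a + 1 / of_nat k) = standard_part a + 1 / of_nat k"
proof (rule standard_part_eq)
  show "a + 1 / of_nat k \<in> finite_elems"
    by (rule finite_elems_close[OF assms, of _ k]) auto
  show "infinitely_close (a + 1 / of_nat k) (standard_part a + 1 / of_nat k)"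
    unfolding infinitely_close_def
  proof (intro allI impI)
    fix j :: nat assume "j > 0"
    then obtain q where q: "\<bar>a - of_rat q\<bar> \<le> 1 / of_nat j" "\<bar>standard_part a - of_rat q\<bar> \<le> 1 / of_nat j"
      using infinitely_close_standard_part[OF assms] unfolding infinitely_close_def by blast
    show "\<exists>q. \<bar>a + 1 / of_nat k - of_rat q\<bar> \<le> 1 / of_nat j \<and> \<bar>standard_part a + 1 / real k - of_rat q\<bar> \<le> 1 / real j"
      by (rule exI[of _ "q + 1 / of_nat k"]) (use q in \<open>simp add: of_rat_add of_rat_1_div\<close>)
  qed
qed

lemma standard_part_le_add:
  assumes "a \<in> finite_elems" "b \<in> finite_elems" "a \<le> b + 1 / of_nat k"
  shows "standard_part a \<le> standard_part b + 1 / real k"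
  using standard_part_mono[OF assms(1) _ assms(3)] finite_elems_close[OF assms(2), of "b + 1 / of_nat k" k]
    standard_part_add_inverse[OF assms(2), of k] by auto

text \<open>The premise has to be strict: elements with the same standard part may lie in either
  order.\<close>

lemma le_add_of_standard_part:
  assumes "a \<in> finite_elems" "b \<in> finite_elems" "standard_part a < standard_part b + 1 / real k"
  shows "a \<le> b + 1 / of_nat k"
proof (rule ccontr)
  assume "\<not> a \<le> b + 1 / of_nat k"
  then have "standard_part (b + 1 / of_nat k) \<le> standard_part a"
    using assms finite_elems_close[OF assms(2), of "b + 1 / of_nat k" k] by (intro standard_part_mono) auto
  then show False using assms standard_part_add_inverse[OF assms(2), of k] by auto
qed

section \<open>Infinitesimal and appreciable elements, and points near a real tuple\<close>

definition infinitesimal :: "'a::linordered_field \<Rightarrow> bool" where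
  "infinitesimal v \<longleftrightarrow> 0 < v \<and> (\<forall>k>0. v \<le> 1 / of_nat k)"

text \<open>Infinite elements are included, so that every positive element is either infinitesimal
  or appreciable.\<close>

definition appreciable :: "'a::linordered_field \<Rightarrow> bool" where
  "appreciable v \<longleftrightarrow> (\<exists>k>0. 1 / of_nat k \<le> v)"

lemma infinitesimal_or_appreciable: "0 < v \<Longrightarrow> infinitesimal v \<or> appreciable v"
  unfolding infinitesimal_def appreciable_def using linear by blast

lemma inverse_of_nat_mono: "0 < (j::nat) \<Longrightarrow> j \<le> k \<Longrightarrow> 1 / of_nat k \<le> (1 / of_nat j :: 'a :: linordered_field)"
  by (simp add: frac_le)

lemma inverse_of_nat_less: "0 < (j::nat) \<Longrightarrow> j < k \<Longrightarrow> 1 / of_nat k < (1 / of_nat j :: 'a :: linordered_field)"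
  by (simp add: frac_less2)

lemma infinitesimal_less_inverse:
  assumes "infinitesimal v" "k > 0"
  shows "v < 1 / of_nat k"
proof -
  have "v \<le> 1 / of_nat (Suc k)" using assms unfolding infinitesimal_def by blast
  also have "\<dots> < 1 / of_nat k" using assms by (intro inverse_of_nat_less) auto
  finally show ?thesis .
qed

lemma infinitesimal_less_appreciable: "infinitesimal v \<Longrightarrow> appreciable w \<Longrightarrow> v < w"
  unfolding appreciable_def using less_le_trans[OF infinitesimal_less_inverse] by blast

lemma appreciable_pos: "appreciable v \<Longrightarrow> 0 < v"
  unfolding appreciable_def by (auto elim!: less_le_trans[rotated])

lemma appreciable_mono: "appreciable v \<Longrightarrow> v \<le> w \<Longrightarrow> appreciable w"
  unfolding appreciable_def using order_trans[of _ v w] by blast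

lemma appreciable_inverse: "k > 0 \<Longrightarrow> appreciable (1 / of_nat k)"
  unfolding appreciable_def by auto

lemma appreciable_half:
  assumes "appreciable v"
  shows "appreciable (v / 2)"
proof -
  obtain k :: nat where "k > 0" "1 / of_nat k \<le> v" using assms unfolding appreciable_def by auto
  then have "1 / of_nat (2 * k) \<le> v / 2" using divide_right_mono[of "1 / of_nat k" v 2] by simp
  then show ?thesis using \<open>k > 0\<close> unfolding appreciable_def by (intro exI[of _ "2 * k"]) auto
qed

definition near :: "nat \<Rightarrow> (nat \<Rightarrow> 'a::linordered_field) \<Rightarrow> (nat \<Rightarrow> real) \<Rightarrow> bool" where
  "near n x p \<longleftrightarrow> (\<forall>i<n. x i \<in> finite_elems \<and> standard_part (x i) = p i)"

text \<open>In contrast to \<open>near\<close>, this is definable in R with \<open>r\<close> as a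
  variable. The two are linked by letting \<open>r\<close> be 1/k or an infinitesimal. Writing the
  bound with addition alone matches the primitives of the structure.\<close>

definition near_by :: "nat \<Rightarrow> (nat \<Rightarrow> 'a::linordered_field) \<Rightarrow> (nat \<Rightarrow> 'a) \<Rightarrow> 'a \<Rightarrow> bool" where
  "near_by n x y r \<longleftrightarrow> (\<forall>i<n. x i \<le> y i + r \<and> y i \<le> x i + r)"

lemma near_by_mono: "near_by n x y r \<Longrightarrow> r \<le> s \<Longrightarrow> near_by n x y s"
  unfolding near_by_def using order_trans[OF _ add_left_mono] by blast

lemma near_near_by_inverse:
  assumes "near n x p" "near n y q" "\<forall>i<n. \<bar>p i - q i\<bar> < 1 / real k"
  shows "near_by n x y (1 / of_nat k)"
  unfolding near_by_def
proof (intro allI impI)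
  fix i assume "i < n"
  with assms have *: "x i \<in> finite_elems" "y i \<in> finite_elems"
    "standard_part (x i) < standard_part (y i) + 1 / real k" 
    "standard_part (y i) < standard_part (x i) + 1 / real k"
    by (auto simp: near_def abs_less_iff algebra_simps)
  show "x i \<le> y i + 1 / of_nat k \<and> y i \<le> x i + 1 / of_nat k"
    using le_add_of_standard_part[OF *(1,2,3)] le_add_of_standard_part[OF *(2,1,4)] by blast
qed

lemma near_dist_le:
  assumes "near n x p" "near n y q" "near_by n x y (1 / of_nat k)" "i < n"
  shows "\<bar>p i - q i\<bar> \<le> 1 / real k"
  using assms standard_part_le_add[of "x i" "y i" k] standard_part_le_add[of "y i" "x i" k]
  by (auto simp: near_def near_by_def abs_le_iff algebra_simps)

lemma near_by_finite_elems:
  assumes "near n x p" "near_by n x y (1 / of_nat k)" "i < n"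
  shows "y i \<in> finite_elems"
  using assms finite_elems_close[of "x i" "y i" k] by (auto simp: near_def near_by_def)

lemma near_of_finite: "(\<And>i. i < n \<Longrightarrow> y i \<in> finite_elems) \<Longrightarrow> near n y (\<lambda>i\<in>{..<n}. standard_part (y i))"
  by (auto simp: near_def)

lemma real_eq_if_dist_le:
  fixes a b :: real
  assumes "\<And>k::nat. k > 0 \<Longrightarrow> \<bar>a - b\<bar> \<le> 1 / real k"
  shows "a = b"
proof (rule ccontr)
  assume "a \<noteq> b"
  then have "0 < \<bar>a - b\<bar>" by simp
  then obtain k :: nat where "k > 0" "inverse (of_nat k) < \<bar>a - b\<bar>"
    using ex_inverse_of_nat_less by blast
  then show False using assms[of k] by (simp add: inverse_eq_divide)
qed

text \<open>The displacement is below every 1/k, so the standard parts differ by at most 1/k for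
  every k.\<close>

lemma near_infinitesimal:
  assumes "near n x p" "near_by n x y r" "infinitesimal r"
  shows "near n y p"
proof -
  have w: "near_by n x y (1 / of_nat k)" if "k > 0" for k
    using assms(2,3) that near_by_mono unfolding infinitesimal_def by blast
  have fin: "y i \<in> finite_elems" if "i < n" for i
    using near_by_finite_elems[OF assms(1) w[of 1] that] by simp
  have "standard_part (y i) = p i" if i: "i < n" for i
  proof (rule real_eq_if_dist_le)
    fix k :: nat assume "k > 0"
    from near_dist_le[OF assms(1) near_of_finite[of n y, OF fin] w[OF this] i] i
    show "\<bar>standard_part (y i) - p i\<bar> \<le> 1 / real k" by auto
  qed
  with fin show ?thesis by (auto simp: near_def)
qed

lemma near_near_by_all:
  assumes "near n x p" "near n y p" "k > 0"
  shows "near_by n x y (1 / of_nat k)"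
  by (rule near_near_by_inverse[OF assms(1,2)]) (use assms in auto)

lemma near_near_by_appreciable: "near n x p \<Longrightarrow> near n y p \<Longrightarrow> appreciable v \<Longrightarrow> near_by n x y v"
  unfolding appreciable_def using near_near_by_all near_by_mono by blast

lemma st_set_iff:
  assumes "X \<subseteq> tuples n"
  shows "p \<in> st_set n X \<longleftrightarrow> p \<in> tuples n \<and> (\<exists>x\<in>X. near n x p)"
proof
  assume "p \<in> st_set n X"
  then obtain x where x: "x \<in> X" "x \<in> {..<n} \<rightarrow>\<^sub>E finite_elems" "p = st_tuple n x"
    unfolding st_set_def by auto
  then have "near n x p" by (auto simp: near_def st_tuple_def)
  with x show "p \<in> tuples n \<and> (\<exists>x\<in>X. near n x p)" by (auto simp: st_tuple_def)
next
  assume "p \<in> tuples n \<and> (\<exists>x\<in>X. near n x p)"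
  then obtain x where x: "p \<in> tuples n" "x \<in> X" "near n x p" by auto
  then have "x \<in> {..<n} \<rightarrow>\<^sub>E finite_elems"
    using assms by (auto simp: near_def PiE_iff)
  moreover have "p = st_tuple n x"
    using x by (auto simp: near_def st_tuple_def fun_eq_iff PiE_iff extensional_def)
  ultimately show "p \<in> st_set n X" using x unfolding st_set_def by blast
qed

section \<open>Saturation and o-minimality\<close>

lemma definable_of_pred:
  fixes M :: "('f, 'r, 'a) fo_struct"
  assumes "definable_pred M A P"
  shows "definable M n {x \<in> tuples n. P x}"
proof -
  obtain \<phi> where \<phi>: "is_fm M A \<phi>" "\<And>e. sat M e \<phi> \<longleftrightarrow> P e"
    using assms unfolding definable_pred_def by auto
  \<comment> \<open>Extensional tuples have the value \<open>undefined\<close> from index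
    \<open>n\<close> on, so this parameter is exactly what the variables outside the arity have to
    be replaced by.\<close>
  define s where "s i = (if i < n then Var i else Par undefined :: ('f, 'a) trm)" for i
  have *: "is_fm M UNIV \<phi>" using is_fm_mono[OF \<phi>(1)] by simp
  have s: "is_trm M UNIV (s i)" for i by (simp add: s_def)
  obtain \<psi> where \<psi>: "is_fm M UNIV \<psi>" "fv \<psi> \<subseteq> (\<Union>i\<in>fv \<phi>. fv_trm (s i))"
      "\<forall>e. sat M e \<psi> \<longleftrightarrow> sat M (\<lambda>i. eval_trm M e (s i)) \<phi>"
    using ex_subst_fm[OF *, of s, OF s] by (elim exE conjE) (rule that)
  have "fv \<psi> \<subseteq> {..<n}" using \<psi>(2) by (auto simp: s_def split: if_splits)
  moreover have "P x \<longleftrightarrow> sat M x \<psi>" if "x \<in> tuples n" for x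
  proof -
    have "(\<lambda>i. eval_trm M x (s i)) = x"
      using that by (auto simp: s_def fun_eq_iff PiE_iff extensional_def)
    then show ?thesis using \<psi>(3) \<phi>(2) by simp
  qed
  then have "{x \<in> tuples n. P x} = {x \<in> tuples n. sat M x \<psi>}" by blast
  ultimately show ?thesis using \<psi>(1) unfolding definable_def by (intro exI[of _ \<psi>]) simp
qed

lemma definable_pred_of_definable:
  assumes "definable M n X"
  obtains A where "finite A" "definable_pred M A (\<lambda>e. (\<lambda>i\<in>{..<n}. e i) \<in> X)" "X \<subseteq> tuples n"
proof -
  obtain \<phi> where \<phi>: "is_fm M UNIV \<phi>" "fv \<phi> \<subseteq> {..<n}" "X = {x \<in> tuples n. sat M x \<phi>}"
    using assms unfolding definable_def by blast
  obtain A where A: "finite A" "is_fm M A \<phi>" using is_fm_finite_params[OF \<phi>(1)] by blast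
  have "sat M e \<phi> \<longleftrightarrow> (\<lambda>i\<in>{..<n}. e i) \<in> X" for e
  proof -
    have "sat M e \<phi> \<longleftrightarrow> sat M (\<lambda>i\<in>{..<n}. e i) \<phi>"
      by (rule sat_cong) (use \<phi>(2) in auto)
    then show ?thesis using \<phi>(3) by auto
  qed
  then have "definable_pred M A (\<lambda>e. (\<lambda>i\<in>{..<n}. e i) \<in> X)"
    unfolding definable_pred_def using A(2) by (intro exI[of _ \<phi>]) simp
  then show ?thesis using that A(1) \<phi>(3) by blast
qed

lemma term_fun_binary:
  assumes "f \<in> fsyms M" "farity M f = 2" "term_fun M A F" "term_fun M A G"
  shows "term_fun M A (\<lambda>e. finterp M f (tuple_of [F e, G e]))"
proof -
  obtain t u where "is_trm M A t" "\<forall>e. eval_trm M e t = F e" "is_trm M A u" "\<forall>e. eval_trm M e u = G e"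
    using assms unfolding term_fun_def by auto
  then show ?thesis using assms unfolding term_fun_def by (intro exI[of _ "App f [t, u]"]) auto
qed

lemma definable_pred_binary:
  assumes "r \<in> rsyms M" "rarity M r = 2" "term_fun M A F" "term_fun M A G"
  shows "definable_pred M A (\<lambda>e. tuple_of [F e, G e] \<in> rinterp M r)"
proof -
  obtain t u where "is_trm M A t" "\<forall>e. eval_trm M e t = F e" "is_trm M A u" "\<forall>e. eval_trm M e u = G e"
    using assms unfolding term_fun_def by auto
  then show ?thesis using assms unfolding definable_pred_def by (intro exI[of _ "Rel r [t, u]"]) auto
qed

text \<open>Variables 0 and 1 carry the two elements and the tuple starts at variable 2, so that two
  quantified elements can be stripped off in front of it.\<close>

definition definable_rel ::
    "('f, 'r, 'a) fo_struct \<Rightarrow> 'a set \<Rightarrow> nat \<Rightarrow> ((nat \<Rightarrow> 'a) \<Rightarrow> 'a \<Rightarrow> 'a \<Rightarrow> bool) \<Rightarrow> bool" where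
  "definable_rel M A n Z \<longleftrightarrow> definable_pred M A (\<lambda>e. Z (\<lambda>i\<in>{..<n}. e (i + 2)) (e 0) (e 1))"

lemma definable_relD:
  fixes M :: "('f, 'r, 'a) fo_struct"
  assumes "definable_rel M A n Z" "A \<subseteq> B" "tuple_fun M B n X" "term_fun M B F" "term_fun M B G"
  shows "definable_pred M B (\<lambda>e. Z (X e) (F e) (G e))"
proof -
  have "definable_pred M B (\<lambda>e. Z (\<lambda>i\<in>{..<n}. e (i + 2)) (e 0) (e 1))"
    using assms(1,2) unfolding definable_rel_def by (rule definable_pred_mono)
  moreover have "term_fun M B (case i of 0 \<Rightarrow> F | Suc 0 \<Rightarrow> G
      | Suc (Suc j) \<Rightarrow> if j < n then (\<lambda>e. X e j) else (\<lambda>e. e 0))" for i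
    using assms(3-5) by (auto simp: tuple_fun_def term_fun_var split: nat.splits)
  ultimately have "definable_pred M B (\<lambda>e. Z (\<lambda>i\<in>{..<n}. if i < n then X e i else e 0) (F e) (G e))"
    by (drule_tac definable_pred_subst[where F = "\<lambda>i. case i of 0 \<Rightarrow> F | Suc 0 \<Rightarrow> G
      | Suc (Suc j) \<Rightarrow> if j < n then (\<lambda>e. X e j) else (\<lambda>e. e 0)"]) (auto simp: if_distribR cong: if_cong)
  moreover have "(\<lambda>i\<in>{..<n}. if i < n then X e i else e 0) = X e" for e
    using assms(3) by (auto simp: tuple_fun_def fun_eq_iff PiE_iff extensional_def)
  ultimately show ?thesis by simp
qed

locale saturated_o_minimal_field =
  fixes M :: "('f, 'r, 'a::linordered_field) fo_struct"
  assumes expands_ordered_field: "expands_ordered_field M"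
    and o_minimal: "o_minimal M"
    and saturated: "saturated (cardSuc (ctwo ^c natLeq)) M"
begin

lemma definable_pred_less:
  assumes "term_fun M A F" "term_fun M A G"
  shows "definable_pred M A (\<lambda>e. F e < G e)"
proof -
  obtain r where r: "r \<in> rsyms M" "rarity M r = 2" "\<forall>x y. tuple_of [x, y] \<in> rinterp M r \<longleftrightarrow> x < y"
    using expands_ordered_field unfolding expands_ordered_field_def by blast
  show ?thesis using definable_pred_binary[OF r(1,2) assms] r(3) by simp
qed

lemma definable_pred_le:
  assumes "term_fun M A F" "term_fun M A G"
  shows "definable_pred M A (\<lambda>e. F e \<le> G e)"
  using definable_pred_not[OF definable_pred_less[OF assms(2,1)]] by (simp add: not_less)

lemma term_fun_add:
  assumes "term_fun M A F" "term_fun M A G"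
  shows "term_fun M A (\<lambda>e. F e + G e)"
proof -
  obtain f where f: "f \<in> fsyms M" "farity M f = 2" "\<forall>x y. finterp M f (tuple_of [x, y]) = x + y"
    using expands_ordered_field unfolding expands_ordered_field_def by blast
  show ?thesis using term_fun_binary[OF f(1,2) assms] f(3) by simp
qed

lemma term_fun_mult:
  assumes "term_fun M A F" "term_fun M A G"
  shows "term_fun M A (\<lambda>e. F e * G e)"
proof -
  obtain f where f: "f \<in> fsyms M" "farity M f = 2" "\<forall>x y. finterp M f (tuple_of [x, y]) = x * y"
    using expands_ordered_field unfolding expands_ordered_field_def by blast
  show ?thesis using term_fun_binary[OF f(1,2) assms] f(3) by simp
qed

lemma definable_pred_near_by:
  assumes "tuple_fun M A n X" "tuple_fun M A n Y" "term_fun M A F"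
  shows "definable_pred M A (\<lambda>e. near_by n (X e) (Y e) (F e))"
  unfolding near_by_def using assms
  by (intro definable_pred_ball_less definable_pred_conj definable_pred_le term_fun_add)
     (auto simp: tuple_fun_def)

section \<open>Consequences of saturation\<close>

lemma realize:
  assumes A: "continuum_sized A"
    and def: "\<And>p. p \<in> P \<Longrightarrow> definable_pred M A (\<lambda>e. p (e 0))"
    and fin: "\<And>Q. finite Q \<Longrightarrow> Q \<subseteq> P \<Longrightarrow> \<exists>a. \<forall>p\<in>Q. p a"
  shows "\<exists>a. \<forall>p\<in>P. p a"
proof -
  define \<Phi> where "\<Phi> = {\<phi>. is_fm M A \<phi> \<and> fv \<phi> \<subseteq> {0} \<and> (\<exists>p\<in>P. \<forall>e. sat M e \<phi> \<longleftrightarrow> p (e 0))}"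
  have ex: "\<exists>\<phi>\<in>\<Phi>. \<forall>e. sat M e \<phi> \<longleftrightarrow> p (e 0)" if p: "p \<in> P" for p
  proof -
    obtain \<phi> where \<phi>: "is_fm M A \<phi>" "\<And>e. sat M e \<phi> \<longleftrightarrow> p (e 0)"
      using def[OF p] unfolding definable_pred_def by auto
    \<comment> \<open>The formula may mention other variables although its truth depends on
      \<open>e 0\<close> alone; replacing all of them by variable 0 gives the one-variable formula
      that saturation asks for.\<close>
    obtain \<psi> where \<psi>: "is_fm M A \<psi>" "fv \<psi> \<subseteq> {0}" "\<And>e. sat M e \<psi> \<longleftrightarrow> sat M (\<lambda>i. e 0) \<phi>"
      using ex_subst_fm[OF \<phi>(1), of "\<lambda>_. Var 0"] by (auto split: if_splits)
    then show ?thesis unfolding \<Phi>_def using p \<phi>(2) by (intro bexI[of _ \<psi>]) auto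
  qed
  have "|A| <o cardSuc (ctwo ^c natLeq)"
    using A cardSuc_ordLeq_ordLess[OF Card_order_cexp card_of_Card_order] by blast
  note sat = saturated[unfolded saturated_def, rule_format, OF this, of \<Phi>]
  have "\<forall>\<phi>\<in>\<Phi>. is_fm M A \<phi> \<and> fv \<phi> \<subseteq> {0}" unfolding \<Phi>_def by blast
  moreover have "\<exists>a. \<forall>\<phi>\<in>\<Psi>. sat M (\<lambda>_. a) \<phi>" if \<Psi>: "\<Psi> \<subseteq> \<Phi>" "finite \<Psi>" for \<Psi>
  proof -
    have "\<forall>\<phi>\<in>\<Psi>. \<exists>p\<in>P. \<forall>e. sat M e \<phi> \<longleftrightarrow> p (e 0)" using \<Psi>(1) unfolding \<Phi>_def by blast
    then obtain g where g: "\<forall>\<phi>\<in>\<Psi>. g \<phi> \<in> P \<and> (\<forall>e. sat M e \<phi> \<longleftrightarrow> g \<phi> (e 0))" by metis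
    then obtain a where "\<forall>p\<in>g ` \<Psi>. p a" using fin[of "g ` \<Psi>"] \<Psi>(2) by blast
    then show ?thesis using g by (intro exI[of _ a]) auto
  qed
  ultimately have "\<exists>a. \<forall>\<phi>\<in>\<Phi>. sat M (\<lambda>_. a) \<phi>"
    by (intro sat) auto
  then obtain a where a: "\<forall>\<phi>\<in>\<Phi>. sat M (\<lambda>_. a) \<phi>" ..
  have "p a" if p: "p \<in> P" for p
  proof -
    obtain \<phi> where \<phi>: "\<phi> \<in> \<Phi>" "\<And>e. sat M e \<phi> \<longleftrightarrow> p (e 0)" using ex[OF p] by blast
    show "p a" using a \<phi>(1) \<phi>(2)[of "\<lambda>_. a"] by blast
  qed
  then show ?thesis by blast
qed

text \<open>Finitely many of the required conditions hold on an interval minus a finite set, and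
  intervals of an ordered field are infinite. Every later choice of one infinitesimal for a
  continuum of points rests on this.\<close>

lemma ex_infinitesimal_greater:
  assumes A: "continuum_sized A" and I: "continuum_sized I"
    and le: "\<And>i k. i \<in> I \<Longrightarrow> k > 0 \<Longrightarrow> i \<le> 1 / of_nat k"
  shows "\<exists>v. infinitesimal v \<and> (\<forall>i\<in>I. i < v) \<and> v \<notin> dcl M A"
proof -
  define P where "P = (\<lambda>i v. i < v) ` insert 0 I \<union> (\<lambda>k v. v \<le> 1 / of_nat k) ` {k::nat. k > 0}
    \<union> (\<lambda>a v. v \<noteq> a) ` dcl M A"
  define B where "B = A \<union> I \<union> insert 0 (range (\<lambda>k::nat. 1 / of_nat k))"
  have B: "A \<subseteq> B" "I \<subseteq> B" "0 \<in> B" "\<And>k. 1 / of_nat k \<in> B" unfolding B_def by auto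
  have "\<exists>v. \<forall>p\<in>P. p v"
  proof (rule realize)
    show "continuum_sized B" unfolding B_def
      by (intro continuum_sized_Un A I continuum_sized_countable) auto
    have "definable_pred M B (\<lambda>e. i < e 0)" if "i \<in> insert 0 I" for i
      using that B by (intro definable_pred_less term_fun_var term_fun_const) auto
    moreover have "definable_pred M B (\<lambda>e. e 0 \<le> 1 / of_nat k)" for k
      using B by (intro definable_pred_le term_fun_var term_fun_const) auto
    \<comment> \<open>\<open>a\<close> is excluded through its definition over \<open>A\<close>, so
      the parameters stay of continuum size however large \<open>dcl M A\<close> is.\<close>
    moreover have "definable_pred M B (\<lambda>e. e 0 \<noteq> a)" if "a \<in> dcl M A" for a
      using that dcl_mono[OF B(1), of M] unfolding dcl_def by (auto intro: definable_pred_not)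
    ultimately show "definable_pred M B (\<lambda>e. p (e 0))" if "p \<in> P" for p
      using that unfolding P_def by (elim UnE imageE) simp_all
  next
    fix Q assume "finite Q" "Q \<subseteq> P"
    then have "\<exists>l F k0. finite F \<and> k0 > 0 \<and> (\<forall>k>0. l \<le> 1 / of_nat k) \<and>
      (\<forall>v. l < v \<and> v < 1 / of_nat k0 \<and> v \<notin> F \<longrightarrow> (\<forall>p\<in>Q. p v))"
    proof (induction Q rule: finite_induct)
      case empty
      show ?case by (intro exI[of _ 0] exI[of _ "{}"] exI[of _ 1]) auto
    next
      case (insert p Q)
      then obtain l F and k0 :: nat where IH: "finite F" "k0 > 0" "\<forall>k>0. l \<le> 1 / of_nat k"
        "\<forall>v. l < v \<and> v < 1 / of_nat k0 \<and> v \<notin> F \<longrightarrow> (\<forall>p\<in>Q. p v)" by auto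
      consider i where "i \<in> insert 0 I" "p = (\<lambda>v. i < v)" 
        | k::nat where "k > 0" "p = (\<lambda>v. v \<le> 1 / of_nat k)"
        | a where "p = (\<lambda>v. v \<noteq> a)"
        using insert.prems unfolding P_def by auto
      then show ?case
      proof cases
        case 1
        have "i \<le> 1 / of_nat k" if "k > 0" for k using 1(1) le that by auto
        then show ?thesis using IH 1
          by (intro exI[of _ "max l i"] exI[of _ F] exI[of _ k0]) auto
      next
        case 2
        have "v \<le> 1 / of_nat k" if "v < 1 / of_nat (max k k0)" for v :: 'a
          using that inverse_of_nat_mono[of k "max k k0", where 'a='a] 2(1) by auto
        moreover have "v < 1 / of_nat k0" if "v < 1 / of_nat (max k k0)" for v :: 'a
          using that inverse_of_nat_mono[of k0 "max k k0", where 'a='a] IH(2) by auto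
        ultimately show ?thesis using IH 2
          by (intro exI[of _ l] exI[of _ F] exI[of _ "max k k0"]) auto
      next
        case 3
        then show ?thesis using IH
          by (intro exI[of _ l] exI[of _ "insert a F"] exI[of _ k0]) auto
      qed
    qed
    then obtain l F and k0 :: nat where *: "finite F" "k0 > 0" "\<forall>k>0. l \<le> 1 / of_nat k"
        "\<forall>v. l < v \<and> v < 1 / of_nat k0 \<and> v \<notin> F \<longrightarrow> (\<forall>p\<in>Q. p v)" by blast
    \<comment> \<open>Moving from \<open>k0\<close> to \<open>Suc k0\<close> turns the weak bound on
      \<open>l\<close> into a strict one, so the interval is not empty.\<close>
    have "l \<le> 1 / of_nat (Suc k0)" using *(3) by blast
    also have "\<dots> < 1 / of_nat k0" using *(2) by (intro inverse_of_nat_less) auto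
    finally have "infinite ({l<..<1 / of_nat k0} - F)"
      using *(1) by (simp add: infinite_Ioo Diff_infinite_finite)
    then obtain v where "v \<in> {l<..<1 / of_nat k0} - F" by (metis finite.emptyI ex_in_conv)
    then show "\<exists>a. \<forall>p\<in>Q. p a" using *(4) by auto
  qed
  then obtain v where v: "\<And>p. p \<in> P \<Longrightarrow> p v" by blast
  have "i < v" if "i \<in> insert 0 I" for i using v[of "\<lambda>v. i < v"] that unfolding P_def by blast
  moreover have "v \<le> 1 / of_nat k" if "k > 0" for k :: nat 
    using v[of "\<lambda>v. v \<le> 1 / of_nat k"] that unfolding P_def by blast
  moreover have "v \<noteq> a" if "a \<in> dcl M A" for a using v[of "\<lambda>v. v \<noteq> a"] that unfolding P_def by blast
  ultimately show ?thesis unfolding infinitesimal_def by (intro exI[of _ v]) blast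
qed

text \<open>Among finitely many of the conditions \<open>v \<le> 1 / of_nat k\<close> the one with
  the largest \<open>k\<close> is the strongest, so all of them together with \<open>p v\<close> are
  finitely satisfiable.\<close>

lemma overspill:
  assumes def: "definable_pred M A (\<lambda>e. p (e 0))"
    and ex: "\<And>k. k > 0 \<Longrightarrow> \<exists>v. 0 < v \<and> v \<le> 1 / of_nat k \<and> p v"
  shows "\<exists>v. infinitesimal v \<and> p v"
proof -
  obtain \<phi> where \<phi>: "is_fm M A \<phi>" "\<And>e. sat M e \<phi> \<longleftrightarrow> p (e 0)"
    using def unfolding definable_pred_def by auto
  \<comment> \<open>\<open>A\<close> may be of any size, but one formula uses finitely many
    parameters; together with 0 and the elements 1/k they form a countable set.\<close>
  obtain A' where A': "finite A'" "is_fm M A' \<phi>" using is_fm_finite_params[OF \<phi>(1)] by blast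
  define B where "B = A' \<union> insert 0 (range (\<lambda>k::nat. 1 / of_nat k))"
  have B: "A' \<subseteq> B" "0 \<in> B" "\<And>k. 1 / of_nat k \<in> B" unfolding B_def by auto
  have pB: "definable_pred M B (\<lambda>e. p (e 0))"
    unfolding definable_pred_def using \<phi>(2) is_fm_mono[OF A'(2) B(1)] by blast
  define P where "P = (\<lambda>k v. 0 < v \<and> v \<le> 1 / of_nat k \<and> p v) ` {k::nat. k > 0}"
  have "\<exists>v. \<forall>p\<in>P. p v"
  proof (rule realize)
    show "continuum_sized B" unfolding B_def
      by (intro continuum_sized_Un continuum_sized_countable countable_finite[OF A'(1)]) auto
    show "definable_pred M B (\<lambda>e. q (e 0))" if q: "q \<in> P" for q
    proof -
      obtain k :: nat where "q = (\<lambda>v. 0 < v \<and> v \<le> 1 / of_nat k \<and> p v)" using q unfolding P_def by blast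
      then show ?thesis using B pB
        by (auto intro!: definable_pred_conj definable_pred_less definable_pred_le term_fun_var term_fun_const)
    qed
  next
    fix Q assume "finite Q" "Q \<subseteq> P"
    then obtain K where K: "K \<subseteq> {k. k > 0}" "finite K" "Q = (\<lambda>k v. 0 < v \<and> v \<le> 1 / of_nat k \<and> p v) ` K"
      unfolding P_def by (meson finite_subset_image)
    obtain v where v: "0 < v" "v \<le> 1 / of_nat (Max (insert 1 K))" "p v"
      using ex[of "Max (insert 1 K)"] K by (auto simp: Max_gr_iff)
    have "v \<le> 1 / of_nat k" if "k \<in> K" for k
    proof -
      have "1 / of_nat (Max (insert 1 K)) \<le> (1 / of_nat k :: 'a)"
        by (intro inverse_of_nat_mono) (use that K in auto)
      then show ?thesis using v by auto
    qed
    then show "\<exists>a. \<forall>q\<in>Q. q a" using v K(3) by (intro exI[of _ v]) auto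
  qed
  then obtain v where v: "0 < v \<and> v \<le> 1 / of_nat k \<and> p v" if "k > 0" for k :: nat
    unfolding P_def by auto
  then have "infinitesimal v \<and> p v" using v[of 1] unfolding infinitesimal_def by auto
  then show ?thesis ..
qed

text \<open>An element realizing the cut of \<open>r\<close> in the rationals, a countable set of
  conditions, has standard part \<open>r\<close>.\<close>

lemma standard_part_surj: "\<exists>a \<in> finite_elems. standard_part (a :: 'a) = r"
proof -
  define P where "P = (\<lambda>q (v::'a). of_rat q < v) ` {q. of_rat q < r} \<union> (\<lambda>q v. v < of_rat q) ` {q. r < of_rat q}"
  have "\<exists>v. \<forall>p\<in>P. p v"
  proof (rule realize)
    show "continuum_sized (range of_rat :: 'a set)" by (intro continuum_sized_countable) auto
    show "definable_pred M (range of_rat) (\<lambda>e. p (e 0))" if "p \<in> P" for p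
      using that unfolding P_def
      by (auto intro!: definable_pred_less term_fun_var term_fun_const)
  next
    fix Q assume "finite Q" "Q \<subseteq> P"
    then have "\<exists>a b. of_rat a < r \<and> r < of_rat b \<and> (\<forall>v. of_rat a < v \<and> v < of_rat b \<longrightarrow> (\<forall>p\<in>Q. p v))"
    proof (induction Q rule: finite_induct)
      case empty
      obtain a where "r - 1 < real_of_rat a" "real_of_rat a < r" using of_rat_dense[of "r - 1" r] by auto
      moreover obtain b where "r < real_of_rat b" "real_of_rat b < r + 1" using of_rat_dense[of r "r + 1"] by auto
      ultimately show ?case by auto
    next
      case (insert p Q)
      then obtain a b where IH: "of_rat a < r" "r < of_rat b" "\<forall>v. of_rat a < v \<and> v < of_rat b \<longrightarrow> (\<forall>p\<in>Q. p v)"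
        by auto
      consider q where "of_rat q < r" "p = (\<lambda>v. of_rat q < v)" | q where "r < of_rat q" "p = (\<lambda>v. v < of_rat q)"
        using insert.prems unfolding P_def by blast
      then show ?case
      proof cases
        case 1
        have "of_rat a \<le> (of_rat (max a q) :: 'a)" "of_rat q \<le> (of_rat (max a q) :: 'a)"
          by (simp_all only: of_rat_less_eq max.cobounded1 max.cobounded2)
        then have "of_rat (max a q) < v \<Longrightarrow> of_rat a < v \<and> of_rat q < v" for v :: 'a
          by auto
        moreover have "real_of_rat (max a q) < r" using IH(1) 1(1) by (simp add: max_def)
        ultimately show ?thesis using IH(2,3) 1(2)
          by (intro exI[of _ "max a q"] exI[of _ b]) blast
      next
        case 2
        have "of_rat (min b q) \<le> (of_rat b :: 'a)" "of_rat (min b q) \<le> (of_rat q :: 'a)"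
          by (simp_all only: of_rat_less_eq min.cobounded1 min.cobounded2)
        then have "v < of_rat (min b q) \<Longrightarrow> v < of_rat b \<and> v < of_rat q" for v :: 'a
          by auto
        moreover have "r < real_of_rat (min b q)" using IH(2) 2(1) by (simp add: min_def)
        ultimately show ?thesis using IH(1,3) 2(2)
          by (intro exI[of _ a] exI[of _ "min b q"]) blast
      qed
    qed
    then obtain a b where ab: "of_rat a < r" "r < of_rat b"
      "\<forall>v. of_rat a < v \<and> v < of_rat b \<longrightarrow> (\<forall>p\<in>Q. p v)" by auto
    have "real_of_rat a < of_rat b" using ab by linarith
    then have "a < b" by (simp only: of_rat_less)
    then obtain c where "a < c" "c < b" using dense by blast
    then have "of_rat a < (of_rat c :: 'a)" "of_rat c < (of_rat b :: 'a)" by (simp_all only: of_rat_less)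
    then have "\<forall>p\<in>Q. p (of_rat c)" using ab(3) by blast
    then show "\<exists>a. \<forall>p\<in>Q. p a" ..
  qed
  then obtain a where "\<And>p. p \<in> P \<Longrightarrow> p a" by blast
  then have a: "of_rat q < r \<Longrightarrow> of_rat q < a" "r < of_rat q \<Longrightarrow> a < of_rat q" for q
    unfolding P_def by blast+
  have cl: "infinitely_close a r"
    unfolding infinitely_close_def
  proof (intro allI impI)
    fix k :: nat assume k: "k > 0"
    obtain q where q: "r - 1 / k < of_rat q" "of_rat q < r" using of_rat_dense[of "r - 1 / k" r] k by auto
    have "r < of_rat (q + 1 / of_nat k)" using q by (simp add: of_rat_add of_rat_1_div)
    then have "a < of_rat (q + 1 / of_nat k)" by (rule a(2))
    then have "a < of_rat q + 1 / of_nat k" by (simp add: of_rat_add of_rat_1_div)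
    moreover have "of_rat q < a" using q by (intro a(1))
    ultimately show "\<exists>q. \<bar>a - of_rat q\<bar> \<le> 1 / of_nat k \<and> \<bar>r - of_rat q\<bar> \<le> 1 / real k"
      using q by (intro exI[of _ q]) (auto simp: abs_le_iff)
  qed
  obtain m :: nat where m: "\<bar>r\<bar> + 1 < of_nat m" using reals_Archimedean2 by blast
  have "of_rat (- of_nat m) < a" by (rule a(1)) (use m in \<open>simp add: of_rat_minus abs_less_iff\<close>)
  moreover have "a < of_rat (of_nat m)" by (rule a(2)) (use m in \<open>simp add: abs_less_iff\<close>)
  ultimately have "\<bar>a\<bar> \<le> of_nat m" by (simp add: of_rat_minus abs_le_iff)
  then have "a \<in> finite_elems" unfolding finite_elems_def by blast
  then show ?thesis using standard_part_eq[OF _ cl] by blast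
qed

lemma ex_near:
  fixes p :: "nat \<Rightarrow> real"
  shows "\<exists>x::nat \<Rightarrow> 'a. x \<in> tuples n \<and> near n x p"
proof -
  obtain f where "\<And>r. f r \<in> finite_elems \<and> standard_part (f r :: 'a) = r" using standard_part_surj by metis
  then show ?thesis by (intro exI[of _ "\<lambda>i\<in>{..<n}. f (p i)"]) (auto simp: near_def)
qed

section \<open>Consequences of o-minimality on the line\<close>

lemma o_minimal_pred:
  assumes "definable_pred M A (\<lambda>e. p (e 0))"
  shows "\<exists>F. finite F \<and> (\<forall>I\<in>F. (\<exists>a. I = {a}) \<or> open_interval I) \<and> Collect p = \<Union>F"
proof -
  have "(\<lambda>x. x 0) ` {x \<in> tuples 1. p (x 0)} = Collect p"
  proof (intro equalityI subsetI)
    fix v assume "v \<in> Collect p"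
    then show "v \<in> (\<lambda>x. x 0) ` {x \<in> tuples 1. p (x 0)}"
      by (intro image_eqI[of _ _ "\<lambda>i\<in>{..<1}. v"]) auto
  qed auto
  with o_minimal[unfolded o_minimal_def, rule_format, OF definable_of_pred[OF assms]]
  show ?thesis by simp
qed

lemma infinite_contains_Ioo:
  assumes "definable_pred M A (\<lambda>e. p (e 0))" "infinite (Collect p)"
  shows "\<exists>a b. a < b \<and> {a<..<b} \<subseteq> Collect p"
proof -
  obtain F where F: "finite F" "\<forall>I\<in>F. (\<exists>a. I = {a}) \<or> open_interval I" "Collect p = \<Union>F"
    using o_minimal_pred[OF assms(1)] by (elim exE conjE) (rule that)
  have "\<not> (\<forall>I\<in>F. finite I)" using F(1,3) assms(2) by auto
  then obtain I where I: "I \<in> F" "infinite I" by blast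
  then have "open_interval I" using F(2) by auto
  then consider "I = UNIV" | a where "I = {a<..}" | b where "I = {..<b}" | a b where "I = {a<..<b}"
    unfolding open_interval_def by blast
  then have "\<exists>a b. a < b \<and> {a<..<b} \<subseteq> I"
  proof cases
    case 1
    then show ?thesis by (intro exI[of _ 0] exI[of _ 1]) auto
  next
    case (2 a)
    then show ?thesis by (intro exI[of _ a] exI[of _ "a + 1"]) auto
  next
    case (3 b)
    then show ?thesis by (intro exI[of _ "b - 1"] exI[of _ b]) auto
  next
    case (4 a b)
    then have "a < b" using I(2) by (cases "a < b") auto
    then show ?thesis using 4 by blast
  qed
  then show ?thesis unfolding F(3) using I(1) Sup_upper[of I F] order_trans[of "{_<..<_}" I "\<Union>F"] by blast
qed

text \<open>The field is not complete, but a bounded nonempty finite union of points and intervals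
  has a supremum: pieces are added one by one and the larger supremum is kept.\<close>

lemma ex_least_upper_bound:
  assumes "definable_pred M A (\<lambda>e. p (e 0))" "p w" "\<And>v. p v \<Longrightarrow> v \<le> u"
  shows "\<exists>s. (\<forall>v. p v \<longrightarrow> v \<le> s) \<and> (\<forall>t<s. \<exists>v>t. p v)"
proof -
  obtain F where F: "finite F" "\<forall>I\<in>F. (\<exists>a. I = {a}) \<or> open_interval I" "Collect p = \<Union>F"
    using o_minimal_pred[OF assms(1)] by (elim exE conjE) (rule that)
  have *: "\<Union>G = {} \<or> (\<exists>s. (\<forall>v\<in>\<Union>G. v \<le> s) \<and> (\<forall>t<s. \<exists>v>t. v \<in> \<Union>G))" if "finite G" "G \<subseteq> F" for G
    using that
  proof (induction G rule: finite_induct)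
    case (insert I G)
    have bd: "v \<le> u" if "v \<in> I" for v using that insert.prems F(3) assms(3) by blast
    have I: "I = {} \<or> (\<exists>s. (\<forall>v\<in>I. v \<le> s) \<and> (\<forall>t<s. \<exists>v>t. v \<in> I))"
    proof -
      have "(\<exists>a. I = {a}) \<or> open_interval I" using F(2) insert.prems by blast
      then consider a where "I = {a}" | "I = UNIV" | a where "I = {a<..}" | b where "I = {..<b}" | a b where "I = {a<..<b}"
        unfolding open_interval_def by blast
      then show ?thesis
      proof cases
        case (1 a)
        then show ?thesis by auto
      next
        case 2
        then show ?thesis using bd[of "u + 1"] by auto
      next
        case (3 a)
        have "a < max a u + 1" "\<not> max a u + 1 \<le> u" by (auto simp: max_def)
        then show ?thesis using bd[of "max a u + 1"] 3 by blast
      next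
        case (4 b)
        then show ?thesis using dense by (intro disjI2 exI[of _ b]) auto
      next
        case (5 a b)
        have "\<exists>v>t. v \<in> I" if t: "a < b" "t < b" for t
        proof -
          obtain z where "max a t < z" "z < b" using dense[of "max a t" b] t by auto
          then show ?thesis using 5 by (intro exI[of _ z]) auto
        qed
        then show ?thesis using 5 by (cases "a < b") (auto intro: exI[of _ b] less_imp_le)
      qed
    qed
    from insert consider "\<Union>G = {}" | s where "\<forall>v\<in>\<Union>G. v \<le> s" "\<forall>t<s. \<exists>v>t. v \<in> \<Union>G" by auto
    then show ?case
    proof cases
      case 1
      then have "\<Union>(insert I G) = I" by auto
      then show ?thesis using I by simp
    next
      case (2 s)
      show ?thesis
      proof (cases "I = {}")
        case True
        then show ?thesis using 2 by auto
      next
        case False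
        then obtain s' where s': "\<forall>v\<in>I. v \<le> s'" "\<forall>t<s'. \<exists>v>t. v \<in> I" using I by auto
        show ?thesis
        proof (cases "s \<le> s'")
          case True
          then have "\<forall>v\<in>\<Union>(insert I G). v \<le> s'" using 2(1) s'(1) by force
          moreover have "\<forall>t<s'. \<exists>v>t. v \<in> \<Union>(insert I G)" using s'(2) by blast
          ultimately show ?thesis by blast
        next
          case False
          then have "\<forall>v\<in>\<Union>(insert I G). v \<le> s" using 2(1) s'(1) by force
          moreover have "\<forall>t<s. \<exists>v>t. v \<in> \<Union>(insert I G)" using 2(2) by blast
          ultimately show ?thesis by blast
        qed
      qed
    qed
  qed auto
  show ?thesis using *[OF F(1) order_refl] F(3) assms(2) by (metis empty_iff mem_Collect_eq)
qed

text \<open>An end point lies on one side of the cut between infinitesimal and appreciable elements,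
  so a ray does not change across the cut. The sets with this property form a Boolean algebra, which
  by o-minimality contains every definable set.\<close>

lemma germ_at_infinitesimal_cut:
  assumes "definable_pred M A (\<lambda>e. p (e 0))"
  shows "\<exists>u w. infinitesimal u \<and> appreciable w \<and> ((\<forall>v. u < v \<and> v < w \<longrightarrow> p v) \<or> (\<forall>v. u < v \<and> v < w \<longrightarrow> \<not> p v))"
proof -
  define C where "C S \<longleftrightarrow> (\<exists>u w. infinitesimal u \<and> appreciable w \<and> ((\<forall>v. u < v \<and> v < w \<longrightarrow> v \<in> S) \<or> (\<forall>v. u < v \<and> v < w \<longrightarrow> v \<notin> S)))" for S :: "'a set"
  obtain \<eta> :: 'a where \<eta>: "infinitesimal \<eta>"
    using ex_infinitesimal_greater[of "{}" "{}"] by (auto simp: continuum_sized_countable)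
  have one: "appreciable (1::'a)" using appreciable_inverse[of 1] by simp
  have Un: "C (S \<union> T)" if ST: "C S" "C T" for S T
  proof -
    obtain u w u' w' where uw: "infinitesimal u" "appreciable w" "(\<forall>v. u < v \<and> v < w \<longrightarrow> v \<in> S) \<or> (\<forall>v. u < v \<and> v < w \<longrightarrow> v \<notin> S)"
      "infinitesimal u'" "appreciable w'" "(\<forall>v. u' < v \<and> v < w' \<longrightarrow> v \<in> T) \<or> (\<forall>v. u' < v \<and> v < w' \<longrightarrow> v \<notin> T)"
      using ST unfolding C_def by (elim exE conjE) (rule that)
    have "infinitesimal (max u u')" "appreciable (min w w')" using uw by (auto simp: max_def min_def)
    then show ?thesis using uw(3,6) unfolding C_def
      by (intro exI[of _ "max u u'"] exI[of _ "min w w'"]) auto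
  qed
  have compl: "C (- S)" if S: "C S" for S
  proof -
    obtain u w where "infinitesimal u" "appreciable w" "(\<forall>v. u < v \<and> v < w \<longrightarrow> v \<in> S) \<or> (\<forall>v. u < v \<and> v < w \<longrightarrow> v \<notin> S)"
      using S unfolding C_def by (elim exE conjE) (rule that)
    then show ?thesis unfolding C_def by (intro exI[of _ u] exI[of _ w]) auto
  qed
  have Ioi: "C {a<..}" for a
  proof (cases "0 < a \<and> \<not> infinitesimal a")
    case True
    then have "appreciable a" using infinitesimal_or_appreciable by blast
    then show ?thesis unfolding C_def using \<eta> by (intro exI[of _ \<eta>] exI[of _ a]) auto
  next
    case False
    moreover have "0 < \<eta>" using \<eta> by (simp add: infinitesimal_def)
    \<comment> \<open>Here \<open>a\<close> is nonpositive or infinitesimal; \<open>\<eta>\<close>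
      keeps the lower end positive in the first case.\<close>
    ultimately have "infinitesimal (max a \<eta>)" using \<eta> less_trans[of 0 \<eta> a]
      by (cases "a \<le> \<eta>") (auto simp: max_def)
    then show ?thesis unfolding C_def using one by (intro exI[of _ "max a \<eta>"] exI[of _ 1]) auto
  qed
  have Iio: "C {..<a}" for a
  proof (cases "0 < a \<and> \<not> infinitesimal a")
    case True
    then have "appreciable a" using infinitesimal_or_appreciable by blast
    then show ?thesis unfolding C_def using \<eta> by (intro exI[of _ \<eta>] exI[of _ a]) auto
  next
    case False
    moreover have "0 < \<eta>" using \<eta> by (simp add: infinitesimal_def)
    ultimately have "infinitesimal (max a \<eta>)" using \<eta> less_trans[of 0 \<eta> a]
      by (cases "a \<le> \<eta>") (auto simp: max_def)
    then show ?thesis unfolding C_def using one by (intro exI[of _ "max a \<eta>"] exI[of _ 1]) auto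
  qed
  have Ioo: "C {a<..<b}" for a b
  proof -
    have "{a<..<b} = - (- {a<..} \<union> - {..<b})" by auto
    then show ?thesis by (metis compl Un Ioi Iio)
  qed
  have sing: "C {a}" for a
  proof -
    have "{a} = - ({a<..} \<union> {..<a})" by auto
    then show ?thesis by (metis compl Un Ioi Iio)
  qed
  have empty: "C {}" unfolding C_def using \<eta> one by auto
  then have UNIV: "C UNIV" using compl[of "{}"] by simp
  obtain F where F: "finite F" "\<forall>I\<in>F. (\<exists>a. I = {a}) \<or> open_interval I" "Collect p = \<Union>F"
    using o_minimal_pred[OF assms] by (elim exE conjE) (rule that)
  have "C (\<Union>G)" if "finite G" "G \<subseteq> F" for G
    using that
  proof (induction G rule: finite_induct)
    case (insert I G)
    have "(\<exists>a. I = {a}) \<or> open_interval I" using F(2) insert.prems by blast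
    then have "C I" using sing UNIV Ioi Iio Ioo unfolding open_interval_def by blast
    then show ?case using insert Un by auto
  qed (auto simp: empty)
  from this[OF F(1) order_refl] have "C (Collect p)" by (simp add: F(3))
  then obtain u w where "infinitesimal u" "appreciable w" "(\<forall>v. u < v \<and> v < w \<longrightarrow> v \<in> Collect p) \<or> (\<forall>v. u < v \<and> v < w \<longrightarrow> v \<notin> Collect p)"
    unfolding C_def by (elim exE conjE) (rule that)
  then show ?thesis by (intro exI[of _ u] exI[of _ w]) auto
qed

end

section \<open>Exchange\<close>

lemma definable_pred_subst_var:
  assumes "definable_pred M A (\<lambda>e. p (e 0))" "A \<subseteq> B" "term_fun M B F"
  shows "definable_pred M B (\<lambda>e. p (F e))"
  using definable_pred_subst[OF definable_pred_mono[OF assms(1,2)], of "\<lambda>_. F"] assms(3) by simp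

lemma definable_pred_subst_var2:
  assumes "definable_pred M A (\<lambda>e. p (e 0) (e 1))" "A \<subseteq> B" "term_fun M B F" "term_fun M B G"
  shows "definable_pred M B (\<lambda>e. p (F e) (G e))"
  using definable_pred_subst[OF definable_pred_mono[OF assms(1,2)], of "\<lambda>i. if i = 0 then F else G"] assms(3,4)
  by simp

context saturated_o_minimal_field
begin

text \<open>The order singles out the elements of a finite definable set: its minimum is definable,
  and removing it leaves a smaller definable set.\<close>

lemma finite_definable_dcl:
  assumes "definable_pred M A (\<lambda>e. p (e 0))" "finite (Collect p)" "p b"
  shows "b \<in> dcl M A"
  using assms
proof (induction "card (Collect p)" arbitrary: p rule: less_induct)
  case less
  define m where "m = Min (Collect p)"
  have m: "p m" "\<And>z. p z \<Longrightarrow> m \<le> z"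
    using less.prems Min_in[of "Collect p"] Min_le[of "Collect p"] unfolding m_def by auto
  have "definable_pred M A (\<lambda>e. p (e 0) \<and> (\<forall>z. p z \<longrightarrow> e 0 \<le> z))"
    by (intro definable_pred_conj definable_pred_all definable_pred_imp definable_pred_le term_fun_var
        definable_pred_subst_var[OF less.prems(1) order_refl])
  moreover have "(\<lambda>e. p (e 0) \<and> (\<forall>z. p z \<longrightarrow> e 0 \<le> z)) = (\<lambda>e :: nat \<Rightarrow> 'a. e 0 = m)"
    using m by (auto simp: fun_eq_iff intro: antisym)
  ultimately have m_def: "definable_pred M A (\<lambda>e. e 0 = m)" by simp
  show ?case
  proof (cases "b = m")
    case True
    then show ?thesis using m_def by (simp add: dcl_def)
  next
    case False
    have *: "Collect (\<lambda>z. p z \<and> z \<noteq> m) = Collect p - {m}" by auto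
    show ?thesis
    proof (rule less.hyps)
      show "card (Collect (\<lambda>z. p z \<and> z \<noteq> m)) < card (Collect p)"
        unfolding * using less.prems(2) m(1) by (intro card_Diff1_less) auto
      show "definable_pred M A (\<lambda>e. p (e 0) \<and> e 0 \<noteq> m)"
        by (intro definable_pred_conj definable_pred_not less.prems(1) m_def)
      show "finite (Collect (\<lambda>z. p z \<and> z \<noteq> m))" unfolding * using less.prems(2) by simp
    qed (use False less.prems in auto)
  qed
qed

text \<open>Otherwise the left end points of the intervals in the fibres would fill an interval, yet each of
  them is followed by an interval free of left end points.\<close>

lemma finite_fibres_with_interior:
  assumes def: "definable_pred M A (\<lambda>e. \<theta> (e 0) (e 1))"
    and disj: "\<And>x x' y. \<theta> x y \<Longrightarrow> \<theta> x' y \<Longrightarrow> x = x'"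
  shows "finite {x. \<exists>a b. a < b \<and> (\<forall>y. a < y \<and> y < b \<longrightarrow> \<theta> x y)}" (is "finite ?E")
proof (rule ccontr)
  assume inf: "infinite ?E"
  \<comment> \<open>\<open>lep x z\<close>: an interval inside the fibre of \<open>x\<close> starts
    at \<open>z\<close> and cannot be prolonged to the left.\<close>
  define lep where "lep x z \<longleftrightarrow> (\<exists>u>z. (\<forall>y. z < y \<and> y < u \<longrightarrow> \<theta> x y) \<and> (\<forall>w<z. \<exists>y. w < y \<and> y < u \<and> \<not> \<theta> x y))"
    for x z
  \<comment> \<open>Fibres containing a ray to the left have to be set aside, since their interval
    need not have a left end point. Two of them would meet far to the left, so there is at most
    one.\<close>
  define N where "N = {x. \<exists>b. \<forall>y<b. \<theta> x y}"
  have N: "x = x'" if xN: "x \<in> N" "x' \<in> N" for x x'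
  proof -
    obtain b b' where "\<forall>y<b. \<theta> x y" "\<forall>y<b'. \<theta> x' y" using xN unfolding N_def by auto
    then have "\<theta> x (min b b' - 1)" "\<theta> x' (min b b' - 1)" by (auto simp: min_def)
    then show ?thesis by (rule disj)
  qed
  then have "finite N" by (metis finite.simps finite_insert is_singletonI' is_singleton_the_elem)
  have lep: "\<exists>z. lep x z" if x: "x \<in> ?E - N" for x
  proof -
    obtain a b where ab: "a < b" "\<forall>y. a < y \<and> y < b \<longrightarrow> \<theta> x y" using x by auto
    \<comment> \<open>\<open>T w\<close> says that the fibre has a gap between \<open>w\<close> and
      \<open>b\<close>, so the supremum of \<open>T\<close> is where the interval reaching up to
      \<open>b\<close> begins.\<close>
    define T where "T w \<longleftrightarrow> (\<exists>y. w < y \<and> y < b \<and> \<not> \<theta> x y)" for w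
    have "definable_pred M (insert x (insert b A)) (\<lambda>e. T (e 0))"
      unfolding T_def
      by (intro definable_pred_ex definable_pred_conj definable_pred_not definable_pred_less term_fun_var
          term_fun_const definable_pred_subst_var2[OF def]) auto
    moreover obtain y0 where "y0 < b" "\<not> \<theta> x y0" using x unfolding N_def by auto
    then have "T (y0 - 1)" unfolding T_def by (intro exI[of _ y0]) auto
    moreover have "w \<le> a" if "T w" for w
      using that ab(2) unfolding T_def by (meson less_trans not_le)
    ultimately obtain s where s: "\<forall>w. T w \<longrightarrow> w \<le> s" "\<forall>t<s. \<exists>v>t. T v"
      using ex_least_upper_bound[of _ T] by blast
    have "s < b"
    proof (rule ccontr)
      assume "\<not> s < b"
      then have "a < s" using ab(1) by simp
      then obtain v where "v > a" "T v" using s(2) by blast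
      then show False using \<open>\<And>w. T w \<Longrightarrow> w \<le> a\<close> by force
    qed
    moreover have "\<theta> x y" if y: "s < y" "y < b" for y
    proof -
      obtain w where w: "s < w" "w < y" using dense y by blast
      then have "\<not> T w" using s(1) by force
      then show ?thesis using w y unfolding T_def by blast
    qed
    moreover have "\<exists>y. w < y \<and> y < b \<and> \<not> \<theta> x y" if w: "w < s" for w
    proof -
      obtain v where v: "w < v" "T v" using s(2) w by blast
      then obtain y where y: "v < y" "y < b" "\<not> \<theta> x y" unfolding T_def by (elim exE conjE) (rule that)
      then show ?thesis using less_trans[OF v(1) y(1)] by (intro exI[of _ y]) simp
    qed
    ultimately have "lep x s" unfolding lep_def by (intro exI[of _ b]) simp
    then show ?thesis ..
  qed
  define g where "g x = (SOME z. lep x z)" for x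
  have g: "lep x (g x)" if "x \<in> ?E - N" for x
    unfolding g_def by (rule someI_ex) (rule lep[OF that])
  \<comment> \<open>Two fibres with a common left end point share the points just to the right of
    it.\<close>
  have meet: "x = x'" if "lep x z" "lep x' z" for x x' z
  proof -
    obtain u u' where u: "u > z" "\<forall>y. z < y \<and> y < u \<longrightarrow> \<theta> x y" "u' > z" "\<forall>y. z < y \<and> y < u' \<longrightarrow> \<theta> x' y"
      using \<open>lep x z\<close> \<open>lep x' z\<close> unfolding lep_def by blast
    then obtain y where "z < y" "y < min u u'" using dense[of z "min u u'"] by auto
    then show ?thesis using u disj[of x y x'] by auto
  qed
  have "inj_on g (?E - N)"
  proof (rule inj_onI)
    fix x x' assume x: "x \<in> ?E - N" "x' \<in> ?E - N" "g x = g x'"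
    show "x = x'" using meet[OF g[OF x(1)]] g[OF x(2)] x(3) by simp
  qed
  moreover have "infinite (?E - N)" using inf \<open>finite N\<close> by simp
  ultimately have "infinite (g ` (?E - N))" by (simp add: finite_image_iff)
  moreover have "g ` (?E - N) \<subseteq> Collect (\<lambda>z. \<exists>x. lep x z)" using g by (intro subsetI) fast
  ultimately have "infinite (Collect (\<lambda>z. \<exists>x. lep x z))" by (rule infinite_super[rotated])
  moreover have "definable_pred M A (\<lambda>e. \<exists>x. lep x (e 0))"
    unfolding lep_def
    by (intro definable_pred_ex definable_pred_all definable_pred_imp definable_pred_conj definable_pred_not
        definable_pred_less term_fun_var definable_pred_subst_var2[OF def] order_refl)
  ultimately obtain c d where cd: "c < d" "{c<..<d} \<subseteq> Collect (\<lambda>z. \<exists>x. lep x z)"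
    using infinite_contains_Ioo[of A "\<lambda>z. \<exists>x. lep x z"] by blast
  obtain z where z: "c < z" "z < d" using dense cd(1) by blast
  then have "z \<in> {c<..<d}" by simp
  then obtain x where "lep x z" using cd(2) by blast
  then obtain u where u: "z < u" "\<forall>y. z < y \<and> y < u \<longrightarrow> \<theta> x y" unfolding lep_def by blast
  \<comment> \<open>\<open>z'\<close> lies inside the interval of \<open>x\<close> that starts at
    \<open>z\<close>, and is itself the left end point of a fibre, which by disjointness can only be
    that of \<open>x\<close>.\<close>
  obtain z' where z': "z < z'" "z' < min u d" using dense[of z "min u d"] u(1) z by auto
  then have "z' \<in> {c<..<d}" using z by simp
  then obtain x' where "lep x' z'" using cd(2) by blast
  then obtain u' where u': "z' < u'" "\<forall>y. z' < y \<and> y < u' \<longrightarrow> \<theta> x' y" "\<forall>w<z'. \<exists>y. w < y \<and> y < u' \<and> \<not> \<theta> x' y"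
    unfolding lep_def by blast
  obtain y where y: "z' < y" "y < min u u'" using dense[of z' "min u u'"] u'(1) z' by auto
  then have "\<theta> x y" using u(2) z'(1) by auto
  moreover have "\<theta> x' y" using u'(2) y by auto
  ultimately have "x = x'" by (rule disj)
  \<comment> \<open>Since the interval at \<open>z'\<close> cannot be prolonged to the left, the
    fibre misses some \<open>y'\<close> between \<open>z\<close> and \<open>u'\<close>. But
    \<open>y'\<close> lies either before \<open>u\<close>, in the first interval, or after
    \<open>z'\<close>, in the second.\<close>
  obtain y' where y': "z < y'" "y' < u'" "\<not> \<theta> x' y'" using u'(3) z'(1) by blast
  show False
  proof (cases "y' < u")
    case True
    then show False using u(2) y' \<open>x = x'\<close> by blast
  next
    case False
    then have "z' < y'" using z'(2) by auto
    then show False using u'(2) y' by blast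
  qed
qed

text \<open>\<open>a\<close> is the value at \<open>b\<close> of a partial function definable over
  \<open>B\<close>. Its fibres are disjoint, so finitely many of them contain an interval, and the
  values on those lie in \<open>dcl M B\<close>. Hence the fibre over \<open>a\<close> is finite; it
  contains \<open>b\<close>.\<close>

lemma dcl_exchange:
  assumes "a \<in> dcl M (insert b B)" "a \<notin> dcl M B"
  shows "b \<in> dcl M (insert a B)"
proof -
  have "definable_pred M (insert b B) (\<lambda>e. e 0 = a)" using assms(1) by (simp add: dcl_def)
  from definable_pred_abstract[OF this]
  obtain Q where Q: "definable_pred M B Q" "\<And>e. Q (case_nat b e) \<longleftrightarrow> e 0 = a" by auto
  define R where "R y x \<longleftrightarrow> Q (case_nat y (\<lambda>_. x))" for y x
  have R: "R b x \<longleftrightarrow> x = a" for x unfolding R_def Q(2) ..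
  have "definable_pred M B (\<lambda>e. Q (\<lambda>i. (case i of 0 \<Rightarrow> (\<lambda>e. e 0) | Suc j \<Rightarrow> (\<lambda>e. e 1)) e))"
    by (rule definable_pred_subst[OF Q(1)]) (auto simp: term_fun_var split: nat.splits)
  moreover have "(\<lambda>i. (case i of 0 \<Rightarrow> (\<lambda>e. e 0) | Suc j \<Rightarrow> (\<lambda>e. e 1)) e) = case_nat (e 0) (\<lambda>_. e 1)"
    for e :: "nat \<Rightarrow> 'a"
    by (auto simp: fun_eq_iff split: nat.splits)
  ultimately have defR: "definable_pred M B (\<lambda>e. R (e 0) (e 1))" unfolding R_def by simp
  \<comment> \<open>\<open>R\<close> is known to be functional at \<open>b\<close> only; uniqueness
    is built into \<open>\<theta>\<close> so that all its fibres are disjoint.\<close>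
  define \<theta> where "\<theta> x y \<longleftrightarrow> R y x \<and> (\<forall>x'. R y x' \<longrightarrow> x' = x)" for x y
  have def: "definable_pred M B (\<lambda>e. \<theta> (e 0) (e 1))"
    unfolding \<theta>_def
    by (intro definable_pred_conj definable_pred_all definable_pred_imp definable_pred_eq
        definable_pred_subst_var2[OF defR] order_refl term_fun_var)
  have disj: "x = x'" if "\<theta> x y" "\<theta> x' y" for x x' y using that unfolding \<theta>_def by blast
  have \<theta>: "\<theta> a b" unfolding \<theta>_def R by simp
  let ?E = "\<lambda>x. \<exists>c d. c < d \<and> (\<forall>y. c < y \<and> y < d \<longrightarrow> \<theta> x y)"
  have defE: "definable_pred M B (\<lambda>e. ?E (e 0))"
    by (intro definable_pred_ex definable_pred_all definable_pred_imp definable_pred_conj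
        definable_pred_less term_fun_var definable_pred_subst_var2[OF def] order_refl)
  have "finite (Collect ?E)" by (rule finite_fibres_with_interior[OF def]) (rule disj)
  then have "\<not> ?E a"
    using finite_definable_dcl[OF defE] assms(2) by blast
  moreover have defa: "definable_pred M (insert a B) (\<lambda>e. \<theta> a (e 0))"
    by (intro definable_pred_subst_var2[OF def] term_fun_var term_fun_const) auto
  ultimately have "finite (Collect (\<theta> a))"
    using infinite_contains_Ioo[OF defa] by (metis (full_types) greaterThanLessThan_iff mem_Collect_eq subset_iff)
  then show ?thesis using finite_definable_dcl[OF defa _ \<theta>] by simp
qed

text \<open>The Steinitz step: \<open>v\<close> depends on a smallest set \<open>K\<close> of
  generators, nonempty because \<open>v\<close> is not in \<open>dcl M A\<close>. Exchange between
  \<open>v\<close> and a generator from \<open>K\<close> makes that generator redundant once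
  \<open>v\<close> is a parameter.\<close>

lemma dcl_basis_shrink:
  fixes n :: nat
  assumes I: "I \<subseteq> {..<n}" and x: "\<And>i. i < n \<Longrightarrow> x i \<in> dcl M (A \<union> x ` I)"
    and v: "v \<in> dcl M (A \<union> x ` {..<n})" "v \<notin> dcl M A"
  shows "\<exists>J\<subseteq>I. card J < card I \<and> (\<forall>i<n. x i \<in> dcl M (insert v A \<union> x ` J))"
proof -
  have "finite I" using finite_subset[OF I] by simp
  have "v \<in> dcl M ((A \<union> x ` I) \<union> x ` {..<n})"
    using v(1) dcl_mono[of "A \<union> x ` {..<n}" "(A \<union> x ` I) \<union> x ` {..<n}" M] by blast
  then have "v \<in> dcl M (A \<union> x ` I)"
    by (rule dcl_trans[rotated]) (use x in auto)
  then have ex: "I \<subseteq> I \<and> v \<in> dcl M (A \<union> x ` I)" by simp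
  obtain K where K: "K \<subseteq> I" "v \<in> dcl M (A \<union> x ` K)"
    and min: "\<And>L. L \<subseteq> I \<Longrightarrow> v \<in> dcl M (A \<union> x ` L) \<Longrightarrow> card K \<le> card L"
    using ex_has_least_nat[of "\<lambda>K. K \<subseteq> I \<and> v \<in> dcl M (A \<union> x ` K)", OF ex, of card]
    by (elim exE conjE) (rule that, auto)
  have "finite K" using finite_subset[OF K(1) \<open>finite I\<close>] .
  have "K \<noteq> {}" using K(2) v(2) by auto
  then obtain i where i: "i \<in> K" by blast
  let ?B = "A \<union> x ` (K - {i})"
  have "insert (x i) ?B = A \<union> x ` K" using i by auto
  then have "v \<in> dcl M (insert (x i) ?B)" using K(2) by simp
  moreover have "v \<notin> dcl M ?B"
  proof
    assume "v \<in> dcl M ?B"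
    then have "card K \<le> card (K - {i})" using K(1) by (intro min) auto
    then show False using i \<open>finite K\<close> by (metis card_Diff1_less not_le)
  qed
  ultimately have "x i \<in> dcl M (insert v ?B)" by (rule dcl_exchange)
  moreover have "insert v ?B \<subseteq> insert v A \<union> x ` (I - {i})" using K(1) by auto
  ultimately have xi: "x i \<in> dcl M (insert v A \<union> x ` (I - {i}))" using dcl_mono by blast
  have "x j \<in> dcl M (insert v A \<union> x ` (I - {i}))" if "j < n" for j
  proof (rule dcl_trans)
    have "A \<union> x ` I \<subseteq> (insert v A \<union> x ` (I - {i})) \<union> {x i}" by auto
    then show "x j \<in> dcl M ((insert v A \<union> x ` (I - {i})) \<union> {x i})"
      using x[OF that] dcl_mono by blast
  qed (use xi in auto)
  moreover have "card (I - {i}) < card I" using i K(1) \<open>finite I\<close> by (meson card_Diff1_less subsetD)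
  ultimately show ?thesis by (intro exI[of _ "I - {i}"]) auto
qed

end

section \<open>Traced sets\<close>

lemma definable_pred_mem:
  fixes M :: "('f, 'r, 'a) fo_struct"
  assumes "definable_pred M A (\<lambda>e. (\<lambda>i\<in>{..<n}. e i) \<in> X)" "A \<subseteq> B" "tuple_fun M B n Y"
  shows "definable_pred M B (\<lambda>e. Y e \<in> X)"
proof -
  have "definable_pred M B (\<lambda>e. (\<lambda>i\<in>{..<n}. e i) \<in> X)"
    using assms(1,2) by (rule definable_pred_mono)
  moreover have "term_fun M B (if i < n then (\<lambda>e. Y e i) else (\<lambda>e. e 0))" for i
    using assms(3) by (auto simp: tuple_fun_def term_fun_var)
  ultimately have "definable_pred M B (\<lambda>e. (\<lambda>i\<in>{..<n}. (if i < n then (\<lambda>e. Y e i) else (\<lambda>e. e 0)) e) \<in> X)"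
    by (rule definable_pred_subst)
  moreover have "(\<lambda>i\<in>{..<n}. (if i < n then (\<lambda>e. Y e i) else (\<lambda>e. e 0)) e) = Y e" for e
    using assms(3) by (auto simp: tuple_fun_def fun_eq_iff PiE_iff extensional_def)
  ultimately show ?thesis by simp
qed

lemma standard_part_eq_infinitesimal:
  assumes "a \<in> finite_elems" "a \<le> b + r" "b \<le> a + r" "infinitesimal r"
  shows "b \<in> finite_elems" "standard_part b = standard_part a"
proof -
  have "near 1 (\<lambda>_. b) (\<lambda>_. standard_part a)"
    by (rule near_infinitesimal[of 1 "\<lambda>_. a", OF _ _ assms(4)]) (use assms in \<open>auto simp: near_def near_by_def\<close>)
  then show "b \<in> finite_elems" "standard_part b = standard_part a" by (auto simp: near_def)
qed

lemma mult_le_1_mono: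
  fixes a :: "'a::linordered_field"
  assumes "a * v \<le> 1" "0 < w" "w \<le> v"
  shows "a * w \<le> 1"
proof (cases "a \<le> 0")
  case True
  then have "a * w \<le> 0" using assms(2) by (simp add: mult_nonpos_nonneg)
  then show ?thesis by (rule order_trans) simp
next
  case False
  then have "a * w \<le> a * v" using assms(3) by (intro mult_left_mono) auto
  then show ?thesis using assms(1) by (rule order_trans)
qed

lemma le_of_mult_le_1:
  fixes a :: "'a::linordered_field"
  assumes "a * v \<le> 1" "0 < k" "1 / of_nat k \<le> v"
  shows "a \<le> of_nat k"
proof -
  have "a * (1 / of_nat k) \<le> 1"
    by (rule mult_le_1_mono[OF assms(1) _ assms(3)]) (use assms(2) in simp)
  then show ?thesis using assms(2) by (simp add: divide_le_eq)
qed

lemma zero_le_mult_add_1_iff: "0 \<le> a * v + 1 \<longleftrightarrow> - a * v \<le> (1 :: 'a :: linordered_field)"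
  unfolding mult_minus_left by linarith

text \<open>For positive \<open>v\<close> the first two premises say that the absolute value of
  \<open>a\<close> is at most 1/v, in terms of order, addition, multiplication, 0 and 1 only. This
  is how finiteness, which is not definable, enters formulas.\<close>

lemma finite_elems_of_mult_le_1:
  fixes a :: "'a::linordered_field"
  assumes "a * v \<le> 1" "0 \<le> a * v + 1" "appreciable v"
  shows "a \<in> finite_elems"
proof -
  obtain k where k: "k > 0" "1 / of_nat k \<le> v" using assms(3) unfolding appreciable_def by auto
  have "- a * v \<le> 1" using assms(2) by (simp only: zero_le_mult_add_1_iff)
  then have "\<bar>a\<bar> \<le> of_nat k"
    using le_of_mult_le_1[OF assms(1) k] le_of_mult_le_1[OF _ k, of "- a"] by (simp add: abs_le_iff)
  then show ?thesis unfolding finite_elems_def by blast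
qed

lemma near_ex_bound:
  fixes y :: "nat \<Rightarrow> 'a::linordered_field"
  assumes "near N y q"
  shows "\<exists>v. appreciable v \<and> (\<forall>j<N. y j * v \<le> 1 \<and> 0 \<le> y j * v + 1)"
proof -
  have "\<forall>j<N. \<exists>m::nat. \<bar>y j\<bar> \<le> of_nat m"
    using assms by (auto simp: near_def finite_elems_def)
  then obtain m :: "nat \<Rightarrow> nat" where m: "\<And>j. j < N \<Longrightarrow> \<bar>y j\<bar> \<le> of_nat (m j)" by metis
  \<comment> \<open>The sum bounds all \<open>m j\<close> at once, and \<open>Suc\<close> keeps it
    positive.\<close>
  define K where "K = Suc (\<Sum>j<N. m j)"
  have K: "(0 :: 'a) < of_nat K" unfolding K_def of_nat_0_less_iff by simp
  have "y j * (1 / of_nat K) \<le> 1 \<and> 0 \<le> y j * (1 / of_nat K) + 1" if j: "j < N" for j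
  proof -
    have "m j \<le> K" unfolding K_def using j member_le_sum[of j "{..<N}" m] by simp
    then have "\<bar>y j\<bar> \<le> of_nat K" using order_trans[OF m[OF j]] by simp
    then have "y j \<le> of_nat K" "- y j \<le> of_nat K" by (auto simp: abs_le_iff)
    then show ?thesis using K by (simp add: field_simps)
  qed
  moreover have "appreciable (1 / of_nat K :: 'a)" by (rule appreciable_inverse) (simp add: K_def)
  ultimately show ?thesis by (intro exI[of _ "1 / of_nat K"]) simp
qed

lemma abs_diff_le_of_standard_part_eq:
  assumes "a \<in> finite_elems" "b \<in> finite_elems" "standard_part a = standard_part b" "k > 0"
  shows "\<bar>a - b\<bar> \<le> 1 / of_nat k"
  using le_add_of_standard_part[OF assms(1,2), of k] le_add_of_standard_part[OF assms(2,1), of k] assms(3,4)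
  by (simp add: abs_le_iff algebra_simps)

lemma appreciable_min: "appreciable v \<Longrightarrow> appreciable w \<Longrightarrow> appreciable (min v w)"
  by (simp add: min_def)

lemma infinitesimal_max: "infinitesimal v \<Longrightarrow> infinitesimal w \<Longrightarrow> infinitesimal (max v w)"
  by (simp add: max_def)

context saturated_o_minimal_field
begin

lemma ex_infinitesimal: "\<exists>r::'a. infinitesimal r"
  using ex_infinitesimal_greater[of "{}" "{}"] continuum_sized_countable by auto

text \<open>The distances are below every 1/k, but all of them may be 0; saturation supplies a
  positive infinitesimal above them.\<close>

lemma infinitely_close_ex_infinitesimal:
  fixes x y :: "nat \<Rightarrow> 'a"
  assumes "finite I" "\<And>i. i \<in> I \<Longrightarrow> x i \<in> finite_elems \<and> y i \<in> finite_elems \<and> standard_part (x i) = standard_part (y i)"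
  shows "\<exists>r. infinitesimal r \<and> (\<forall>i\<in>I. x i \<le> y i + r \<and> y i \<le> x i + r)"
proof -
  let ?D = "(\<lambda>i. \<bar>x i - y i\<bar>) ` I"
  have le: "d \<le> 1 / of_nat k" if d: "d \<in> ?D" and k: "k > 0" for d and k :: nat
  proof -
    obtain j where "j \<in> I" "d = \<bar>x j - y j\<bar>" using d by auto
    then show ?thesis
      using abs_diff_le_of_standard_part_eq[OF _ _ _ k, of "x j" "y j"] assms(2)[of j] by simp
  qed
  have "continuum_sized ?D" "continuum_sized ({} :: 'a set)"
    using assms(1) by (auto intro!: continuum_sized_countable countable_finite)
  then obtain r where r: "infinitesimal r" "\<forall>d\<in>?D. d < r"
    using ex_infinitesimal_greater[of "{}" ?D] le by blast
  have "x i \<le> y i + r \<and> y i \<le> x i + r" if "i \<in> I" for i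
  proof -
    have "\<bar>x i - y i\<bar> < r" using r(2) that by simp
    then show ?thesis by (simp add: abs_less_iff algebra_simps less_imp_le)
  qed
  then show ?thesis using r(1) by blast
qed

lemma near_ex_near_by:
  fixes x y :: "nat \<Rightarrow> 'a"
  assumes "near n x p" "near n y p"
  shows "\<exists>r. infinitesimal r \<and> near_by n x y r"
  using infinitely_close_ex_infinitesimal[of "{..<n}" x y] assms by (auto simp: near_def near_by_def)

text \<open>\<open>realized n Z\<close> is the standard part of an external set: \<open>v\<close> ranges over the appreciable and
  \<open>r\<close> over the infinitesimal elements. By saturation \<open>r\<close> may be fixed, but \<open>v\<close> may not.\<close>

definition family :: "'a set \<Rightarrow> nat \<Rightarrow> ((nat \<Rightarrow> 'a) \<Rightarrow> 'a \<Rightarrow> 'a \<Rightarrow> bool) \<Rightarrow> bool" where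
  "family A n Z \<longleftrightarrow> continuum_sized A \<and> {0, 1} \<subseteq> A \<and> definable_rel M A n Z \<and>
     (\<forall>x v w r s. Z x v r \<longrightarrow> 0 < w \<longrightarrow> w \<le> v \<longrightarrow> r \<le> s \<longrightarrow> Z x w s)"

definition realized :: "nat \<Rightarrow> ((nat \<Rightarrow> 'a) \<Rightarrow> 'a \<Rightarrow> 'a \<Rightarrow> bool) \<Rightarrow> (nat \<Rightarrow> real) set" where
  "realized n Z = {p \<in> tuples n. \<exists>x\<in>tuples n. \<exists>v r. near n x p \<and> appreciable v \<and> infinitesimal r \<and> Z x v r}"

definition traced :: "nat \<Rightarrow> (nat \<Rightarrow> real) set \<Rightarrow> bool" where
  "traced n S \<longleftrightarrow> (\<exists>A Z. family A n Z \<and> S = realized n Z)"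

lemma familyD:
  assumes "family A n Z"
  shows "continuum_sized A" "0 \<in> A" "1 \<in> A" "definable_rel M A n Z"
    "\<And>x v w r s. Z x v r \<Longrightarrow> 0 < w \<Longrightarrow> w \<le> v \<Longrightarrow> r \<le> s \<Longrightarrow> Z x w s"
  using assms unfolding family_def by (blast | simp)+

lemma familyI:
  assumes "continuum_sized A" "0 \<in> A" "1 \<in> A" 
    "definable_pred M A (\<lambda>e. Z (\<lambda>i\<in>{..<n}. e (i + 2)) (e 0) (e 1))"
    "\<And>x v w r s. Z x v r \<Longrightarrow> 0 < w \<Longrightarrow> w \<le> v \<Longrightarrow> r \<le> s \<Longrightarrow> Z x w s"
  shows "family A n Z"
  using assms unfolding family_def definable_rel_def by blast

lemma realizedI:
  "p \<in> tuples n \<Longrightarrow> x \<in> tuples n \<Longrightarrow> near n x p \<Longrightarrow> appreciable v \<Longrightarrow> infinitesimal r \<Longrightarrow> Z x v r \<Longrightarrow> p \<in> realized n Z"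
  unfolding realized_def by blast

lemma realizedE:
  assumes "p \<in> realized n Z"
  obtains x v r where "p \<in> tuples n" "x \<in> tuples n" "near n x p" "appreciable v" "infinitesimal r" "Z x v r"
  using assms unfolding realized_def by blast

section \<open>Basic traced sets, unions, intersections and projections\<close>

lemma traced_st_set:
  assumes "continuum_sized A" "0 \<in> A" "1 \<in> A" "definable_pred M A (\<lambda>e. (\<lambda>i\<in>{..<n}. e i) \<in> X)" "X \<subseteq> tuples n"
  shows "traced n (st_set n X)"
proof -
  have "family A n (\<lambda>x v r. x \<in> X)"
    by (rule familyI) (use assms in \<open>auto intro!: definable_pred_mem[OF assms(4)] tuple_fun_vars\<close>)
  moreover have "st_set n X = realized n (\<lambda>x v r. x \<in> X)"
  proof (intro equalityI subsetI)
    fix p assume "p \<in> st_set n X"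
    then obtain x where x: "p \<in> tuples n" "x \<in> X" "near n x p" using st_set_iff[OF assms(5)] by blast
    obtain r :: 'a where "infinitesimal r" using ex_infinitesimal by blast
    then show "p \<in> realized n (\<lambda>x v r. x \<in> X)"
      using x assms(5) appreciable_inverse[of 1] by (intro realizedI[of p n x 1 r]) auto
  next
    fix p assume "p \<in> realized n (\<lambda>x v r. x \<in> X)"
    then show "p \<in> st_set n X" using st_set_iff[OF assms(5)] unfolding realized_def by blast
  qed
  ultimately show ?thesis unfolding traced_def by blast
qed

text \<open>Overspill turns points of \<open>X\<close> within 1/k of a fixed lift of
  \<open>p\<close>, for every \<open>k\<close>, into one at infinitesimal distance. It follows both
  that st(X) is closed and that a lift of a point outside keeps an appreciable distance from
  \<open>X\<close>.\<close>

lemma st_set_ex_near_by: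
  assumes def: "definable_pred M A (\<lambda>e. (\<lambda>i\<in>{..<n}. e i) \<in> X)" and X: "X \<subseteq> tuples n"
    and p: "p \<in> tuples n" and x: "x \<in> tuples n" "near n x p"
    and ex: "\<And>k. k > 0 \<Longrightarrow> \<exists>y\<in>X. near_by n x y (1 / of_nat k)"
  shows "p \<in> st_set n X"
proof -
  have "definable_pred M (A \<union> x ` {..<n}) (\<lambda>e. \<exists>y\<in>tuples n. y \<in> X \<and> near_by n x y (e 0))"
    by (intro definable_pred_ex_tuple definable_pred_conj definable_pred_mem[OF def] definable_pred_near_by
        tuple_fun_vars[where f = "\<lambda>i. i"] tuple_fun_const term_fun_var x(1)) auto
  moreover have "\<exists>v. 0 < v \<and> v \<le> 1 / of_nat k \<and> (\<exists>y\<in>tuples n. y \<in> X \<and> near_by n x y v)" if "k > 0" for k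
    using ex[OF that] X that by (intro exI[of _ "1 / of_nat k"]) auto
  ultimately have "\<exists>v. infinitesimal v \<and> (\<exists>y\<in>tuples n. y \<in> X \<and> near_by n x y v)"
    by (rule overspill[where p = "\<lambda>v. \<exists>y\<in>tuples n. y \<in> X \<and> near_by n x y v"])
  then obtain v y where "infinitesimal v" "y \<in> X" "near_by n x y v" by blast
  then have "near n y p" using near_infinitesimal[OF x(2)] by blast
  then show ?thesis using st_set_iff[OF X] p \<open>y \<in> X\<close> by blast
qed

lemma st_set_adherent:
  assumes def: "definable_pred M A (\<lambda>e. (\<lambda>i\<in>{..<n}. e i) \<in> X)" and X: "X \<subseteq> tuples n"
    and p: "p \<in> tuples n"
    and ex: "\<And>k. k > 0 \<Longrightarrow> \<exists>s\<in>st_set n X. \<forall>i<n. \<bar>p i - s i\<bar> < 1 / real k"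
  shows "p \<in> st_set n X"
proof -
  obtain x :: "nat \<Rightarrow> 'a" where x: "x \<in> tuples n" "near n x p" using ex_near by blast
  have "\<exists>y\<in>X. near_by n x y (1 / of_nat k)" if "k > 0" for k
  proof -
    obtain s where s: "s \<in> st_set n X" "\<forall>i<n. \<bar>p i - s i\<bar> < 1 / real k" using ex[OF \<open>k > 0\<close>] by blast
    then obtain y where "y \<in> X" "near n y s" using st_set_iff[OF X] by blast
    then show ?thesis using near_near_by_inverse[OF x(2) _ s(2)] by blast
  qed
  then show ?thesis by (rule st_set_ex_near_by[OF def X p x])
qed

text \<open>Having no point of \<open>X\<close> within \<open>v\<close> passes to smaller
  \<open>v\<close>, which is the monotonicity required of a family. Two lifts of a point of st(X)
  would lie within every appreciable distance of each other.\<close>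

lemma traced_compl_st_set:
  assumes A: "continuum_sized A" "0 \<in> A" "1 \<in> A"
    and def: "definable_pred M A (\<lambda>e. (\<lambda>i\<in>{..<n}. e i) \<in> X)" and X: "X \<subseteq> tuples n"
  shows "traced n (tuples n - st_set n X)"
proof -
  let ?Z = "\<lambda>x v r. \<not> (\<exists>y\<in>tuples n. y \<in> X \<and> near_by n x y v)"
  have "family A n ?Z"
  proof (rule familyI)
    show "definable_pred M A (\<lambda>e. ?Z (\<lambda>i\<in>{..<n}. e (i + 2)) (e 0) (e 1))"
      by (intro definable_pred_not definable_pred_ex_tuple definable_pred_conj definable_pred_mem[OF def]
          definable_pred_near_by tuple_fun_vars[where f = "\<lambda>i. i"] tuple_fun_vars term_fun_var order_refl)
    show "?Z x w s" if "?Z x v r" "0 < w" "w \<le> v" "r \<le> s" for x v w r s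
      using that(1) near_by_mono[OF _ that(3)] by blast
  qed (use A in auto)
  moreover have "tuples n - st_set n X = realized n ?Z"
  proof (intro equalityI subsetI)
    fix p assume p: "p \<in> tuples n - st_set n X"
    obtain x :: "nat \<Rightarrow> 'a" where x: "x \<in> tuples n" "near n x p" using ex_near by blast
    have "\<not> (\<forall>k>0. \<exists>y\<in>X. near_by n x y (1 / of_nat k))"
      using st_set_ex_near_by[OF def X _ x] p by blast
    then obtain k where k: "k > 0" "\<not> (\<exists>y\<in>X. near_by n x y (1 / of_nat k))" by blast
    obtain r :: 'a where "infinitesimal r" using ex_infinitesimal by blast
    then show "p \<in> realized n ?Z"
      using p x k appreciable_inverse[OF k(1)] by (intro realizedI[of p n x "1 / of_nat k" r]) auto
  next
    fix p assume "p \<in> realized n ?Z"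
    then obtain x v r where x: "p \<in> tuples n" "x \<in> tuples n" "near n x p" "appreciable v" "?Z x v r"
      by (rule realizedE)
    have "p \<notin> st_set n X"
    proof
      assume "p \<in> st_set n X"
      then obtain y where y: "y \<in> X" "near n y p" using st_set_iff[OF X] by blast
      then have "near_by n x y v" using near_near_by_appreciable[OF x(3) y(2) x(4)] by blast
      then show False using x(5) y(1) X by blast
    qed
    then show "p \<in> tuples n - st_set n X" using x(1) by simp
  qed
  ultimately show ?thesis unfolding traced_def by blast
qed

lemma traced_Un:
  assumes "traced n S" "traced n T"
  shows "traced n (S \<union> T)"
proof -
  obtain A Z B Y where fam: "family A n Z" "family B n Y" and ST: "S = realized n Z" "T = realized n Y"
    using assms unfolding traced_def by blast
  note A = familyD[OF fam(1)] and B = familyD[OF fam(2)]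
  let ?W = "\<lambda>x v r. Z x v r \<or> Y x v r"
  have "family (A \<union> B) n ?W"
  proof (rule familyI)
    show "definable_pred M (A \<union> B) (\<lambda>e. ?W (\<lambda>i\<in>{..<n}. e (i + 2)) (e 0) (e 1))"
      by (intro definable_pred_disj definable_relD[OF A(4)] definable_relD[OF B(4)] tuple_fun_vars term_fun_var) auto
    show "?W x w s" if "?W x v r" "0 < w" "w \<le> v" "r \<le> s" for x v w r s
      using that(1) A(5)[OF _ that(2-)] B(5)[OF _ that(2-)] by blast
  qed (use A B in \<open>auto intro: continuum_sized_Un\<close>)
  moreover have "S \<union> T = realized n ?W" unfolding ST realized_def by blast
  ultimately show ?thesis unfolding traced_def by blast
qed

text \<open>The two sets may have different lifts of the same real point as witnesses; lifts of one
  point are infinitely close, and \<open>r\<close> absorbs their distance.\<close>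

lemma traced_Int:
  assumes "traced n S" "traced n T"
  shows "traced n (S \<inter> T)"
proof -
  obtain A Z B Y where fam: "family A n Z" "family B n Y" and ST: "S = realized n Z" "T = realized n Y"
    using assms unfolding traced_def by blast
  note A = familyD[OF fam(1)] and B = familyD[OF fam(2)]
  let ?W = "\<lambda>x v r. Z x v r \<and> (\<exists>y\<in>tuples n. near_by n x y r \<and> Y y v r)"
  have "family (A \<union> B) n ?W"
  proof (rule familyI)
    show "definable_pred M (A \<union> B) (\<lambda>e. ?W (\<lambda>i\<in>{..<n}. e (i + 2)) (e 0) (e 1))"
      by (intro definable_pred_conj definable_pred_ex_tuple definable_relD[OF A(4)] definable_relD[OF B(4)]
          definable_pred_near_by tuple_fun_vars[where f = "\<lambda>i. i"] tuple_fun_vars term_fun_var) auto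
    show "?W x w s" if "?W x v r" "0 < w" "w \<le> v" "r \<le> s" for x v w r s
      using that(1) A(5)[OF _ that(2-)] B(5)[OF _ that(2-)] near_by_mono[OF _ that(4)] by blast
  qed (use A B in \<open>auto intro: continuum_sized_Un\<close>)
  moreover have "S \<inter> T = realized n ?W"
  proof (intro equalityI subsetI)
    fix p assume "p \<in> S \<inter> T"
    then have p: "p \<in> realized n Z" "p \<in> realized n Y" unfolding ST by auto
    obtain x v r where x: "p \<in> tuples n" "x \<in> tuples n" "near n x p" "appreciable v" "infinitesimal r" "Z x v r"
      using p(1) by (rule realizedE)
    obtain y w s where y: "y \<in> tuples n" "near n y p" "appreciable w" "infinitesimal s" "Y y w s"
      using p(2) by (rule realizedE)
    obtain t where t: "infinitesimal t" "near_by n x y t" using near_ex_near_by[OF x(3) y(2)] by blast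
    let ?v = "min v w" and ?r = "max t (max r s)"
    have v: "appreciable ?v" using x(4) y(3) by (rule appreciable_min)
    have "Z x ?v ?r" by (rule A(5)[OF x(6) appreciable_pos[OF v]]) auto
    moreover have "Y y ?v ?r" by (rule B(5)[OF y(5) appreciable_pos[OF v]]) auto
    moreover have "near_by n x y ?r" by (rule near_by_mono[OF t(2)]) auto
    ultimately show "p \<in> realized n ?W"
      using x(1,2,3) y(1) v infinitesimal_max[OF t(1) infinitesimal_max[OF x(5) y(4)]]
      by (intro realizedI[of p n x ?v ?r]) auto
  next
    fix p assume "p \<in> realized n ?W"
    then obtain x v r where x: "p \<in> tuples n" "x \<in> tuples n" "near n x p" "appreciable v" "infinitesimal r" "?W x v r"
      by (rule realizedE)
    then obtain y where y: "y \<in> tuples n" "near_by n x y r" "Y y v r" by blast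
    have "near n y p" using near_infinitesimal[OF x(3) y(2) x(5)] .
    then have "p \<in> T" unfolding ST using x y by (intro realizedI[of p n y v r]) auto
    moreover have "p \<in> S" unfolding ST using x by (intro realizedI[of p n x v r]) auto
    ultimately show "p \<in> S \<inter> T" by simp
  qed
  ultimately show ?thesis unfolding traced_def by blast
qed

text \<open>Projections and cylinders at once: only the coordinates in \<open>I\<close> are
  compared. The witness \<open>y\<close> must be finite also in the coordinates that are forgotten;
  bounding them by 1/v with \<open>v\<close> appreciable ensures this. Comparing up to
  \<open>r\<close> allows any lift \<open>x\<close> of \<open>p\<close>.\<close>

lemma traced_image:
  assumes "traced N S" and I: "I \<subseteq> {..<n}" "I \<subseteq> {..<N}"
  shows "traced n {p \<in> tuples n. \<exists>q\<in>S. \<forall>i\<in>I. p i = q i}"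
proof -
  obtain A Z where fam: "family A N Z" and S: "S = realized N Z" using assms(1) unfolding traced_def by blast
  note A = familyD[OF fam]
  let ?b = "\<lambda>y v. \<forall>j<N. y j * v \<le> 1 \<and> 0 \<le> y j * v + 1"
  let ?c = "\<lambda>x y r. \<forall>i<n. i \<in> I \<longrightarrow> x i \<le> y i + r \<and> y i \<le> x i + r"
  let ?W = "\<lambda>x v r. \<exists>y\<in>tuples N. Z y v r \<and> ?c x y r \<and> ?b y v"
  have "family A n ?W"
  proof (rule familyI)
    have *: "term_fun M A (\<lambda>e. (\<lambda>i\<in>{..<n}. e i) i)" if "i < n" for i n
      using that by (simp add: term_fun_var)
    have c: "definable_pred M A (\<lambda>e. i \<in> I \<longrightarrow> (\<lambda>i\<in>{..<n}. e (i + 2 + N)) i \<le> (\<lambda>i\<in>{..<N}. e i) i + e (1 + N)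
        \<and> (\<lambda>i\<in>{..<N}. e i) i \<le> (\<lambda>i\<in>{..<n}. e (i + 2 + N)) i + e (1 + N))" if "i < n" for i
    proof (cases "i \<in> I")
      case True
      then have "i < N" "i < n" using I by auto
      then show ?thesis
        by (simp del: restrict_apply add: True)
           (intro definable_pred_conj definable_pred_le term_fun_add; simp add: term_fun_var)
    next
      case False
      then show ?thesis by (simp add: definable_pred_const)
    qed
    have "definable_pred M A (\<lambda>e. Z (\<lambda>i\<in>{..<N}. e i) (e (0 + N)) (e (1 + N)) \<and>
      ?c (\<lambda>i\<in>{..<n}. e (i + 2 + N)) (\<lambda>i\<in>{..<N}. e i) (e (1 + N)) \<and> ?b (\<lambda>i\<in>{..<N}. e i) (e (0 + N)))"
      by (intro definable_pred_conj definable_relD[OF A(4)] definable_pred_ball_less c definable_pred_le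
          term_fun_add term_fun_mult * term_fun_var tuple_fun_vars[where f = "\<lambda>i. i"] term_fun_const A order_refl)
    then show "definable_pred M A (\<lambda>e. ?W (\<lambda>i\<in>{..<n}. e (i + 2)) (e 0) (e 1))"
      by (rule definable_pred_ex_tuple)
    show "?W x w s" if W: "?W x v r" and h: "0 < w" "w \<le> v" "r \<le> s" for x v w r s
    proof -
      obtain y where y: "y \<in> tuples N" "Z y v r" "?c x y r" "?b y v" using W by blast
      have "?c x y s"
        using y(3) order_trans[OF _ add_left_mono[OF h(3)]] by blast
      moreover have "?b y w"
      proof (intro allI impI conjI)
        fix j assume j: "j < N"
        show "y j * w \<le> 1" using mult_le_1_mono[OF _ h(1,2)] y(4) j by blast
        have "- y j * v \<le> 1" using y(4) j zero_le_mult_add_1_iff by blast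
        then have "- y j * w \<le> 1" by (rule mult_le_1_mono[OF _ h(1,2)])
        then show "0 \<le> y j * w + 1" unfolding zero_le_mult_add_1_iff .
      qed
      ultimately show ?thesis using y(1) A(5)[OF y(2) h] by blast
    qed
  qed (use A in auto)
  moreover have "{p \<in> tuples n. \<exists>q\<in>S. \<forall>i\<in>I. p i = q i} = realized n ?W"
  proof (intro equalityI subsetI)
    fix p assume "p \<in> {p \<in> tuples n. \<exists>q\<in>S. \<forall>i\<in>I. p i = q i}"
    then obtain q where p: "p \<in> tuples n" and q: "q \<in> realized N Z" "\<forall>i\<in>I. p i = q i" unfolding S by blast
    obtain y v r where y: "y \<in> tuples N" "near N y q" "appreciable v" "infinitesimal r" "Z y v r"
      using q(1) by (rule realizedE)
    obtain x :: "nat \<Rightarrow> 'a" where x: "x \<in> tuples n" "near n x p" using ex_near by blast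
    obtain w where w: "appreciable w" "?b y w" using near_ex_bound[OF y(2)] by blast
    have "x i \<in> finite_elems \<and> y i \<in> finite_elems \<and> standard_part (x i) = standard_part (y i)" if i: "i \<in> I" for i
    proof -
      have "i < n" "i < N" using i I by auto
      then show ?thesis using x(2) y(2) q(2) i by (simp add: near_def)
    qed
    then obtain t where t: "infinitesimal t" "\<forall>i\<in>I. x i \<le> y i + t \<and> y i \<le> x i + t"
      using infinitely_close_ex_infinitesimal[of I x y] finite_subset[OF I(1)] by auto
    then have c: "?c x y t" by blast
    let ?v = "min v w" and ?r = "max r t"
    have v: "appreciable ?v" using y(3) w(1) by (rule appreciable_min)
    have "Z y ?v ?r" by (rule A(5)[OF y(5) appreciable_pos[OF v]]) auto
    moreover have "?c x y ?r" using c order_trans[OF _ add_left_mono[of t ?r]] by (metis max.cobounded2)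
    moreover have "?b y ?v"
    proof (intro allI impI conjI)
      fix j assume j: "j < N"
      show "y j * ?v \<le> 1" by (rule mult_le_1_mono[of _ w]) (use w j appreciable_pos[OF v] in auto)
      have "- y j * w \<le> 1" using w(2) j zero_le_mult_add_1_iff by blast
      then have "- y j * ?v \<le> 1" by (rule mult_le_1_mono[OF _ appreciable_pos[OF v]]) simp
      then show "0 \<le> y j * ?v + 1" unfolding zero_le_mult_add_1_iff .
    qed
    ultimately have "?W x ?v ?r" using y(1) by blast
    then show "p \<in> realized n ?W"
      by (rule realizedI[OF p x v infinitesimal_max[OF y(4) t(1)]])
  next
    fix p assume "p \<in> realized n ?W"
    then obtain x v r where x: "p \<in> tuples n" "x \<in> tuples n" "near n x p" "appreciable v" "infinitesimal r" "?W x v r"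
      by (rule realizedE)
    then obtain y where y: "y \<in> tuples N" "Z y v r" "?c x y r" "?b y v" by blast
    let ?q = "\<lambda>i\<in>{..<N}. standard_part (y i)"
    have "near N y ?q"
      by (rule near_of_finite) (use finite_elems_of_mult_le_1[OF _ _ x(4)] y(4) in blast)
    then have "?q \<in> S" unfolding S using x y by (intro realizedI[of ?q N y v r]) auto
    moreover have "p i = ?q i" if i: "i \<in> I" for i
    proof -
      have "i < n" "i < N" using i I by auto
      then have "standard_part (y i) = standard_part (x i)"
        using standard_part_eq_infinitesimal(2)[OF _ _ _ x(5), of "x i" "y i"] x(3) y(3) i by (simp add: near_def)
      then show ?thesis using x(3) \<open>i < n\<close> \<open>i < N\<close> by (simp add: near_def)
    qed
    ultimately show "p \<in> {p \<in> tuples n. \<exists>q\<in>S. \<forall>i\<in>I. p i = q i}" using x(1) by blast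
  qed
  ultimately show ?thesis unfolding traced_def by blast
qed

end

section \<open>Complements of traced sets\<close>

context saturated_o_minimal_field
begin

text \<open>One witness \<open>\<rho> p\<close> is chosen for each real point of the set, which
  makes at most a continuum of infinitesimals; one above all of them serves every point, since
  \<open>Z\<close> increases in its last argument.\<close>

lemma realized_fix_infinitesimal:
  assumes "family A n Z"
  shows "\<exists>r. infinitesimal r \<and> family (insert r A) n (\<lambda>x v _. Z x v r) \<and>
    realized n Z = realized n (\<lambda>x v _. Z x v r)"
proof -
  note A = familyD[OF assms]
  define \<rho> where "\<rho> p = (SOME r. \<exists>x\<in>tuples n. \<exists>v. near n x p \<and> appreciable v \<and> infinitesimal r \<and> Z x v r)" for p
  have \<rho>: "\<exists>x\<in>tuples n. \<exists>v. near n x p \<and> appreciable v \<and> infinitesimal (\<rho> p) \<and> Z x v (\<rho> p)"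
    if "p \<in> realized n Z" for p
    unfolding \<rho>_def by (rule someI_ex) (use that in \<open>auto simp: realized_def\<close>)
  have "continuum_sized (\<rho> ` realized n Z)"
    by (intro continuum_sized_image continuum_sized_subset[OF _ continuum_sized_real_tuples[of n]])
       (auto simp: realized_def)
  moreover have "s \<le> 1 / of_nat k" if s: "s \<in> \<rho> ` realized n Z" and k: "k > 0" for s and k :: nat
  proof -
    obtain p where p: "p \<in> realized n Z" "s = \<rho> p" using s by blast
    then have "infinitesimal s" using \<rho>[OF p(1)] by blast
    then show ?thesis using k unfolding infinitesimal_def by blast
  qed
  ultimately obtain r where r: "infinitesimal r" "\<forall>s\<in>\<rho> ` realized n Z. s < r"
    using ex_infinitesimal_greater[OF A(1), of "\<rho> ` realized n Z"] by blast
  have "family (insert r A) n (\<lambda>x v _. Z x v r)"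
  proof (rule familyI)
    show "definable_pred M (insert r A) (\<lambda>e. Z (\<lambda>i\<in>{..<n}. e (i + 2)) (e 0) r)"
      by (intro definable_relD[OF A(4)] tuple_fun_vars term_fun_var term_fun_const) auto
    have "continuum_sized ({r} \<union> A)"
      by (intro continuum_sized_Un A(1) continuum_sized_countable) auto
    then show "continuum_sized (insert r A)" by simp
    show "Z x w r" if "Z x v r" "0 < w" "w \<le> v" for x v w :: "_" using A(5)[OF that order_refl] .
  qed (use A in auto)
  moreover have "realized n Z = realized n (\<lambda>x v _. Z x v r)"
  proof (intro equalityI subsetI)
    fix p assume p: "p \<in> realized n Z"
    then obtain x v where x: "x \<in> tuples n" "near n x p" "appreciable v" "Z x v (\<rho> p)" using \<rho> by blast
    have "\<rho> p \<le> r" using r(2) p by (simp add: less_imp_le)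
    then have "Z x v r" using A(5)[OF x(4) appreciable_pos[OF x(3)] order_refl] by blast
    then show "p \<in> realized n (\<lambda>x v _. Z x v r)"
      using p x r(1) by (intro realizedI[of p n x v r]) (auto simp: realized_def)
  next
    fix p assume "p \<in> realized n (\<lambda>x v _. Z x v r)"
    then show "p \<in> realized n Z" unfolding realized_def using r(1) by blast
  qed
  ultimately show ?thesis using r(1) by blast
qed

section \<open>Level sets of a family and the closure of the realized set\<close>

lemma definable_pred_family:
  assumes "family A n (\<lambda>x v _. Z x v)" "A \<subseteq> B" "tuple_fun M B n X" "term_fun M B F"
  shows "definable_pred M B (\<lambda>e. Z (X e) (F e))"
  using definable_relD[OF familyD(4)[OF assms(1)] assms(2,3,4,4)] .

definition adherent :: "nat \<Rightarrow> (nat \<Rightarrow> real) set \<Rightarrow> (nat \<Rightarrow> real) \<Rightarrow> bool" where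
  "adherent n S p \<longleftrightarrow> (\<forall>k>0. \<exists>s\<in>S. \<forall>i<n. \<bar>p i - s i\<bar> < 1 / real k)"

lemma definable_level:
  assumes "family A n (\<lambda>x v _. Z x v)"
  shows "definable_pred M (insert r A) (\<lambda>e. (\<lambda>i\<in>{..<n}. e i) \<in> {x \<in> tuples n. Z x r})"
proof -
  have "definable_pred M (insert r A) (\<lambda>e. Z (\<lambda>i\<in>{..<n}. e i) r)"
    by (rule definable_pred_family[OF assms])
       (auto intro: tuple_fun_vars[where f = "\<lambda>i. i"] term_fun_const)
  then show ?thesis by simp
qed

text \<open>If \<open>p\<close> is not adherent, then the level sets at appreciable \<open>v\<close>
  keep a fixed distance from a lift of \<open>p\<close>, and by overspill so does the one at some
  infinitesimal \<open>\<omega> p\<close>. The level set at an \<open>r\<close> above all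
  \<open>\<omega> p\<close> lies in each of the latter and contains all the former, and its standard
  part is closed.\<close>

lemma adherent_realized:
  assumes fam: "family A n (\<lambda>x v _. Z x v)"
  shows "\<exists>r. infinitesimal r \<and>
    (\<forall>p\<in>tuples n. p \<in> st_set n {x \<in> tuples n. Z x r} \<longleftrightarrow> adherent n (realized n (\<lambda>x v _. Z x v)) p)"
proof -
  note A = familyD[OF fam]
  let ?R = "realized n (\<lambda>x v _. Z x v)"
  let ?far = "\<lambda>p w. infinitesimal w \<and> (\<exists>x'\<in>tuples n. near n x' p \<and> (\<exists>k>0. \<not> (\<exists>x\<in>tuples n. near_by n x' x (1 / of_nat k) \<and> Z x w)))"
  have ex_far: "\<exists>w. ?far p w" if p: "p \<in> tuples n" "\<not> adherent n ?R p" for p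
  proof -
    obtain k where k: "k > 0" "\<not> (\<exists>s\<in>?R. \<forall>i<n. \<bar>p i - s i\<bar> < 1 / real k)" using p(2) unfolding adherent_def by blast
    obtain x' :: "nat \<Rightarrow> 'a" where x': "x' \<in> tuples n" "near n x' p" using ex_near by blast
    \<comment> \<open>Half the radius: the weak bound 1/(2k) on standard parts gives the strict
      bound 1/k in the definition of adherence.\<close>
    let ?q = "\<lambda>w. \<not> (\<exists>x\<in>tuples n. near_by n x' x (1 / of_nat (2 * k)) \<and> Z x w)"
    have "definable_pred M (insert (1 / of_nat (2 * k)) (A \<union> x' ` {..<n})) (\<lambda>e. ?q (e 0))"
      by (intro definable_pred_not definable_pred_ex_tuple definable_pred_conj definable_pred_near_by
          tuple_fun_vars[where f = "\<lambda>i. i"] tuple_fun_const x'(1) term_fun_const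
          definable_pred_family[OF fam] term_fun_var) auto
    moreover have q: "?q v" if "appreciable v" for v
    proof
      assume "\<exists>x\<in>tuples n. near_by n x' x (1 / of_nat (2 * k)) \<and> Z x v"
      then obtain x where x: "x \<in> tuples n" "near_by n x' x (1 / of_nat (2 * k))" "Z x v" by blast
      let ?s = "\<lambda>i\<in>{..<n}. standard_part (x i)"
      have s: "near n x ?s" by (rule near_of_finite) (rule near_by_finite_elems[OF x'(2) x(2)])
      obtain r :: 'a where "infinitesimal r" using ex_infinitesimal by blast
      then have "?s \<in> ?R" using x s that by (intro realizedI[of ?s n x v r]) auto
      moreover have "\<bar>p i - ?s i\<bar> < 1 / real k" if "i < n" for i
      proof -
        have "\<bar>p i - ?s i\<bar> \<le> 1 / real (2 * k)" by (rule near_dist_le[OF x'(2) s x(2) that])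
        also have "\<dots> < 1 / real k" using k(1) by (intro inverse_of_nat_less) auto
        finally show ?thesis .
      qed
      ultimately show False using k(2) by blast
    qed
    have "\<exists>v. 0 < v \<and> v \<le> 1 / of_nat j \<and> ?q v" if "j > 0" for j
      using q[OF appreciable_inverse[OF that]] that by (intro exI[of _ "1 / of_nat j"]) auto
    ultimately have "\<exists>w. infinitesimal w \<and> ?q w" by (rule overspill[where p = ?q])
    then obtain w where w: "infinitesimal w" "?q w" by blast
    have "2 * k > 0" using k(1) by simp
    then show ?thesis using w x' by blast
  qed
  define \<omega> where "\<omega> p = (SOME w. ?far p w)" for p
  have \<omega>: "?far p (\<omega> p)" if "p \<in> tuples n" "\<not> adherent n ?R p" for p
    unfolding \<omega>_def by (rule someI_ex) (rule ex_far[OF that])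
  let ?B = "{p \<in> tuples n. \<not> adherent n ?R p}"
  have "continuum_sized (\<omega> ` ?B)"
    by (intro continuum_sized_image continuum_sized_subset[OF _ continuum_sized_real_tuples[of n]]) auto
  moreover have "s \<le> 1 / of_nat k" if s: "s \<in> \<omega> ` ?B" and k: "k > 0" for s and k :: nat
  proof -
    obtain p where p: "p \<in> tuples n" "\<not> adherent n ?R p" "s = \<omega> p" using s by blast
    then have "infinitesimal s" using \<omega>[OF p(1,2)] by blast
    then show ?thesis using k unfolding infinitesimal_def by blast
  qed
  ultimately obtain r where r: "infinitesimal r" "\<forall>s\<in>\<omega> ` ?B. s < r"
    using ex_infinitesimal_greater[OF A(1), of "\<omega> ` ?B"] by blast
  have r0: "0 < r" using r(1) by (simp add: infinitesimal_def)
  let ?X = "{x \<in> tuples n. Z x r}"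
  have X: "?X \<subseteq> tuples n" by blast
  have "p \<in> st_set n ?X \<longleftrightarrow> adherent n ?R p" if p: "p \<in> tuples n" for p
  proof
    assume "p \<in> st_set n ?X"
    then obtain x where x: "x \<in> tuples n" "Z x r" "near n x p" using st_set_iff[OF X] by blast
    show "adherent n ?R p"
    proof (rule ccontr)
      assume nadh: "\<not> adherent n ?R p"
      then have "\<omega> p < r" using r(2) p by blast
      obtain x' k where x': "near n x' p" "k > 0" "\<not> (\<exists>x\<in>tuples n. near_by n x' x (1 / of_nat k) \<and> Z x (\<omega> p))"
        and w: "infinitesimal (\<omega> p)" using \<omega>[OF p nadh] by blast
      have "0 < \<omega> p" using w by (simp add: infinitesimal_def)
      then have "Z x (\<omega> p)" using A(5)[OF x(2) _ less_imp_le[OF \<open>\<omega> p < r\<close>] order_refl] by blast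
      moreover have "near_by n x' x (1 / of_nat k)" using near_near_by_all[OF x'(1) x(3) x'(2)] .
      ultimately show False using x'(3) x(1) by blast
    qed
  next
    assume adh: "adherent n ?R p"
    have sub: "?R \<subseteq> st_set n ?X"
    proof
      fix s assume "s \<in> ?R"
      then obtain x v t where x: "s \<in> tuples n" "x \<in> tuples n" "near n x s" "appreciable v" "Z x v"
        by (rule realizedE)
      have "r \<le> v" using infinitesimal_less_appreciable[OF r(1) x(4)] by simp
      then have "Z x r" using A(5)[OF x(5) r0 _ order_refl] by blast
      then show "s \<in> st_set n ?X" using st_set_iff[OF X] x by blast
    qed
    show "p \<in> st_set n ?X"
    proof (rule st_set_adherent[OF definable_level[OF fam] X p])
      fix k :: nat assume "k > 0"
      then show "\<exists>s\<in>st_set n ?X. \<forall>i<n. \<bar>p i - s i\<bar> < 1 / real k" using adh sub unfolding adherent_def by blast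
    qed
  qed
  then show ?thesis using r(1) by blast
qed

lemma adherent_self: "p \<in> S \<Longrightarrow> adherent n S p"
  unfolding adherent_def by (intro allI impI bexI[of _ p]) auto

text \<open>\<open>peak Z x v\<close> says that \<open>v\<close> is the supremum of the \<open>w\<close> with \<open>Z x w\<close>.\<close>

definition peak :: "((nat \<Rightarrow> 'a) \<Rightarrow> 'a \<Rightarrow> bool) \<Rightarrow> (nat \<Rightarrow> 'a) \<Rightarrow> 'a \<Rightarrow> bool" where
  "peak Z x v \<longleftrightarrow> (\<forall>w. 0 < w \<and> w < v \<longrightarrow> Z x w) \<and> (\<forall>w. v < w \<longrightarrow> \<not> Z x w)"

text \<open>Positivity matters: where no level holds at all, every nonpositive element satisfies the
  formula for a peak.\<close>

lemma peak_unique: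
  assumes "peak Z x v" "peak Z x w" "0 < v" "0 < w"
  shows "v = w"
proof (rule ccontr)
  assume "v \<noteq> w"
  have False if "peak Z x v" "peak Z x w" "0 < v" "v < w" for v w
  proof -
    obtain u where u: "v < u" "u < w" using dense \<open>v < w\<close> by blast
    then have "0 < u" using \<open>0 < v\<close> by simp
    then have "Z x u" using that(2) u(2) unfolding peak_def by blast
    then show False using that(1) u(1) unfolding peak_def by blast
  qed
  then show False using assms \<open>v \<noteq> w\<close> by (metis linorder_neqE)
qed

lemma definable_peak:
  assumes "family A n (\<lambda>x v _. Z x v)" "A \<subseteq> B" "tuple_fun M B n X" "term_fun M B F"
  shows "definable_pred M B (\<lambda>e. peak Z (X e) (F e))"
proof -
  note A = familyD[OF assms(1)]
  have 0: "0 \<in> A" using A(2) .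
  have "definable_pred M A (\<lambda>e. peak Z (\<lambda>i\<in>{..<n}. e (i + 2)) (e 0))"
    unfolding peak_def
    by (intro definable_pred_conj definable_pred_all definable_pred_imp definable_pred_not definable_pred_less
        term_fun_const[OF 0] term_fun_var definable_pred_family[OF assms(1)] order_refl tuple_fun_vars)
  then have "definable_rel M A n (\<lambda>x v _. peak Z x v)" by (simp add: definable_rel_def)
  from definable_relD[OF this assms(2,3,4,4)] show ?thesis .
qed

text \<open>The levels at \<open>x\<close> form a definable set bounded by 1, so o-minimality
  provides the supremum although the field is not complete.\<close>

lemma ex_peak:
  assumes fam: "family A n (\<lambda>x v _. Z x v)" and le: "\<And>x v. Z x v \<Longrightarrow> v \<le> 1"
    and x: "x \<in> tuples n" "Z x w" "0 < w"
  shows "\<exists>s\<ge>w. peak Z x s"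
proof -
  note A = familyD[OF fam]
  have "definable_pred M (A \<union> x ` {..<n}) (\<lambda>e. 0 < e 0 \<and> Z x (e 0))"
    by (intro definable_pred_conj definable_pred_less term_fun_const definable_pred_family[OF fam] tuple_fun_const
        term_fun_var x(1)) (use A(2) in auto)
  from ex_least_upper_bound[OF this, of w 1] x(2,3) le
  obtain s where s: "\<And>v. 0 < v \<and> Z x v \<Longrightarrow> v \<le> s" "\<And>t. t < s \<Longrightarrow> \<exists>v>t. 0 < v \<and> Z x v" by blast
  have "w \<le> s" using s(1) x by blast
  moreover have "Z x v" if v: "0 < v" "v < s" for v
  proof -
    obtain u where "v < u" "Z x u" using s(2)[OF v(2)] by blast
    then show ?thesis using A(5)[OF _ v(1) less_imp_le order_refl] by blast
  qed
  moreover have "\<not> Z x v" if v: "s < v" for v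
  proof
    assume "Z x v"
    moreover have "0 < v" using v \<open>w \<le> s\<close> x(3) by simp
    ultimately show False using s(1)[of v] v by simp
  qed
  ultimately show ?thesis unfolding peak_def by (intro exI[of _ s]) blast
qed

text \<open>If \<open>p\<close> is a limit of points of the set but not one itself, then on every appreciable neighbourhood
  of \<open>p\<close> the peaks reach past the infinitesimals, while on the infinitesimal one they do not. By
  o-minimality they cannot jump over all large infinitesimals.\<close>

lemma ex_near_peak:
  assumes fam: "family A n (\<lambda>x v _. Z x v)" and le: "\<And>x v. Z x v \<Longrightarrow> v \<le> 1"
    and p: "p \<in> tuples n" and adh: "adherent n (realized n (\<lambda>x v _. Z x v)) p"
    and nin: "p \<notin> realized n (\<lambda>x v _. Z x v)"
  shows "\<exists>u. infinitesimal u \<and> (\<forall>v. infinitesimal v \<and> u < v \<longrightarrow> (\<exists>x\<in>tuples n. near n x p \<and> peak Z x v))"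
proof -
  note A = familyD[OF fam]
  obtain x' :: "nat \<Rightarrow> 'a" where x': "x' \<in> tuples n" "near n x' p" using ex_near by blast
  let ?W = "\<lambda>r v. \<exists>x\<in>tuples n. near_by n x' x r \<and> peak Z x v"
  have defW: "definable_pred M B (\<lambda>e. ?W (F e) (G e))"
    if "A \<union> x' ` {..<n} \<subseteq> B" "term_fun M B (\<lambda>e. F (\<lambda>i. e (i + n)))" "term_fun M B (\<lambda>e. G (\<lambda>i. e (i + n)))" for B F G
    by (intro definable_pred_ex_tuple definable_pred_conj definable_pred_near_by definable_peak[OF fam]
        tuple_fun_vars[where f = "\<lambda>i. i"] tuple_fun_const x'(1)) (use that in auto)
  have claim: "\<exists>u. infinitesimal u \<and> (\<forall>v. infinitesimal v \<and> u < v \<longrightarrow> ?W (1 / of_nat k) v)" if k: "k > 0" for k :: nat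
  proof -
    let ?B = "insert (1 / of_nat k) (A \<union> x' ` {..<n})"
    have "definable_pred M ?B (\<lambda>e. ?W (1 / of_nat k) (e 0))"
      by (rule defW) (auto intro: term_fun_const term_fun_var)
    from germ_at_infinitesimal_cut[OF this] obtain u w where uw: "infinitesimal u" "appreciable w"
      "(\<forall>v. u < v \<and> v < w \<longrightarrow> ?W (1 / of_nat k) v) \<or> (\<forall>v. u < v \<and> v < w \<longrightarrow> \<not> ?W (1 / of_nat k) v)"
      by (elim exE conjE) (rule that)
    from uw(3) show ?thesis
    proof
      assume "\<forall>v. u < v \<and> v < w \<longrightarrow> ?W (1 / of_nat k) v"
      then show ?thesis using uw(1,2) infinitesimal_less_appreciable by blast
    next
      \<comment> \<open>Without peaks between \<open>u\<close> and \<open>w\<close>, points of the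
        set that approach \<open>p\<close> have peaks of at least \<open>w\<close>. Then level
        \<open>w / 2\<close>, strictly below these peaks, is attained arbitrarily close to
        \<open>p\<close>, by overspill infinitely close, and \<open>p\<close> would be in the
        set.\<close>
      assume no: "\<forall>v. u < v \<and> v < w \<longrightarrow> \<not> ?W (1 / of_nat k) v"
      let ?q = "\<lambda>r. \<exists>x\<in>tuples n. near_by n x' x r \<and> Z x (w / 2)"
      have half: "appreciable (w / 2)" using appreciable_half[OF uw(2)] .
      have "definable_pred M (insert (w / 2) (A \<union> x' ` {..<n})) (\<lambda>e. ?q (e 0))"
        by (intro definable_pred_ex_tuple definable_pred_conj definable_pred_near_by
            tuple_fun_vars[where f = "\<lambda>i. i"] tuple_fun_const x'(1) term_fun_const
            definable_pred_family[OF fam] term_fun_var) auto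
      moreover have "\<exists>v. 0 < v \<and> v \<le> 1 / of_nat j \<and> ?q v" if j: "j > 0" for j
      proof -
        \<comment> \<open>Overspill asks for distance 1/j, while the absence of peaks is known
          within distance 1/k.\<close>
        let ?m = "max j k"
        have m: "0 < ?m" using j by simp
        obtain s where s: "s \<in> realized n (\<lambda>x v _. Z x v)" "\<forall>i<n. \<bar>p i - s i\<bar> < 1 / real ?m"
          using adh m unfolding adherent_def by blast
        obtain x v t where x: "x \<in> tuples n" "near n x s" "appreciable v" "Z x v"
          using s(1) by (rule realizedE)
        have nb: "near_by n x' x (1 / of_nat ?m)" by (rule near_near_by_inverse[OF x'(2) x(2) s(2)])
        obtain h where h: "v \<le> h" "peak Z x h"
          using ex_peak[OF fam _ x(1,4) appreciable_pos[OF x(3)]] le by blast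
        have "near_by n x' x (1 / of_nat k)"
          by (rule near_by_mono[OF nb inverse_of_nat_mono]) (use k in auto)
        then have "?W (1 / of_nat k) h" using x(1) h(2) by blast
        moreover have "u < h" using infinitesimal_less_appreciable[OF uw(1) appreciable_mono[OF x(3) h(1)]] .
        ultimately have "w \<le> h" using no by (meson not_le)
        then have "0 < w / 2 \<and> w / 2 < h" using appreciable_pos[OF uw(2)] by auto
        then have "Z x (w / 2)" using h(2) unfolding peak_def by blast
        then show ?thesis using nb x(1) m inverse_of_nat_mono[of j ?m, where 'a='a] j
          by (intro exI[of _ "1 / of_nat ?m"]) auto
      qed
      ultimately have "\<exists>r. infinitesimal r \<and> ?q r" by (rule overspill[where p = ?q])
      then obtain r x where r: "infinitesimal r" "x \<in> tuples n" "near_by n x' x r" "Z x (w / 2)" by blast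
      then have "near n x p" using near_infinitesimal[OF x'(2)] by blast
      then have "p \<in> realized n (\<lambda>x v _. Z x v)"
        using p half r by (intro realizedI[of p n x "w / 2" r]) auto
      then show ?thesis using nin by simp
    qed
  qed
  \<comment> \<open>The thresholds belonging to the countably many radii 1/k have a common
    infinitesimal bound; beyond it, overspill in the radius brings the peak infinitely close to
    \<open>p\<close>.\<close>
  define \<mu> where "\<mu> k = (SOME u. infinitesimal u \<and> (\<forall>v. infinitesimal v \<and> u < v \<longrightarrow> ?W (1 / of_nat k) v))" for k :: nat
  have \<mu>: "infinitesimal (\<mu> k) \<and> (\<forall>v. infinitesimal v \<and> \<mu> k < v \<longrightarrow> ?W (1 / of_nat k) v)" if "k > 0" for k
    unfolding \<mu>_def by (rule someI_ex) (rule claim[OF that])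
  have "s \<le> 1 / of_nat j" if s: "s \<in> \<mu> ` {0<..}" and j: "j > 0" for s and j :: nat
    using s \<mu> j unfolding infinitesimal_def by auto
  then obtain u where u: "infinitesimal u" "\<forall>s\<in>\<mu> ` {0<..}. s < u"
    using ex_infinitesimal_greater[OF A(1), of "\<mu> ` {0<..}"] continuum_sized_countable[of "\<mu> ` {0<..}"] by auto
  have "\<exists>x\<in>tuples n. near n x p \<and> peak Z x v" if v: "infinitesimal v" "u < v" for v
  proof -
    have "definable_pred M (insert v (A \<union> x' ` {..<n})) (\<lambda>e. ?W (e 0) v)"
      by (rule defW) (auto intro: term_fun_const term_fun_var)
    moreover have "\<exists>r. 0 < r \<and> r \<le> 1 / of_nat k \<and> ?W r v" if k: "k > 0" for k
    proof -
      have "\<mu> k < v" using u(2) v(2) k by force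
      then have "?W (1 / of_nat k) v" using \<mu>[OF k] v(1) by blast
      then show ?thesis using k by (intro exI[of _ "1 / of_nat k"]) auto
    qed
    ultimately have "\<exists>r. infinitesimal r \<and> ?W r v" by (rule overspill[where p = "\<lambda>r. ?W r v"])
    then show ?thesis using near_infinitesimal[OF x'(2)] by blast
  qed
  then show ?thesis using u(1) by blast
qed

text \<open>The last hypothesis bounds the dimension of the family by \<open>d - 1\<close>; for \<open>d = 0\<close> the family is empty.\<close>

lemma traced_compl_realized:
  assumes "family A n (\<lambda>x v _. Z x v)" "\<And>x v. Z x v \<Longrightarrow> v \<le> 1"
    and "\<And>x v. x \<in> tuples n \<Longrightarrow> 0 < v \<Longrightarrow> Z x v \<Longrightarrow>
      \<exists>I\<subseteq>{..<n}. card I < d \<and> (\<forall>i<n. x i \<in> dcl M (A \<union> x ` I))"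
  shows "traced n (tuples n - realized n (\<lambda>x v _. Z x v))"
  using assms
proof (induction d arbitrary: A Z)
  case 0
  note A = familyD[OF "0.prems"(1)]
  \<comment> \<open>Appreciable levels are positive, and no set has fewer than 0 elements, so no
    witness exists.\<close>
  have "realized n (\<lambda>x v _. Z x v) = {}"
    unfolding realized_def using "0.prems"(3) appreciable_pos by blast
  moreover have "st_set n ({} :: (nat \<Rightarrow> 'a) set) = {}" by (simp add: st_set_def)
  moreover have "traced n (tuples n - st_set n ({} :: (nat \<Rightarrow> 'a) set))"
    using A by (intro traced_compl_st_set[of A]) (auto simp: definable_pred_const)
  ultimately show ?case by simp
next
  case (Suc d)
  note fam = Suc.prems(1) and A = familyD[OF Suc.prems(1)]
  let ?R = "realized n (\<lambda>x v _. Z x v)"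
  obtain r where r: "infinitesimal r"
    "\<And>p. p \<in> tuples n \<Longrightarrow> p \<in> st_set n {x \<in> tuples n. Z x r} \<longleftrightarrow> adherent n ?R p"
    using adherent_realized[OF fam] by blast
  let ?C = "st_set n {x \<in> tuples n. Z x r}"
  have R: "?R \<subseteq> ?C"
  proof
    fix p assume p: "p \<in> ?R"
    then have "p \<in> tuples n" unfolding realized_def by blast
    then show "p \<in> ?C" using r(2) adherent_self[OF p] by blast
  qed
  let ?P = "\<lambda>p u. infinitesimal u \<and> (\<forall>v. infinitesimal v \<and> u < v \<longrightarrow> (\<exists>x\<in>tuples n. near n x p \<and> peak Z x v))"
  \<comment> \<open>Beyond the threshold \<open>\<mu> p\<close>, every infinitesimal is a peak at
    some point near \<open>p\<close>.\<close>
  define \<mu> where "\<mu> p = (SOME u. ?P p u)" for p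
  let ?B = "{p \<in> tuples n. p \<in> ?C - ?R}"
  have \<mu>: "?P p (\<mu> p)" if p: "p \<in> ?B" for p
    unfolding \<mu>_def
  proof (rule someI_ex)
    show "\<exists>u. ?P p u"
      by (rule ex_near_peak[OF fam Suc.prems(2)]) (use p r(2) in auto)
  qed
  have "continuum_sized (\<mu> ` ?B)"
    by (intro continuum_sized_image continuum_sized_subset[OF _ continuum_sized_real_tuples[of n]]) auto
  moreover have "s \<le> 1 / of_nat k" if s: "s \<in> \<mu> ` ?B" and k: "k > 0" for s and k :: nat
  proof -
    obtain p where p: "p \<in> ?B" "s = \<mu> p" using s by blast
    then have "infinitesimal s" using \<mu>[OF p(1)] by blast
    then show ?thesis using k unfolding infinitesimal_def by blast
  qed
  \<comment> \<open>Exceeding all thresholds places every point of \<open>?C - ?R\<close> in the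
    standard part of the one fibre \<open>peak Z x v\<close>; avoiding \<open>dcl M A\<close> makes
    the dimension drop on that fibre.\<close>
  ultimately obtain v where v: "infinitesimal v" "\<forall>s\<in>\<mu> ` ?B. s < v" "v \<notin> dcl M A"
    using ex_infinitesimal_greater[OF A(1), of "\<mu> ` ?B"] by blast
  have v0: "0 < v" using v(1) by (simp add: infinitesimal_def)
  have csA: "continuum_sized (insert s A')" if "continuum_sized A'" for s :: 'a and A'
    using continuum_sized_Un[OF continuum_sized_countable[of "{s}"] that] by simp
  let ?X' = "{x \<in> tuples n. peak Z x v}"
  have X': "?X' \<subseteq> tuples n" by blast
  have defX': "definable_pred M (insert v A) (\<lambda>e. (\<lambda>i\<in>{..<n}. e i) \<in> ?X')"
  proof -
    have "definable_pred M (insert v A) (\<lambda>e. peak Z (\<lambda>i\<in>{..<n}. e i) v)"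
      by (intro definable_peak[OF fam] tuple_fun_vars[where f = "\<lambda>i. i"] term_fun_const) auto
    then show ?thesis by simp
  qed
  have B: "?C - ?R \<subseteq> st_set n ?X'"
  proof
    fix p assume p: "p \<in> ?C - ?R"
    then have pt: "p \<in> tuples n" using st_set_iff[of "{x \<in> tuples n. Z x r}" n p] by blast
    then have "\<mu> p < v" "?P p (\<mu> p)" using v(2) \<mu>[of p] p by blast+
    then obtain x where "x \<in> tuples n" "near n x p" "peak Z x v" using v(1) by blast
    then show "p \<in> st_set n ?X'" using st_set_iff[OF X'] pt by blast
  qed
  \<comment> \<open>A point of the fibre has the infinitesimal peak \<open>v\<close>, so it
    satisfies no appreciable level itself. The level is carried by some \<open>y\<close> infinitely
    close, and the base point \<open>x\<close> stays in the fibre, where the dimension is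
    smaller.\<close>
  let ?Y = "\<lambda>x w s. peak Z x v \<and> (\<exists>y\<in>tuples n. near_by n x y s \<and> Z y w)"
  have famY: "family (insert v A) n ?Y"
  proof (rule familyI)
    show "definable_pred M (insert v A) (\<lambda>e. ?Y (\<lambda>i\<in>{..<n}. e (i + 2)) (e 0) (e 1))"
      by (intro definable_pred_conj definable_pred_ex_tuple definable_pred_near_by definable_peak[OF fam]
          definable_pred_family[OF fam] tuple_fun_vars[where f = "\<lambda>i. i"] tuple_fun_vars term_fun_var term_fun_const) auto
    show "?Y x w' s'" if Y: "?Y x w s" and h: "0 < w'" "w' \<le> w" "s \<le> s'" for x w w' s s'
    proof -
      obtain y where y: "y \<in> tuples n" "near_by n x y s" "Z y w" using Y by blast
      have "near_by n x y s'" by (rule near_by_mono[OF y(2) h(3)])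
      moreover have "Z y w'" by (rule A(5)[OF y(3) h(1,2) order_refl])
      ultimately show ?thesis using Y y(1) by blast
    qed
  qed (use A csA in auto)
  have Y: "realized n ?Y = ?R \<inter> st_set n ?X'"
  proof (intro equalityI subsetI)
    fix p assume "p \<in> realized n ?Y"
    then obtain x w s where x: "p \<in> tuples n" "x \<in> tuples n" "near n x p" "appreciable w" "infinitesimal s" "?Y x w s"
      by (rule realizedE)
    then obtain y where y: "y \<in> tuples n" "near_by n x y s" "Z y w" by blast
    have "near n y p" by (rule near_infinitesimal[OF x(3) y(2) x(5)])
    then have "p \<in> ?R" using x y by (intro realizedI[of p n y w s]) auto
    moreover have "p \<in> st_set n ?X'" using st_set_iff[OF X'] x by blast
    ultimately show "p \<in> ?R \<inter> st_set n ?X'" by simp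
  next
    fix p assume p: "p \<in> ?R \<inter> st_set n ?X'"
    then have "p \<in> ?R" by simp
    then obtain y w s where y: "p \<in> tuples n" "y \<in> tuples n" "near n y p" "appreciable w" "Z y w" by (rule realizedE)
    obtain x where x: "x \<in> tuples n" "peak Z x v" "near n x p" using p st_set_iff[OF X'] by blast
    obtain t where t: "infinitesimal t" "near_by n x y t" using near_ex_near_by[OF x(3) y(3)] by blast
    show "p \<in> realized n ?Y"
      by (rule realizedI[OF y(1) x(1,3) y(4) t(1)]) (use x(2) y(2,5) t(2) in blast)
  qed
  \<comment> \<open>Freezing the distance at an infinitesimal restores the form of family that the
    induction hypothesis covers.\<close>
  obtain s where s: "family (insert s (insert v A)) n (\<lambda>x w _. ?Y x w s)"
    "realized n ?Y = realized n (\<lambda>x w _. ?Y x w s)"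
    using realized_fix_infinitesimal[OF famY] by blast
  have "traced n (tuples n - realized n (\<lambda>x w _. ?Y x w s))"
  proof (rule Suc.IH[OF s(1)])
    show "w \<le> 1" if "?Y x w s" for x w using that Suc.prems(2) by blast
    fix x w assume x: "x \<in> tuples n" and "0 < w" and "?Y x w s"
    then have pk: "peak Z x v" by blast
    \<comment> \<open>A peak guarantees only the levels strictly below it.\<close>
    have "Z x (v / 2)" using pk v0 unfolding peak_def by simp
    then obtain I where I: "I \<subseteq> {..<n}" "card I < Suc d" "\<And>i. i < n \<Longrightarrow> x i \<in> dcl M (A \<union> x ` I)"
      using Suc.prems(3)[OF x, of "v / 2"] v0 by auto
    \<comment> \<open>The only positive peak at \<open>x\<close> is \<open>v\<close>, so
      \<open>v\<close> is defined over \<open>A\<close> and the coordinates of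
      \<open>x\<close>.\<close>
    have "definable_pred M (A \<union> x ` {..<n}) (\<lambda>e. 0 < e 0 \<and> peak Z x (e 0))"
      by (intro definable_pred_conj definable_pred_less term_fun_const term_fun_var definable_peak[OF fam]
          tuple_fun_const x) (use A(2) in auto)
    moreover have "(\<lambda>e. 0 < e 0 \<and> peak Z x (e 0)) = (\<lambda>e :: nat \<Rightarrow> 'a. e 0 = v)"
    proof (rule ext)
      fix e :: "nat \<Rightarrow> 'a"
      show "(0 < e 0 \<and> peak Z x (e 0)) = (e 0 = v)"
        using peak_unique[of Z x "e 0" v] pk v0 by (cases "e 0 = v") auto
    qed
    ultimately have "v \<in> dcl M (A \<union> x ` {..<n})" unfolding dcl_def by simp
    have "\<exists>J\<subseteq>I. card J < card I \<and> (\<forall>i<n. x i \<in> dcl M (insert v A \<union> x ` J))"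
      by (rule dcl_basis_shrink[OF I(1) _ \<open>v \<in> dcl M (A \<union> x ` {..<n})\<close> v(3)]) (rule I(3))
    then obtain J where J: "J \<subseteq> I" "card J < card I" "\<forall>i<n. x i \<in> dcl M (insert v A \<union> x ` J)"
      by (elim exE conjE) (rule that)
    have "J \<subseteq> {..<n}" "card J < d" using J(1,2) I(1,2) by auto
    moreover have "x i \<in> dcl M (insert s (insert v A) \<union> x ` J)" if "i < n" for i
    proof -
      have "dcl M (insert v A \<union> x ` J) \<subseteq> dcl M (insert s (insert v A) \<union> x ` J)"
        by (rule dcl_mono) auto
      then show ?thesis using J(3) that by auto
    qed
    ultimately show "\<exists>I\<subseteq>{..<n}. card I < d \<and> (\<forall>i<n. x i \<in> dcl M (insert s (insert v A) \<union> x ` I))" by blast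
  qed
  moreover have "traced n (st_set n ?X')"
    by (rule traced_st_set[OF _ _ _ defX' X']) (use A csA in auto)
  ultimately have "traced n (st_set n ?X' \<inter> (tuples n - realized n (\<lambda>x w _. ?Y x w s)))" 
    by (intro traced_Int)
  moreover have "traced n (tuples n - ?C)"
    by (rule traced_compl_st_set[OF _ _ _ definable_level[OF fam]]) (use A csA in auto)
  ultimately have "traced n ((tuples n - ?C) \<union> (st_set n ?X' \<inter> (tuples n - realized n (\<lambda>x w _. ?Y x w s))))"
    by (intro traced_Un)
  \<comment> \<open>A point outside \<open>?R\<close> is outside the closure \<open>?C\<close> or in
    \<open>?C - ?R\<close>. In the latter case it lies in the standard part of the fibre, where
    \<open>?R\<close> agrees with the realized set of \<open>?Y\<close>.\<close>
  moreover have "tuples n - ?R = (tuples n - ?C) \<union> (st_set n ?X' \<inter> (tuples n - realized n (\<lambda>x w _. ?Y x w s)))"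
    unfolding s(2)[symmetric] Y using R B st_set_iff[OF X'] by blast
  ultimately show ?case by simp
qed

text \<open>By monotonicity any appreciable level can be lowered to at most 1, so cutting the levels
  off at 1 keeps the set and bounds the suprema. The dimension count starts with all
  \<open>n\<close> coordinates as generators.\<close>

lemma traced_compl:
  assumes "traced n S"
  shows "traced n (tuples n - S)"
proof -
  obtain B Y where BY: "family B n Y" "S = realized n Y" using assms unfolding traced_def by blast
  obtain A Z where fam: "family A n (\<lambda>x v _. Z x v)" and S: "S = realized n (\<lambda>x v _. Z x v)"
    using realized_fix_infinitesimal[OF BY(1)] unfolding BY(2)[symmetric] by (elim exE conjE) (rule that)
  note A = familyD[OF fam]
  let ?Z = "\<lambda>x v. Z x v \<and> v \<le> 1"
  have fam': "family A n (\<lambda>x v _. ?Z x v)"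
  proof (rule familyI)
    show "definable_pred M A (\<lambda>e. ?Z (\<lambda>i\<in>{..<n}. e (i + 2)) (e 0))"
      by (intro definable_pred_conj definable_pred_family[OF fam] definable_pred_le tuple_fun_vars term_fun_var
          term_fun_const A order_refl)
    show "?Z x w" if "?Z x v" "0 < w" "w \<le> v" for x v w
      using that A(5)[OF _ that(2,3) order_refl] by auto
  qed (use A in auto)
  have "realized n (\<lambda>x v _. ?Z x v) = S"
  proof (intro equalityI subsetI)
    fix p assume "p \<in> S"
    then obtain x v and r :: 'a where x: "p \<in> tuples n" "x \<in> tuples n" "near n x p" "appreciable v"
      "infinitesimal r" "Z x v"
      unfolding S by (rule realizedE)
    have "appreciable (min v 1)" using x(4) appreciable_inverse[of 1] by (intro appreciable_min) auto
    then show "p \<in> realized n (\<lambda>x v _. ?Z x v)"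
      using x A(5)[OF x(6) appreciable_pos, of "min v 1"] by (intro realizedI[of p n x "min v 1" r]) auto
  qed (auto simp: S realized_def)
  moreover have "traced n (tuples n - realized n (\<lambda>x v _. ?Z x v))"
  proof (rule traced_compl_realized[OF fam'])
    show "\<exists>I\<subseteq>{..<n}. card I < Suc n \<and> (\<forall>i<n. x i \<in> dcl M (A \<union> x ` I))" for x
      using subset_dcl[of "A \<union> x ` {..<n}" M] by (intro exI[of _ "{..<n}"]) auto
  qed auto
  ultimately show ?thesis by simp
qed

end

section \<open>Sets definable in the induced structure\<close>

text \<open>Open cubes of radius 1/k form a neighbourhood base, because finitely many radii
  \<open>1 / real (\<kappa> i)\<close> have the common lower bound
  \<open>1 / real K\<close>.\<close>

lemma closedin_tuples_iff:
  fixes S :: "(nat \<Rightarrow> real) set"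
  shows "closedin (product_topology (\<lambda>_. euclideanreal) {..<n}) S \<longleftrightarrow>
    S \<subseteq> tuples n \<and> (\<forall>p\<in>tuples n. (\<forall>k>0. \<exists>s\<in>S. \<forall>i<n. \<bar>p i - s i\<bar> < 1 / real k) \<longrightarrow> p \<in> S)"
    (is "_ \<longleftrightarrow> _ \<and> ?adh")
proof (cases "S \<subseteq> tuples n")
  case S: True
  have "openin (product_topology (\<lambda>_. euclideanreal) {..<n}) (tuples n - S) \<longleftrightarrow> ?adh"
  proof
    assume op: "openin (product_topology (\<lambda>_. euclideanreal) {..<n}) (tuples n - S)"
    show ?adh
    proof (intro ballI impI, rule ccontr)
      fix p assume p: "p \<in> tuples n" and adh: "\<forall>k>0. \<exists>s\<in>S. \<forall>i<n. \<bar>p i - s i\<bar> < 1 / real k" and "p \<notin> S"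
      then have "p \<in> tuples n - S" by blast
      from op[unfolded openin_product_topology_alt, rule_format, OF this]
      obtain U where U: "\<forall>i\<in>{..<n}. openin euclideanreal (U i)" "p \<in> Pi\<^sub>E {..<n} U" "Pi\<^sub>E {..<n} U \<subseteq> tuples n - S"
        by (elim exE conjE) (rule that)
      have "\<exists>k::nat. k > 0 \<and> ball (p i) (1 / real k) \<subseteq> U i" if i: "i < n" for i
      proof -
        have "openin euclideanreal (U i)" "p i \<in> U i" using U(1,2) i by (auto simp: PiE_iff)
        then have "open (U i)" "p i \<in> U i" by (simp_all only: open_openin)
        then obtain e where e: "e > 0" "ball (p i) e \<subseteq> U i" using open_contains_ball by blast
        obtain k :: nat where "k > 0" "inverse (real k) < e" using ex_inverse_of_nat_less[OF e(1)] by blast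
        then have "ball (p i) (1 / real k) \<subseteq> ball (p i) e" by (intro subset_ball) (simp add: inverse_eq_divide)
        then show ?thesis using e(2) \<open>k > 0\<close> by blast
      qed
      then obtain \<kappa> :: "nat \<Rightarrow> nat" where \<kappa>: "\<And>i. i < n \<Longrightarrow> \<kappa> i > 0 \<and> ball (p i) (1 / real (\<kappa> i)) \<subseteq> U i" by metis
      define K where "K = Suc (\<Sum>i<n. \<kappa> i)"
      obtain s where s: "s \<in> S" "\<forall>i<n. \<bar>p i - s i\<bar> < 1 / real K" using adh unfolding K_def by blast
      have "s i \<in> U i" if i: "i < n" for i
      proof -
        have "\<kappa> i \<le> K" unfolding K_def using i member_le_sum[of i "{..<n}" \<kappa>] by simp
        then have "1 / real K \<le> 1 / real (\<kappa> i)" using \<kappa>[OF i] by (intro inverse_of_nat_mono) auto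
        then have "s i \<in> ball (p i) (1 / real (\<kappa> i))" using s(2) i by (force simp: dist_real_def)
        then show ?thesis using \<kappa>[OF i] by blast
      qed
      moreover have "s \<in> tuples n" using s(1) S by blast
      ultimately have "s \<in> Pi\<^sub>E {..<n} U" by (auto simp: PiE_iff)
      then show False using U(3) s(1) by blast
    qed
  next
    assume ?adh
    show "openin (product_topology (\<lambda>_. euclideanreal) {..<n}) (tuples n - S)"
      unfolding openin_product_topology_alt
    proof
      fix p assume p: "p \<in> tuples n - S"
      then have "p \<in> tuples n" "p \<notin> S" by simp_all
      have "\<not> (\<forall>k>0. \<exists>s\<in>S. \<forall>i<n. \<bar>p i - s i\<bar> < 1 / real k)"
        by (rule contrapos_nn[OF \<open>p \<notin> S\<close> mp[OF bspec[OF \<open>?adh\<close> \<open>p \<in> tuples n\<close>]]])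
      then obtain k where k: "k > 0" "\<not> (\<exists>s\<in>S. \<forall>i<n. \<bar>p i - s i\<bar> < 1 / real k)"
        unfolding not_all not_imp by (elim exE conjE) (rule that)
      show "\<exists>U. finite {i \<in> {..<n}. U i \<noteq> topspace euclideanreal} \<and> (\<forall>i\<in>{..<n}. openin euclideanreal (U i)) \<and>
        p \<in> Pi\<^sub>E {..<n} U \<and> Pi\<^sub>E {..<n} U \<subseteq> tuples n - S"
      proof (intro exI[of _ "\<lambda>i. ball (p i) (1 / real k)"] conjI)
        show "p \<in> Pi\<^sub>E {..<n} (\<lambda>i. ball (p i) (1 / real k))" using p k(1) by (auto simp: PiE_iff)
        show "Pi\<^sub>E {..<n} (\<lambda>i. ball (p i) (1 / real k)) \<subseteq> tuples n - S"
        proof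
          fix q assume q: "q \<in> Pi\<^sub>E {..<n} (\<lambda>i. ball (p i) (1 / real k))"
          then have "\<forall>i<n. \<bar>p i - q i\<bar> < 1 / real k" by (auto simp: PiE_iff dist_real_def)
          then have "q \<notin> S" using k(2) by blast
          moreover have "q \<in> tuples n" using q by (simp add: PiE_iff)
          ultimately show "q \<in> tuples n - S" by blast
        qed
        have "openin euclideanreal (ball (p i) (1 / real k))" for i
          by (simp only: open_openin[symmetric] open_ball)
        then show "\<forall>i\<in>{..<n}. openin euclideanreal (ball (p i) (1 / real k))" by blast
      qed simp
    qed
  qed
  then show ?thesis using S unfolding closedin_def by simp
qed (auto simp: closedin_def)

context saturated_o_minimal_field
begin

text \<open>\<open>g j\<close> is the value of the j-th argument of an atomic formula, a variable or
  a real constant. It is lifted to R, a constant becoming a parameter with that standard part, and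
  the lifted arguments are compared with points of \<open>X\<close> up to an infinitesimal.\<close>

lemma traced_Rel:
  fixes g :: "nat \<Rightarrow> (nat \<Rightarrow> real) \<Rightarrow> real"
  assumes A: "continuum_sized A" and def: "definable_pred M A (\<lambda>e. (\<lambda>i\<in>{..<m}. e i) \<in> X)" and X: "X \<subseteq> tuples m"
    and g: "\<And>j. j < m \<Longrightarrow> (\<exists>i<N. g j = (\<lambda>p. p i)) \<or> (\<exists>c. g j = (\<lambda>_. c))"
  shows "traced N {p \<in> tuples N. (\<lambda>j\<in>{..<m}. g j p) \<in> st_set m X}"
proof -
  define L where "L j h b \<longleftrightarrow> ((\<exists>i<N. h = (\<lambda>x. x i)) \<or> h = (\<lambda>_. b)) \<and>
    (\<forall>x p. near N x p \<longrightarrow> h x \<in> finite_elems \<and> standard_part (h x) = g j p)"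
    for j and h :: "(nat \<Rightarrow> 'a) \<Rightarrow> 'a" and b
  have ex: "\<exists>hb. L j (fst hb) (snd hb)" if j: "j < m" for j
    using g[OF j]
  proof (elim disjE exE conjE)
    fix i assume "i < N" "g j = (\<lambda>p. p i)"
    \<comment> \<open>\<open>undefined\<close> is a placeholder: only constants are lifted to a
      parameter.\<close>
    then show ?thesis unfolding L_def by (intro exI[of _ "(\<lambda>x. x i, undefined)"]) (auto simp: near_def)
  next
    fix c assume c: "g j = (\<lambda>_. c)"
    obtain b :: 'a where "b \<in> finite_elems" "standard_part b = c" using standard_part_surj by blast
    then show ?thesis using c unfolding L_def by (intro exI[of _ "(\<lambda>_. b, b)"]) auto
  qed
  define h where "h j = fst (SOME hb. L j (fst hb) (snd hb))" for j
  define b where "b j = snd (SOME hb. L j (fst hb) (snd hb))" for j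
  have L: "L j (h j) (b j)" if "j < m" for j
    unfolding h_def b_def by (rule someI_ex[OF ex[OF that]])
  have h: "(\<exists>i<N. h j = (\<lambda>x. x i)) \<or> h j = (\<lambda>_. b j)" if "j < m" for j
    using L[OF that] unfolding L_def by (rule conjunct1)
  have near_h: "h j x \<in> finite_elems \<and> standard_part (h j x) = g j p" if "j < m" "near N x p" for j x p
    using L[OF that(1)] that(2) unfolding L_def by simp
  let ?h = "\<lambda>x. \<lambda>j\<in>{..<m}. h j x" and ?g = "\<lambda>p. \<lambda>j\<in>{..<m}. g j p"
  have near: "near m (?h x) (?g p)" if "near N x p" for x p
    using near_h[OF _ that] by (auto simp: near_def)
  let ?B = "A \<union> ({0, 1} \<union> b ` {..<m})"
  have h_fun: "tuple_fun M ?B m (\<lambda>e. ?h (\<lambda>i\<in>{..<N}. e (i + k)))" for k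
    unfolding tuple_fun_def
  proof (intro conjI allI impI)
    fix j assume j: "j < m"
    from h[OF j] show "term_fun M ?B (\<lambda>e. ?h (\<lambda>i\<in>{..<N}. e (i + k)) j)"
      using j by (elim disjE exE conjE) (auto simp: term_fun_var term_fun_const)
  qed auto
  let ?Z = "\<lambda>x v r. \<exists>z\<in>tuples m. z \<in> X \<and> near_by m (?h x) z r"
  have "family ?B N ?Z"
  proof (rule familyI)
    show "continuum_sized ?B" by (intro continuum_sized_Un A continuum_sized_countable) auto
    have "definable_pred M ?B (\<lambda>e. (\<lambda>i\<in>{..<m}. e i) \<in> X \<and>
        near_by m (?h (\<lambda>i\<in>{..<N}. e (i + (2 + m)))) (\<lambda>i\<in>{..<m}. e i) (e (1 + m)))"
      by (intro definable_pred_conj definable_pred_mem[OF def] definable_pred_near_by h_fun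
          tuple_fun_vars[where f = "\<lambda>i. i"] term_fun_var) auto
    then show "definable_pred M ?B (\<lambda>e. ?Z (\<lambda>i\<in>{..<N}. e (i + 2)) (e 0) (e 1))"
      by (intro definable_pred_ex_tuple) (simp only: add.assoc)
    show "?Z x w s" if "?Z x v r" "r \<le> s" for x v w r s
      using that(1) near_by_mono[OF _ that(2)] by blast
  qed auto
  moreover have "{p \<in> tuples N. ?g p \<in> st_set m X} = realized N ?Z"
  proof (intro equalityI subsetI)
    fix p assume p: "p \<in> {p \<in> tuples N. ?g p \<in> st_set m X}"
    then obtain z where z: "z \<in> X" "near m z (?g p)" using st_set_iff[OF X] by blast
    obtain x :: "nat \<Rightarrow> 'a" where x: "x \<in> tuples N" "near N x p" using ex_near by blast
    obtain r where "infinitesimal r" "near_by m (?h x) z r"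
      using near_ex_near_by[OF near[OF x(2)] z(2)] by blast
    then show "p \<in> realized N ?Z"
      using p x z(1) X appreciable_inverse[of 1] by (intro realizedI[of p N x 1 r]) auto
  next
    fix p assume "p \<in> realized N ?Z"
    then obtain x v r where x: "p \<in> tuples N" "near N x p" "infinitesimal r" "?Z x v r" by (rule realizedE)
    then obtain z where z: "z \<in> X" "near_by m (?h x) z r" by blast
    have "near m z (?g p)" by (rule near_infinitesimal[OF near[OF x(2)] z(2) x(3)])
    moreover have "?g p \<in> tuples m" by simp
    ultimately have "?g p \<in> st_set m X" using st_set_iff[OF X] z(1) by blast
    then show "p \<in> {p \<in> tuples N. ?g p \<in> st_set m X}" using x(1) by blast
  qed
  ultimately show ?thesis unfolding traced_def by blast
qed

text \<open>Equality of reals is the standard part of the diagonal of R^2, so it is treated as a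
  basic relation.\<close>

lemma traced_Eq:
  fixes g h :: "(nat \<Rightarrow> real) \<Rightarrow> real"
  assumes "(\<exists>i<N. g = (\<lambda>p. p i)) \<or> (\<exists>c. g = (\<lambda>_. c))" "(\<exists>i<N. h = (\<lambda>p. p i)) \<or> (\<exists>c. h = (\<lambda>_. c))"
  shows "traced N {p \<in> tuples N. g p = h p}"
proof -
  let ?X = "{z :: nat \<Rightarrow> 'a. z \<in> tuples 2 \<and> z 0 = z 1}"
  let ?g = "\<lambda>j. if j = (0::nat) then g else h"
  have X: "?X \<subseteq> tuples 2" by blast
  have "definable_pred M {} (\<lambda>e. e 0 = e 1)" by (intro definable_pred_eq term_fun_var)
  then have def: "definable_pred M {} (\<lambda>e. (\<lambda>i\<in>{..<2}. e i) \<in> ?X)" by simp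
  have "traced N {p \<in> tuples N. (\<lambda>j\<in>{..<2}. ?g j p) \<in> st_set 2 ?X}"
    by (rule traced_Rel[OF _ def X]) (use assms in \<open>auto intro: continuum_sized_countable\<close>)
  moreover have "(\<lambda>j\<in>{..<2}. ?g j p) \<in> st_set 2 ?X \<longleftrightarrow> g p = h p" for p
  proof
    assume "(\<lambda>j\<in>{..<2}. ?g j p) \<in> st_set 2 ?X"
    then obtain z where "z \<in> ?X" "near 2 z (\<lambda>j\<in>{..<2}. ?g j p)" using st_set_iff[OF X] by blast
    then show "g p = h p" by (auto simp: near_def numeral_2_eq_2 All_less_Suc)
  next
    assume eq: "g p = h p"
    obtain a :: 'a where a: "a \<in> finite_elems" "standard_part a = g p" using standard_part_surj by blast
    have "(\<lambda>j\<in>{..<2}. a) \<in> ?X" "near 2 (\<lambda>j\<in>{..<2}. a) (\<lambda>j\<in>{..<2}. ?g j p)"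
      using a eq by (auto simp: near_def)
    moreover have "(\<lambda>j\<in>{..<2}. ?g j p) \<in> tuples 2" by simp
    ultimately show "(\<lambda>j\<in>{..<2}. ?g j p) \<in> st_set 2 ?X" using st_set_iff[OF X] by blast
  qed
  ultimately show ?thesis by simp
qed

section \<open>Formulas of the induced structure\<close>

lemma R_ind_trm:
  assumes "is_trm (R_ind M) A t" "fv_trm t \<subseteq> {..<N}"
  shows "(\<exists>i<N. (\<lambda>p. eval_trm (R_ind M) p t) = (\<lambda>p. p i)) \<or> (\<exists>c. (\<lambda>p. eval_trm (R_ind M) p t) = (\<lambda>_. c))"
  using assms by (cases t) (auto simp: R_ind_def)

text \<open>Variables are named by indices, bound ones included. In tuples long enough for all of
  these names a quantifier becomes a projection that forgets one coordinate, hence a claim for all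
  large \<open>N\<close> and not for the number of free variables.\<close>

lemma traced_R_ind:
  "is_fm (R_ind M) UNIV \<phi> \<Longrightarrow> \<exists>N0. \<forall>N\<ge>N0. traced N {p \<in> tuples N. sat (R_ind M) p \<phi>}"
proof (induction \<phi>)
  case (Eq s t)
  obtain N0 where N0: "fv_trm s \<union> fv_trm t \<subseteq> {..<N0}"
    using finite_nat_iff_bounded[of "fv_trm s \<union> fv_trm t"] finite_fv_trm by auto
  have "traced N {p \<in> tuples N. sat (R_ind M) p (Eq s t)}" if "N \<ge> N0" for N
    unfolding sat.simps
    by (rule traced_Eq; rule R_ind_trm) (use Eq N0 that in \<open>auto simp: subset_iff intro: less_le_trans\<close>)
  then show ?case by blast
next
  case (Rel c ts)
  obtain m X where c: "c = (m, st_set m X)" "definable M m X" using Rel by (auto simp: R_ind_def)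
  have len: "length ts = m" and ts: "\<forall>t\<in>set ts. is_trm (R_ind M) UNIV t" using Rel c(1) by (auto simp: R_ind_def)
  obtain A where A: "finite A" "definable_pred M A (\<lambda>e. (\<lambda>i\<in>{..<m}. e i) \<in> X)" "X \<subseteq> tuples m"
    using definable_pred_of_definable[OF c(2)] .
  have "finite (\<Union>t\<in>set ts. fv_trm t)" by (simp add: finite_fv_trm)
  then obtain N0 where N0: "(\<Union>t\<in>set ts. fv_trm t) \<subseteq> {..<N0}" using finite_nat_iff_bounded by blast
  have "traced N {p \<in> tuples N. sat (R_ind M) p (Rel c ts)}" if N: "N \<ge> N0" for N
  proof -
    have "traced N {p \<in> tuples N. (\<lambda>j\<in>{..<m}. eval_trm (R_ind M) p (ts ! j)) \<in> st_set m X}"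
    proof (rule traced_Rel[OF _ A(2,3)])
      show "continuum_sized A" using A(1) by (intro continuum_sized_countable countable_finite)
      fix j assume "j < m"
      then have "ts ! j \<in> set ts" using len by simp
      then have "is_trm (R_ind M) UNIV (ts ! j)" "fv_trm (ts ! j) \<subseteq> {..<N}" using ts N0 N by force+
      then show "(\<exists>i<N. (\<lambda>p. eval_trm (R_ind M) p (ts ! j)) = (\<lambda>p. p i)) \<or>
          (\<exists>c. (\<lambda>p. eval_trm (R_ind M) p (ts ! j)) = (\<lambda>_. c))" by (rule R_ind_trm)
    qed
    moreover have "tuple_of (map (eval_trm (R_ind M) p) ts) = (\<lambda>j\<in>{..<m}. eval_trm (R_ind M) p (ts ! j))" for p
      using len by (auto simp: tuple_of_def fun_eq_iff)
    moreover have "rinterp (R_ind M) c = st_set m X" by (simp add: c(1) R_ind_def)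
    ultimately show ?thesis by simp
  qed
  then show ?case by blast
next
  case (Neg \<phi>)
  then obtain N0 where N0: "\<And>N. N \<ge> N0 \<Longrightarrow> traced N {p \<in> tuples N. sat (R_ind M) p \<phi>}" by auto
  have "{p \<in> tuples N. sat (R_ind M) p (Neg \<phi>)} = tuples N - {p \<in> tuples N. sat (R_ind M) p \<phi>}" for N by auto
  then show ?case using N0 traced_compl by (intro exI[of _ N0]) simp
next
  case (Conj \<phi> \<psi>)
  then obtain N1 N2 where N1: "\<And>N. N \<ge> N1 \<Longrightarrow> traced N {p \<in> tuples N. sat (R_ind M) p \<phi>}"
    and N2: "\<And>N. N \<ge> N2 \<Longrightarrow> traced N {p \<in> tuples N. sat (R_ind M) p \<psi>}" by auto
  have "{p \<in> tuples N. sat (R_ind M) p (Conj \<phi> \<psi>)} =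
    {p \<in> tuples N. sat (R_ind M) p \<phi>} \<inter> {p \<in> tuples N. sat (R_ind M) p \<psi>}" for N by auto
  then show ?case using N1 N2 traced_Int by (intro exI[of _ "max N1 N2"]) simp
next
  case (Ex i \<phi>)
  then obtain N0 where N0: "\<And>N. N \<ge> N0 \<Longrightarrow> traced N {p \<in> tuples N. sat (R_ind M) p \<phi>}" by auto
  \<comment> \<open>The bound \<open>Suc i\<close> makes the quantified variable one of the
    coordinates.\<close>
  have "traced N {p \<in> tuples N. sat (R_ind M) p (Ex i \<phi>)}" if N: "N \<ge> max N0 (Suc i)" for N
  proof -
    let ?S = "{p \<in> tuples N. sat (R_ind M) p \<phi>}" and ?I = "{..<N} - {i}"
    have "traced N {p \<in> tuples N. \<exists>q\<in>?S. \<forall>j\<in>?I. p j = q j}"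
      by (rule traced_image) (use N0 N in auto)
    moreover have "sat (R_ind M) p (Ex i \<phi>) \<longleftrightarrow> (\<exists>q\<in>?S. \<forall>j\<in>?I. p j = q j)" if p: "p \<in> tuples N" for p
    proof
      assume "sat (R_ind M) p (Ex i \<phi>)"
      then obtain a where a: "sat (R_ind M) (p(i := a)) \<phi>" by auto
      have "p(i := a) \<in> tuples N" using p N by (auto simp: PiE_iff extensional_def)
      then show "\<exists>q\<in>?S. \<forall>j\<in>?I. p j = q j" using a by (intro bexI[of _ "p(i := a)"]) auto
    next
      assume "\<exists>q\<in>?S. \<forall>j\<in>?I. p j = q j"
      then obtain q where q: "q \<in> tuples N" "sat (R_ind M) q \<phi>" "\<forall>j\<in>?I. p j = q j" by blast
      have "q = p(i := q i)"
      proof (rule ext)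
        fix j
        show "q j = (p(i := q i)) j"
          using q(1,3) p by (cases "j = i"; cases "j < N") (auto simp: PiE_iff extensional_def)
      qed
      then show "sat (R_ind M) p (Ex i \<phi>)" using q(2) by (metis sat.simps(5))
    qed
    then have "{p \<in> tuples N. sat (R_ind M) p (Ex i \<phi>)} = {p \<in> tuples N. \<exists>q\<in>?S. \<forall>j\<in>?I. p j = q j}"
      by (intro Collect_cong conj_cong refl)
    ultimately show ?thesis by (simp only:)
  qed
  then show ?case by blast
qed

text \<open>The coordinates from \<open>n\<close> on do not occur free, so projecting from
  \<open>N\<close> to \<open>n\<close> coordinates preserves truth.\<close>

lemma traced_of_definable:
  assumes "definable (R_ind M) n S"
  shows "traced n S"
proof -
  obtain \<phi> where \<phi>: "is_fm (R_ind M) UNIV \<phi>" "fv \<phi> \<subseteq> {..<n}" "S = {p \<in> tuples n. sat (R_ind M) p \<phi>}"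
    using assms unfolding definable_def by blast
  obtain N0 where N0: "\<forall>N\<ge>N0. traced N {p \<in> tuples N. sat (R_ind M) p \<phi>}" using traced_R_ind[OF \<phi>(1)] by blast
  define N where "N = max n N0"
  let ?T = "{p \<in> tuples N. sat (R_ind M) p \<phi>}"
  have "traced n {p \<in> tuples n. \<exists>q\<in>?T. \<forall>i\<in>{..<n}. p i = q i}"
  proof (rule traced_image)
    show "traced N ?T" using N0 by (simp add: N_def del: sat.simps)
  qed (auto simp: N_def)
  moreover have "sat (R_ind M) p \<phi> \<longleftrightarrow> (\<exists>q\<in>?T. \<forall>i\<in>{..<n}. p i = q i)" for p
  proof
    let ?q = "\<lambda>i\<in>{..<N}. p i"
    assume "sat (R_ind M) p \<phi>"
    moreover have "sat (R_ind M) ?q \<phi> \<longleftrightarrow> sat (R_ind M) p \<phi>"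
      by (rule sat_cong) (use \<phi>(2) in \<open>auto simp: N_def\<close>)
    ultimately show "\<exists>q\<in>?T. \<forall>i\<in>{..<n}. p i = q i" by (intro bexI[of _ ?q]) (auto simp: N_def)
  next
    assume "\<exists>q\<in>?T. \<forall>i\<in>{..<n}. p i = q i"
    then obtain q where q: "sat (R_ind M) q \<phi>" "\<forall>i\<in>{..<n}. p i = q i" by blast
    have "sat (R_ind M) p \<phi> \<longleftrightarrow> sat (R_ind M) q \<phi>" by (rule sat_cong) (use \<phi>(2) q(2) in auto)
    then show "sat (R_ind M) p \<phi>" using q(1) by simp
  qed
  then have "S = {p \<in> tuples n. \<exists>q\<in>?T. \<forall>i\<in>{..<n}. p i = q i}"
    unfolding \<phi>(3) by (intro Collect_cong conj_cong refl)
  ultimately show ?thesis by (simp only:)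
qed

text \<open>The closure of a traced set is the standard part of one level set, and a closed set is
  its own closure.\<close>

lemma ex_st_set_of_closed:
  assumes "definable (R_ind M) n S" "closedin (product_topology (\<lambda>_. euclideanreal) {..<n}) S"
  shows "\<exists>X. definable M n X \<and> S = st_set n X"
proof -
  obtain B Y where BY: "family B n Y" "S = realized n Y"
    using traced_of_definable[OF assms(1)] unfolding traced_def by blast
  obtain A Z where fam: "family A n (\<lambda>x v _. Z x v)" and S: "S = realized n (\<lambda>x v _. Z x v)"
    using realized_fix_infinitesimal[OF BY(1)] unfolding BY(2)[symmetric] by (elim exE conjE) (rule that)
  obtain r where r: "\<forall>p\<in>tuples n. p \<in> st_set n {x \<in> tuples n. Z x r} \<longleftrightarrow> adherent n S p"
    using adherent_realized[OF fam] unfolding S by blast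
  let ?X = "{x \<in> tuples n. Z x r}"
  have cl: "S \<subseteq> tuples n" "\<And>p. p \<in> tuples n \<Longrightarrow> adherent n S p \<Longrightarrow> p \<in> S"
    using assms(2) unfolding closedin_tuples_iff adherent_def by blast+
  have "S = st_set n ?X"
  proof (intro equalityI subsetI)
    fix p assume "p \<in> S"
    then show "p \<in> st_set n ?X" using cl(1) r adherent_self by blast
  next
    fix p assume p: "p \<in> st_set n ?X"
    then have "p \<in> tuples n" using st_set_iff[of ?X n p] by blast
    then show "p \<in> S" using cl(2) r p by blast
  qed
  \<comment> \<open>Restricting the environment gives \<open>Z\<close> a tuple of the first
    \<open>n\<close> variables as argument, which is the form covered by the definability of the
    family; on extensional tuples nothing changes.\<close>
  moreover have "definable M n {x \<in> tuples n. Z (\<lambda>i\<in>{..<n}. x i) r}"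
  proof (rule definable_of_pred)
    show "definable_pred M (insert r A) (\<lambda>e. Z (\<lambda>i\<in>{..<n}. e i) r)"
      by (rule definable_pred_family[OF fam])
         (auto intro: tuple_fun_vars[where f = "\<lambda>i. i"] term_fun_const)
  qed
  moreover have "{x \<in> tuples n. Z (\<lambda>i\<in>{..<n}. x i) r} = ?X"
    by (intro Collect_cong conj_cong refl) (simp add: PiE_restrict)
  ultimately show ?thesis by metis
qed

section \<open>Standard parts of definable sets are definable and closed\<close>

lemma definable_st_set:
  assumes "definable M n X"
  shows "definable (R_ind M) n (st_set n X)"
proof -
  let ?\<phi> = "Rel (n, st_set n X) (map Var [0..<n])"
  have "is_fm (R_ind M) UNIV ?\<phi>" using assms by (auto simp: R_ind_def)
  moreover have "fv ?\<phi> \<subseteq> {..<n}" by auto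
  moreover have "st_set n X = {x \<in> tuples n. sat (R_ind M) x ?\<phi>}"
  proof -
    have "tuple_of (map (eval_trm (R_ind M) x) (map Var [0..<n])) = x" if "x \<in> tuples n" for x
      using that by (auto simp: tuple_of_def fun_eq_iff PiE_iff extensional_def)
    moreover have "st_set n X \<subseteq> tuples n" by (auto simp: st_set_def st_tuple_def)
    ultimately show ?thesis by (auto simp: R_ind_def simp del: map_map)
  qed
  ultimately show ?thesis unfolding definable_def by blast
qed

lemma closedin_st_set:
  assumes "definable M n X"
  shows "closedin (product_topology (\<lambda>_. euclideanreal) {..<n}) (st_set n X)"
proof -
  obtain A where A: "finite A" "definable_pred M A (\<lambda>e. (\<lambda>i\<in>{..<n}. e i) \<in> X)" "X \<subseteq> tuples n"
    using definable_pred_of_definable[OF assms] .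
  have "st_set n X \<subseteq> tuples n" by (auto simp: st_set_def st_tuple_def)
  then show ?thesis unfolding closedin_tuples_iff using st_set_adherent[OF A(2,3)] by blast
qed

end

theorem proposition5p1:
  fixes M :: "('f, 'r, 'a::linordered_field) fo_struct" and n :: nat
  assumes "expands_ordered_field M"
    and "o_minimal M"
    and "saturated (cardSuc (ctwo ^c natLeq)) M"
    and "n \<ge> 1"
  shows "{S. definable (R_ind M) n S \<and> closedin (product_topology (\<lambda>_. euclideanreal) {..<n}) S}
       = {st_set n X | X. definable M n X}"
proof -
  interpret saturated_o_minimal_field M using assms(1-3) by unfold_locales
  show ?thesis using ex_st_set_of_closed definable_st_set closedin_st_set by blast
qed

end
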